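(* Let $(R,m)$ be a Noetherian local ring and let $N$ be a finitely generated $R$-module. If $x\in mN$, then $$\dim R/N^*(x) \geq \dim R/Q-\mu_Q(N)$$ for every minimal prime $Q$ of $R$; thus for every such $Q$, $$\operatorname{ht} N^*(x) \leq \dim R-\dim R/Q +\mu_Q(N).$$
   Context: All rings are commutative with $1$. For an $R$-module $N$ and $x\in N$, the order ideal of $x$ is $N^*(x)=\{\varphi(x)\mid \varphi\in \operatorname{Hom}_R(N,R)\}\subset R$. For a prime $Q\subset R$, $\mu_Q(N)$ denotes the minimal number of generators of the $R_Q$-module $N_Q$. $\operatorname{ht}$ denotes the height of an ideal and $\dim$ denotes Krull dimension. *)

theory Defs
  imports "HOL-Algebra.Module" "HOL-Algebra.Ring_Divisibility" "HOL-Library.Extended_Real"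
begin

section \<open>Local rings, minimal primes, Krull dimension and height\<close>

definition local_ring :: "('a, 'r) ring_scheme \<Rightarrow> 'a set \<Rightarrow> bool" where
  "local_ring R m \<longleftrightarrow> cring R \<and> maximalideal m R \<and> (\<forall>n. maximalideal n R \<longrightarrow> n = m)"

definition minimal_prime :: "('a, 'r) ring_scheme \<Rightarrow> 'a set \<Rightarrow> bool" where
  "minimal_prime R Q \<longleftrightarrow>
     primeideal Q R \<and> (\<forall>P. primeideal P R \<and> P \<subseteq> Q \<longrightarrow> P = Q)"

definition prime_chain :: "('a, 'r) ring_scheme \<Rightarrow> (nat \<Rightarrow> 'a set) \<Rightarrow> nat \<Rightarrow> bool" where
  "prime_chain R p n \<longleftrightarrow>
     (\<forall>i\<le>n. primeideal (p i) R) \<and> (\<forall>i<n. p i \<subset> p (Suc i))"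

text \<open>Dimension, height and numbers of generators take values in \<^typ>\<open>ereal\<close>, so that
  differences are not truncated. The zero ring has dimension \<open>-\<infinity>\<close>, and the unit
  ideal has height \<open>\<infinity>\<close>.\<close>

definition krull_dim :: "('a, 'r) ring_scheme \<Rightarrow> ereal" where
  "krull_dim R = (SUP n \<in> {n. \<exists>p. prime_chain R p n}. ereal (real n))"

definition prime_height :: "('a, 'r) ring_scheme \<Rightarrow> 'a set \<Rightarrow> ereal" where
  "prime_height R P = (SUP n \<in> {n. \<exists>p. prime_chain R p n \<and> p n = P}. ereal (real n))"

definition ideal_height :: "('a, 'r) ring_scheme \<Rightarrow> 'a set \<Rightarrow> ereal" where
  "ideal_height R I = (INF P \<in> {P. primeideal P R \<and> I \<subseteq> P}. prime_height R P)"


section \<open>Generators of modules\<close>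

definition module_span ::
  "('a, 'r) ring_scheme \<Rightarrow> ('a, 'b, 'm) module_scheme \<Rightarrow> 'b set \<Rightarrow> 'b set" where
  "module_span R M A = \<Inter> {H. submodule H R M \<and> A \<subseteq> H}"

definition finite_generating_set ::
  "('a, 'r) ring_scheme \<Rightarrow> ('a, 'b, 'm) module_scheme \<Rightarrow> 'b set \<Rightarrow> bool" where
  "finite_generating_set R M A \<longleftrightarrow>
     finite A \<and> A \<subseteq> carrier M \<and> module_span R M A = carrier M"

definition finitely_generated_module ::
  "('a, 'r) ring_scheme \<Rightarrow> ('a, 'b, 'm) module_scheme \<Rightarrow> bool" where
  "finitely_generated_module R M \<longleftrightarrow> (\<exists>A. finite_generating_set R M A)"

definition min_generators ::
  "('a, 'r) ring_scheme \<Rightarrow> ('a, 'b, 'm) module_scheme \<Rightarrow> ereal" where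
  "min_generators R M = (INF A \<in> {A. finite_generating_set R M A}. ereal (real (card A)))"

definition ideal_smult ::
  "('a, 'r) ring_scheme \<Rightarrow> 'a set \<Rightarrow> ('a, 'b, 'm) module_scheme \<Rightarrow> 'b set" where
  "ideal_smult R I M = module_span R M {a \<odot>\<^bsub>M\<^esub> y | a y. a \<in> I \<and> y \<in> carrier M}"


section \<open>Module homomorphisms and order ideals\<close>

definition self_module :: "('a, 'r) ring_scheme \<Rightarrow> ('a, 'a) module" where
  "self_module R =
     \<lparr>carrier = carrier R, monoid.mult = monoid.mult R, monoid.one = \<one>\<^bsub>R\<^esub>, ring.zero = \<zero>\<^bsub>R\<^esub>, ring.add = ring.add R, smult = monoid.mult R\<rparr>"

definition module_hom ::
  "('a, 'r) ring_scheme \<Rightarrow> ('a, 'b, 'm) module_scheme \<Rightarrow> ('a, 'c, 'n) module_scheme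
     \<Rightarrow> ('b \<Rightarrow> 'c) set" where
  "module_hom R M N =
     {\<phi> \<in> carrier M \<rightarrow> carrier N.
        (\<forall>x \<in> carrier M. \<forall>y \<in> carrier M. \<phi> (x \<oplus>\<^bsub>M\<^esub> y) = \<phi> x \<oplus>\<^bsub>N\<^esub> \<phi> y) \<and>
        (\<forall>a \<in> carrier R. \<forall>x \<in> carrier M. \<phi> (a \<odot>\<^bsub>M\<^esub> x) = a \<odot>\<^bsub>N\<^esub> \<phi> x)}"

definition order_ideal ::
  "('a, 'r) ring_scheme \<Rightarrow> ('a, 'b, 'm) module_scheme \<Rightarrow> 'b \<Rightarrow> 'a set" where
  "order_ideal R M x = {\<phi> x | \<phi>. \<phi> \<in> module_hom R M (self_module R)}"


section \<open>Localization\<close>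

text \<open>\<open>fraction R S M x s\<close> is the fraction \<open>x/s\<close>, as the class of \<open>(x, s)\<close> for the relation
  that identifies \<open>(x, s)\<close> and \<open>(y, t)\<close> when \<open>u(tx) = u(sy)\<close> for some \<open>u\<close> in the
  multiplicative set \<open>S\<close>. As for cosets in \<^const>\<open>rcoset_mult\<close>, an operation on fractions
  is the union of the results over all representatives; these results all coincide.\<close>

definition fraction ::
  "('a, 'r) ring_scheme \<Rightarrow> 'a set \<Rightarrow> ('a, 'b, 'm) module_scheme \<Rightarrow> 'b \<Rightarrow> 'a \<Rightarrow> ('b \<times> 'a) set" where
  "fraction R S M x s =
     {(y, t). y \<in> carrier M \<and> t \<in> S \<and>
        (\<exists>u \<in> S. u \<odot>\<^bsub>M\<^esub> (t \<odot>\<^bsub>M\<^esub> x) = u \<odot>\<^bsub>M\<^esub> (s \<odot>\<^bsub>M\<^esub> y))}"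

definition fraction_add ::
  "('a, 'r) ring_scheme \<Rightarrow> 'a set \<Rightarrow> ('a, 'b, 'm) module_scheme
     \<Rightarrow> ('b \<times> 'a) set \<Rightarrow> ('b \<times> 'a) set \<Rightarrow> ('b \<times> 'a) set" where
  "fraction_add R S M X Y =
     (\<Union>(x, s) \<in> X. \<Union>(y, t) \<in> Y.
        fraction R S M ((t \<odot>\<^bsub>M\<^esub> x) \<oplus>\<^bsub>M\<^esub> (s \<odot>\<^bsub>M\<^esub> y)) (s \<otimes>\<^bsub>R\<^esub> t))"

definition fraction_smult ::
  "('a, 'r) ring_scheme \<Rightarrow> 'a set \<Rightarrow> ('a, 'b, 'm) module_scheme
     \<Rightarrow> ('a \<times> 'a) set \<Rightarrow> ('b \<times> 'a) set \<Rightarrow> ('b \<times> 'a) set" where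
  "fraction_smult R S M A X =
     (\<Union>(a, s) \<in> A. \<Union>(x, t) \<in> X. fraction R S M (a \<odot>\<^bsub>M\<^esub> x) (s \<otimes>\<^bsub>R\<^esub> t))"

definition localization_ring ::
  "('a, 'r) ring_scheme \<Rightarrow> 'a set \<Rightarrow> ('a \<times> 'a) set ring" where
  "localization_ring R S =
     \<lparr>carrier = {fraction R S (self_module R) a s | a s. a \<in> carrier R \<and> s \<in> S},
      monoid.mult = fraction_smult R S (self_module R),
      monoid.one = fraction R S (self_module R) \<one>\<^bsub>R\<^esub> \<one>\<^bsub>R\<^esub>,
      ring.zero = fraction R S (self_module R) \<zero>\<^bsub>R\<^esub> \<one>\<^bsub>R\<^esub>,
      ring.add = fraction_add R S (self_module R)\<rparr>"

text \<open>The record type of modules inherits \<^const>\<open>monoid.mult\<close> and \<^const>\<open>monoid.one\<close> from rings; they play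
  no role for modules.\<close>

definition localization_module ::
  "('a, 'r) ring_scheme \<Rightarrow> 'a set \<Rightarrow> ('a, 'b, 'm) module_scheme
     \<Rightarrow> (('a \<times> 'a) set, ('b \<times> 'a) set) module" where
  "localization_module R S M =
     \<lparr>carrier = {fraction R S M x s | x s. x \<in> carrier M \<and> s \<in> S},
      monoid.mult = undefined,
      monoid.one = undefined,
      ring.zero = fraction R S M \<zero>\<^bsub>M\<^esub> \<one>\<^bsub>R\<^esub>,
      ring.add = fraction_add R S M,
      smult = fraction_smult R S M\<rparr>"

definition local_min_generators ::
  "('a, 'r) ring_scheme \<Rightarrow> 'a set \<Rightarrow> ('a, 'b, 'm) module_scheme \<Rightarrow> ereal" where
  "local_min_generators R Q M =
     min_generators (localization_ring R (carrier R - Q))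
       (localization_module R (carrier R - Q) M)"

end

theory Submission
  imports Defs "HOL-Algebra.Subrings" "HOL-Algebra.QuotRing"
begin

text \<open>Write \<open>x = \<Sum> a\<^sub>i n\<^sub>i\<close> with \<open>a\<^sub>i \<in> m\<close> for \<open>i < s\<close>, and choose \<open>\<mu> = \<mu>\<^sub>Q(N)\<close> elements \<open>e\<close> of \<open>N\<close> generating
  \<open>N\<^sub>Q\<close>, so that \<open>u\<^sub>i n\<^sub>i = \<Sum> c\<^sub>i\<^sub>e e\<close> with \<open>u\<^sub>i \<notin> Q\<close>. In the polynomial ring over \<open>R\<close> in \<open>s\<close> variables
  let \<open>T\<close> be the subalgebra generated by the linear forms \<open>Y\<^sub>i = u\<^sub>i w\<^sub>i\<close> and \<open>Z\<^sub>e = \<Sum> c\<^sub>i\<^sub>e w\<^sub>i\<close>. It has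
  a chain of primes of length \<open>s\<close> from the kernel of reduction modulo \<open>Q\<close> up to the elements vanishing
  modulo \<open>Q\<close> at the origin, and
  above that a copy of every chain of primes of \<open>R\<close> above \<open>Q\<close>. By the principal ideal theorem, imposing
  the \<open>s + \<mu>\<close> equations \<open>Y\<^sub>i = a\<^sub>i\<close> and \<open>Z\<^sub>e = 0\<close> lowers the length of such a chain from \<open>s + d\<close> to at
  least \<open>d - \<mu>\<close>. Polynomials are represented by functions on \<open>R\<^sup>s\<close>, which suffices because \<open>R/Q\<close> is infinite
  when \<open>d > 0\<close>. Modulo these equations \<open>T\<close> is a quotient of \<open>R\<close>, and for \<open>\<phi> \<in> N\<^sup>*\<close> the identity
  \<open>\<Sum> \<phi>(n\<^sub>i) Y\<^sub>i = \<Sum> \<phi>(e) Z\<^sub>e\<close> shows that \<open>\<phi>(x) = \<Sum> \<phi>(n\<^sub>i) a\<^sub>i\<close> vanishes there.\<close>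

text \<open>For a free module the bound is the principal ideal theorem in \<open>R\<close> itself:
  the order ideal is generated by the \<mu> coordinates of \<open>x\<close>. In general the
  \<open>e\<close> generate only after the \<open>u\<^sub>i\<close> are inverted, so the order ideal
  need not have so few generators over \<open>R\<close>. The equations are therefore imposed in a
  larger ring, where the \<open>s\<close> additional ones are paid for by \<open>s\<close>
  additional steps of the chain. The factors \<open>u\<^sub>i\<close> have two duties: they make the
  relations available over \<open>R\<close>, and being outside \<open>Q\<close> they keep each
  \<open>Y\<^sub>i\<close> nonzero modulo \<open>Q\<close>, so that those \<open>s\<close> steps are
  strict. The subalgebra \<open>T\<close> is used instead of the whole polynomial ring because a
  ring generated by the equated forms collapses to a quotient of \<open>R\<close>; this makes
  distinct primes above the equations contract to distinct primes of \<open>R\<close>. Finally,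
  \<open>x \<in> m N\<close> enters through \<open>a\<^sub>i \<in> m\<close>: it puts all equations
  into the prime of functions whose value at the origin lies in \<open>m\<close>, which has to be
  the top of the chain before anything is imposed.\<close>

lemma (in cring) ideal_of_closed:
  assumes "I \<subseteq> carrier R" "\<zero> \<in> I"
    and "\<And>a b. a \<in> I \<Longrightarrow> b \<in> I \<Longrightarrow> a \<oplus> b \<in> I"
    and "\<And>a r. a \<in> I \<Longrightarrow> r \<in> carrier R \<Longrightarrow> r \<otimes> a \<in> I"
  shows "ideal I R"
proof (rule idealI[OF ring_axioms])
  have "\<ominus> a \<in> I" if "a \<in> I" for a
  proof -
    have "\<ominus> \<one> \<otimes> a = \<ominus> a" using that assms(1) by (simp add: l_minus subsetD)
    then show ?thesis using assms(4)[OF that, of "\<ominus> \<one>"] by simp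
  qed
  then show "subgroup I (add_monoid R)"
    using assms by unfold_locales (auto simp: a_inv_def[symmetric] subsetD add.group_l_invI)
  show "a \<otimes> r \<in> I" if "a \<in> I" "r \<in> carrier R" for a r
    using that assms(1,4) by (metis m_comm subsetD)
qed (use assms in auto)

lemma (in ideal) minus_closed_ideal: "a \<in> I \<Longrightarrow> b \<in> I \<Longrightarrow> a \<ominus> b \<in> I"
  by (simp add: a_minus_def)

section \<open>Ideals saturated with respect to a prime\<close>

locale noetherian_cring = noetherian_ring + cring

text \<open>Ideals of the localization at \<open>p\<close> correspond to the saturated ideals; working with the
  latter makes it unnecessary to form the localization in the principal ideal theorem.\<close>

definition sat_ideal :: "('a, 'r) ring_scheme \<Rightarrow> 'a set \<Rightarrow> 'a set \<Rightarrow> bool" where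
  "sat_ideal R p I \<longleftrightarrow> ideal I R \<and>
     (\<forall>u \<in> carrier R - p. \<forall>s \<in> carrier R. u \<otimes>\<^bsub>R\<^esub> s \<in> I \<longrightarrow> s \<in> I)"

lemma sat_ideal_ideal: "sat_ideal R p I \<Longrightarrow> ideal I R"
  by (simp add: sat_ideal_def)

lemma sat_idealD:
  "sat_ideal R p I \<Longrightarrow> u \<in> carrier R - p \<Longrightarrow> s \<in> carrier R \<Longrightarrow> u \<otimes>\<^bsub>R\<^esub> s \<in> I \<Longrightarrow> s \<in> I"
  unfolding sat_ideal_def by blast

text \<open>The preimage in \<open>R\<close> of the ideal that \<open>I\<close> and \<open>f\<close>
  generate in the localization at \<open>p\<close>.\<close>

definition sat_extend :: "('a, 'r) ring_scheme \<Rightarrow> 'a set \<Rightarrow> 'a set \<Rightarrow> 'a \<Rightarrow> 'a set" where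
  "sat_extend R p I f = {s \<in> carrier R. \<exists>u \<in> carrier R - p. \<exists>i \<in> I. \<exists>r \<in> carrier R.
     u \<otimes>\<^bsub>R\<^esub> s = i \<oplus>\<^bsub>R\<^esub> r \<otimes>\<^bsub>R\<^esub> f}"

lemma (in primeideal) one_notin: "\<one> \<notin> I"
  using I_notcarr one_imp_carrier by blast

lemma (in primeideal) mult_notin:
  "a \<in> carrier R - I \<Longrightarrow> b \<in> carrier R - I \<Longrightarrow> a \<otimes> b \<in> carrier R - I"
  using I_prime by auto

lemma (in cring) sat_ideal_extend:
  assumes p: "primeideal p R" and I: "ideal I R" and f: "f \<in> carrier R"
  shows "sat_ideal R p (sat_extend R p I f)" "I \<subseteq> sat_extend R p I f" "f \<in> sat_extend R p I f"
proof -
  interpret p: primeideal p R by fact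
  interpret I: ideal I R by fact
  let ?E = "sat_extend R p I f"
  have id: "ideal ?E R"
  proof (rule ideal_of_closed)
    show "?E \<subseteq> carrier R" by (auto simp: sat_extend_def)
    have "\<one> \<otimes> \<zero> = \<zero> \<oplus> \<zero> \<otimes> f" using f by simp
    then show "\<zero> \<in> ?E" unfolding sat_extend_def using p.one_notin I.zero_closed by blast
    show "a \<oplus> b \<in> ?E" if "a \<in> ?E" "b \<in> ?E" for a b
    proof -
      obtain u i r where u: "u \<in> carrier R - p" "i \<in> I" "r \<in> carrier R" "u \<otimes> a = i \<oplus> r \<otimes> f"
        and a: "a \<in> carrier R"
        using \<open>a \<in> ?E\<close> unfolding sat_extend_def by blast
      obtain v j t where v: "v \<in> carrier R - p" "j \<in> I" "t \<in> carrier R" "v \<otimes> b = j \<oplus> t \<otimes> f"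
        and b: "b \<in> carrier R"
        using \<open>b \<in> ?E\<close> unfolding sat_extend_def by blast
      have c: "i \<in> carrier R" "j \<in> carrier R" "u \<in> carrier R" "v \<in> carrier R" using u v I.Icarr by auto
      have "(u \<otimes> v) \<otimes> (a \<oplus> b) = v \<otimes> (u \<otimes> a) \<oplus> u \<otimes> (v \<otimes> b)"
        using c a b by algebra
      also have "\<dots> = (v \<otimes> i \<oplus> u \<otimes> j) \<oplus> (v \<otimes> r \<oplus> u \<otimes> t) \<otimes> f"
        unfolding u(4) v(4) using c a b u(3) v(3) f by algebra
      finally have eq: "(u \<otimes> v) \<otimes> (a \<oplus> b) = (v \<otimes> i \<oplus> u \<otimes> j) \<oplus> (v \<otimes> r \<oplus> u \<otimes> t) \<otimes> f" .
      moreover have "v \<otimes> i \<oplus> u \<otimes> j \<in> I" using u v c by (simp add: I.I_l_closed)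
      moreover have "v \<otimes> r \<oplus> u \<otimes> t \<in> carrier R" "a \<oplus> b \<in> carrier R" using u v c a b by auto
      ultimately show ?thesis
        using p.mult_notin[OF u(1) v(1)] unfolding sat_extend_def by blast
    qed
    show "t \<otimes> a \<in> ?E" if "a \<in> ?E" and t: "t \<in> carrier R" for a t
    proof -
      obtain u i r where u: "u \<in> carrier R - p" "i \<in> I" "r \<in> carrier R" "u \<otimes> a = i \<oplus> r \<otimes> f"
        and a: "a \<in> carrier R"
        using \<open>a \<in> ?E\<close> unfolding sat_extend_def by blast
      have c: "i \<in> carrier R" "u \<in> carrier R" using u I.Icarr by auto
      have "u \<otimes> (t \<otimes> a) = t \<otimes> (u \<otimes> a)" using c a t by algebra
      also have "\<dots> = t \<otimes> i \<oplus> (t \<otimes> r) \<otimes> f" unfolding u(4) using c u(3) t f by algebra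
      finally have "u \<otimes> (t \<otimes> a) = t \<otimes> i \<oplus> (t \<otimes> r) \<otimes> f" .
      moreover have "t \<otimes> i \<in> I" "t \<otimes> r \<in> carrier R" "t \<otimes> a \<in> carrier R"
        using u t a by (auto simp: I.I_l_closed)
      ultimately show ?thesis using u(1) unfolding sat_extend_def by blast
    qed
  qed
  have "s \<in> ?E" if v: "v \<in> carrier R - p" and s: "s \<in> carrier R" and vs: "v \<otimes> s \<in> ?E" for v s
  proof -
    obtain u i r where u: "u \<in> carrier R - p" "i \<in> I" "r \<in> carrier R" "u \<otimes> (v \<otimes> s) = i \<oplus> r \<otimes> f"
      using vs unfolding sat_extend_def by blast
    have "(u \<otimes> v) \<otimes> s = i \<oplus> r \<otimes> f" using u(1,4) v s by (simp add: m_assoc)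
    then show ?thesis using p.mult_notin[OF u(1) v] u(2,3) s unfolding sat_extend_def by blast
  qed
  then show "sat_ideal R p ?E" unfolding sat_ideal_def using id by blast
  show "I \<subseteq> ?E"
  proof
    fix i assume i: "i \<in> I"
    then have "\<one> \<otimes> i = i \<oplus> \<zero> \<otimes> f" using f I.Icarr by simp
    then show "i \<in> ?E" unfolding sat_extend_def using i I.Icarr p.one_notin by blast
  qed
  have "\<one> \<otimes> f = \<zero> \<oplus> \<one> \<otimes> f" using f by simp
  then show "f \<in> ?E" unfolding sat_extend_def using f I.zero_closed p.one_notin by blast
qed

lemma (in cring) sat_extend_mono:
  "I \<subseteq> J \<Longrightarrow> sat_extend R p I f \<subseteq> sat_extend R p J f"
  unfolding sat_extend_def by blast

lemma (in cring) sat_ideal_colon: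
  assumes p: "primeideal p R" and I: "sat_ideal R p I" and f: "f \<in> carrier R"
  shows "sat_ideal R p {s \<in> carrier R. s \<otimes> f \<in> I}" (is "sat_ideal R p ?C")
proof -
  interpret I: ideal I R using I by (simp add: sat_ideal_def)
  have "ideal ?C R"
    using f by (intro ideal_of_closed)
      (auto simp: l_distr m_assoc I.I_l_closed)
  moreover have "s \<in> ?C" if u: "u \<in> carrier R - p" and s: "s \<in> carrier R" and us: "u \<otimes> s \<in> ?C" for u s
  proof -
    have "u \<otimes> (s \<otimes> f) \<in> I" using u s us f by (simp add: m_assoc)
    then show ?thesis using sat_idealD[OF I u] s f by blast
  qed
  ultimately show ?thesis unfolding sat_ideal_def by blast
qed

text \<open>An element of \<open>I\<close> outside \<open>p\<close> would be a unit in the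
  localization: it multiplies \<open>\<one>\<close> into \<open>I\<close>, and saturation then
  returns \<open>\<one>\<close>.\<close>

lemma (in cring) sat_ideal_proper:
  assumes I: "sat_ideal R p I" and "I \<noteq> carrier R"
  shows "I \<subseteq> p"
proof
  interpret I: ideal I R using I by (simp add: sat_ideal_def)
  fix u assume u: "u \<in> I"
  show "u \<in> p"
  proof (rule ccontr)
    assume "u \<notin> p"
    then have "\<one> \<in> I"
      using I u I.Icarr unfolding sat_ideal_def by (metis Diff_iff one_closed r_one)
    then show False using I.one_imp_carrier assms(2) by blast
  qed
qed

lemma (in cring) sat_ideal_prime:
  assumes "primeideal q R" "q \<subseteq> p"
  shows "sat_ideal R p q"
proof -
  interpret q: primeideal q R by fact
  show ?thesis unfolding sat_ideal_def using q.is_ideal q.I_prime assms(2) by blast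
qed

text \<open>The union of a nonempty chain of ideals in a Noetherian ring is a member of the chain,
  so Zorn's lemma applies to an arbitrary family \<open>F\<close>, with no closure under
  unions.\<close>

lemma (in noetherian_ring) exists_maximal_ideal_in:
  assumes "F \<noteq> {}" and "\<And>I. I \<in> F \<Longrightarrow> ideal I R"
  shows "\<exists>M\<in>F. \<forall>J\<in>F. M \<subseteq> J \<longrightarrow> J = M"
proof (rule subset_Zorn_nonempty[OF assms(1)])
  fix C assume C: "C \<noteq> {}" "subset.chain F C"
  have CF: "C \<subseteq> F" using C(2) by (simp add: subset.chain_def)
  then have "C \<subseteq> {I. ideal I R}" using assms(2) by blast
  then have "subset.chain {I. ideal I R} C" using C(2) by (simp add: subset.chain_def)
  then have "\<Union>C \<in> C" by (rule ideal_chain_is_trivial[OF C(1)])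
  then show "\<Union>C \<in> F" using CF by (rule rev_subsetD)
qed

text \<open>This plays the role of Nakayama's lemma over the localization at \<open>p\<close>; \<open>L\<close> is a maximal proper
  saturated ideal between \<open>M'\<close> and \<open>M\<close>.\<close>

lemma (in noetherian_cring) sat_ideal_nakayama:
  assumes p: "primeideal p R" and M: "sat_ideal R p M" and M': "sat_ideal R p M'" "M' \<subset> M"
  obtains L where "sat_ideal R p L" "M' \<subseteq> L" "L \<subset> M"
    "\<And>t z. t \<in> p \<Longrightarrow> z \<in> M \<Longrightarrow> t \<otimes> z \<in> L"
proof -
  interpret p: primeideal p R by fact
  interpret M: ideal M R using M by (simp add: sat_ideal_def)
  define F where "F = {L. sat_ideal R p L \<and> M' \<subseteq> L \<and> L \<subset> M}"
  have "F \<noteq> {}" unfolding F_def using M' by auto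
  moreover have "ideal K R" if "K \<in> F" for K using that by (simp add: F_def sat_ideal_def)
  ultimately obtain L where L: "L \<in> F" "\<And>J. J \<in> F \<Longrightarrow> L \<subseteq> J \<Longrightarrow> J = L"
    using exists_maximal_ideal_in[of F] by blast
  have L': "sat_ideal R p L" "M' \<subseteq> L" "L \<subset> M" using L(1) unfolding F_def by auto
  interpret L: ideal L R using L' by (simp add: sat_ideal_def)
  have "t \<otimes> z \<in> L" if t: "t \<in> p" and z: "z \<in> M" for t z
  proof (rule ccontr)
    assume tz: "t \<otimes> z \<notin> L"
    have c: "t \<in> carrier R" "z \<in> carrier R" using t z p.Icarr M.Icarr by auto
    let ?E = "sat_extend R p L (t \<otimes> z)"
    have E: "sat_ideal R p ?E" "L \<subseteq> ?E" "t \<otimes> z \<in> ?E"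
      using sat_ideal_extend[OF p L.is_ideal, of "t \<otimes> z"] c by auto
    have EM: "?E \<subseteq> M"
    proof
      fix s assume "s \<in> ?E"
      then obtain u i r where u: "u \<in> carrier R - p" "i \<in> L" "r \<in> carrier R" "u \<otimes> s = i \<oplus> r \<otimes> (t \<otimes> z)"
        and s: "s \<in> carrier R" unfolding sat_extend_def by blast
      have "i \<oplus> r \<otimes> (t \<otimes> z) \<in> M" using u L'(3) z c by (auto simp: M.I_l_closed)
      then show "s \<in> M" using sat_idealD[OF M u(1) s] u(4) by simp
    qed
    have "?E = M"
    proof (rule ccontr)
      assume "?E \<noteq> M"
      then have "?E \<in> F" unfolding F_def using E EM L' by blast
      then show False using L(2) E tz by blast
    qed
    then have "z \<in> ?E" using z by simp
    then obtain u i r where u: "u \<in> carrier R - p" "i \<in> L" "r \<in> carrier R" "u \<otimes> z = i \<oplus> r \<otimes> (t \<otimes> z)"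
      unfolding sat_extend_def by blast
    have cc: "u \<in> carrier R" "i \<in> carrier R" using u L.Icarr by auto
    \<comment> \<open>The factor \<open>u \<ominus> r \<otimes> t\<close> takes the place of the
      unit \<open>1 - r t\<close> of a local ring: it is outside \<open>p\<close> because
      \<open>u\<close> is outside and \<open>t\<close> is inside.\<close>
    have "(u \<ominus> r \<otimes> t) \<otimes> z = u \<otimes> z \<ominus> r \<otimes> (t \<otimes> z)" using cc u(3) c by algebra
    also have "\<dots> = i" unfolding u(4) using cc u(3) c by algebra
    finally have "(u \<ominus> r \<otimes> t) \<otimes> z \<in> L" using u(2) by simp
    moreover have "u \<ominus> r \<otimes> t \<notin> p"
    proof
      assume "u \<ominus> r \<otimes> t \<in> p"
      then have "(u \<ominus> r \<otimes> t) \<oplus> r \<otimes> t \<in> p" using t u(3) by (simp add: p.I_l_closed)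
      moreover have "(u \<ominus> r \<otimes> t) \<oplus> r \<otimes> t = u" using cc u(3) c by algebra
      ultimately show False using u(1) by simp
    qed
    ultimately have "z \<in> L" using sat_idealD[OF L'(1), of "u \<ominus> r \<otimes> t" z] cc u(3) c by simp
    then show False using tz c by (simp add: L.I_l_closed)
  qed
  then show thesis using that L' by blast
qed

text \<open>The localization at \<open>p\<close> modulo an ideal \<open>I\<close> is Artinian when \<open>p\<close> is minimal over \<open>I\<close>.
  In a counterexample with \<open>I\<close> maximal, \<open>I\<close> cannot be prime, and for \<open>f g \<in> I\<close> the chain is
  controlled by its traces above \<open>I + (f)\<close> and above \<open>(I : f)\<close>.\<close>

lemma (in noetherian_cring) sat_ideal_dcc:
  assumes p: "primeideal p R" and I: "sat_ideal R p I"
    and min: "\<And>P. primeideal P R \<Longrightarrow> I \<subseteq> P \<Longrightarrow> P \<subseteq> p \<Longrightarrow> P = p"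
    and J: "\<And>n::nat. sat_ideal R p (J n)" "\<And>n. I \<subseteq> J n" "decseq J"
  shows "\<exists>n. \<forall>k\<ge>n. J k = J n"
proof (rule ccontr)
  assume contr: "\<not> (\<exists>n. \<forall>k\<ge>n. J k = J n)"
  interpret p: primeideal p R by fact
  define bad where "bad = (\<lambda>K. \<exists>J::nat \<Rightarrow> 'a set. (\<forall>n. sat_ideal R p (J n) \<and> K \<subseteq> J n) \<and>
    decseq J \<and> \<not> (\<exists>n. \<forall>k\<ge>n. J k = J n))"
  define F where "F = {K. sat_ideal R p K \<and> I \<subseteq> K \<and> bad K}"
  have "I \<in> F" unfolding F_def bad_def using I J contr by blast
  then have "F \<noteq> {}" by blast
  moreover have "ideal K R" if "K \<in> F" for K using that by (simp add: F_def sat_ideal_def)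
  ultimately obtain K where K: "K \<in> F" "\<And>L. L \<in> F \<Longrightarrow> K \<subseteq> L \<Longrightarrow> L = K"
    using exists_maximal_ideal_in[of F] by blast
  have K': "sat_ideal R p K" "I \<subseteq> K" using K(1) unfolding F_def by auto
  interpret K: ideal K R using K' by (simp add: sat_ideal_def)
  have "bad K" using K(1) unfolding F_def by simp
  then obtain J where J': "\<forall>n::nat. sat_ideal R p (J n) \<and> K \<subseteq> J n" "decseq J"
    and nst': "\<not> (\<exists>n. \<forall>k\<ge>n. J k = J n)"
    unfolding bad_def by (elim exE conjE) rule
  have J: "\<And>n. sat_ideal R p (J n)" "\<And>n. K \<subseteq> J n" "decseq J" using J' by auto
  have nst: "\<exists>k\<ge>n. J k \<noteq> J n" for n using nst' by auto
  have Jid: "ideal (J n) R" for n using J(1) by (simp add: sat_ideal_def)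
  have Jc: "J n \<subseteq> carrier R" for n using ideal.Icarr[OF Jid] by blast
  have dec: "J k \<subseteq> J n" if "n \<le> k" for n k using J(3) that by (simp add: decseq_def)
  have stab: "\<exists>n. \<forall>k\<ge>n. J' k = J' n"
    if "sat_ideal R p L" "K \<subset> L" "\<And>n::nat. sat_ideal R p (J' n)" "\<And>n. L \<subseteq> J' n" "decseq J'" for L J'
  proof (rule ccontr)
    assume "\<not> ?thesis"
    then have "bad L" unfolding bad_def using that by blast
    then have "L \<in> F" unfolding F_def using that K' by blast
    then show False using K(2) that(2) by blast
  qed
  have "K \<noteq> carrier R"
  proof
    assume "K = carrier R"
    then have "J n = carrier R" for n using J(2) Jc by blast
    then show False using nst by blast
  qed
  have "\<not> primeideal K R"
  proof
    assume pr: "primeideal K R"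
    \<comment> \<open>Saturated ideals above \<open>K = p\<close> are \<open>p\<close> and the whole
      ring only, so the chain could drop at most once.\<close>
    then have "K = p" using min K'(2) sat_ideal_proper[OF K'(1) \<open>K \<noteq> carrier R\<close>] by blast
    then have alt: "J n = p \<or> J n = carrier R" for n using sat_ideal_proper[OF J(1)] J(2) by blast
    show False
    proof (cases "\<exists>n. J n = p")
      case True
      then obtain n where n: "J n = p" by blast
      then have "J k = J n" if "k \<ge> n" for k using dec[OF that] J(2)[of k] \<open>K = p\<close> by blast
      then show False using nst by blast
    next
      case False
      then show False using alt nst by metis
    qed
  qed
  then obtain f g where fg: "f \<in> carrier R" "g \<in> carrier R" "f \<otimes> g \<in> K" "f \<notin> K" "g \<notin> K"
    using primeidealI[OF K.is_ideal is_cring] \<open>K \<noteq> carrier R\<close> by blast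
  \<comment> \<open>Both families lie above saturated ideals strictly larger than \<open>K\<close>:
    the first above one containing \<open>f\<close>, the second above one containing
    \<open>g\<close>. By the maximality of \<open>K\<close> both stabilize.\<close>
  let ?A = "\<lambda>n. sat_extend R p (J n) f" and ?B = "\<lambda>n. {s \<in> carrier R. s \<otimes> f \<in> J n}"
  have "\<exists>n. \<forall>k\<ge>n. ?A k = ?A n"
  proof (rule stab[of "sat_extend R p K f"])
    show "decseq ?A" unfolding decseq_def using sat_extend_mono dec by metis
    show "K \<subset> sat_extend R p K f" using sat_ideal_extend[OF p K.is_ideal fg(1)] fg by blast
  qed (use sat_ideal_extend[OF p Jid fg(1)] sat_ideal_extend[OF p K.is_ideal fg(1)]
        sat_extend_mono[OF J(2)] in blast)+
  then obtain n1 where n1: "\<And>k. k \<ge> n1 \<Longrightarrow> ?A k = ?A n1" by blast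
  have "\<exists>n. \<forall>k\<ge>n. ?B k = ?B n"
  proof (rule stab[of "{s \<in> carrier R. s \<otimes> f \<in> K}"])
    show "decseq ?B" unfolding decseq_def using dec by blast
    have "g \<in> {s \<in> carrier R. s \<otimes> f \<in> K}" using fg m_comm by auto
    moreover have "K \<subseteq> {s \<in> carrier R. s \<otimes> f \<in> K}" using K.Icarr fg(1) K.I_r_closed by auto
    ultimately show "K \<subset> {s \<in> carrier R. s \<otimes> f \<in> K}" using fg(5) by blast
    show "{s \<in> carrier R. s \<otimes> f \<in> K} \<subseteq> ?B n" for n using J(2) by blast
  qed (use sat_ideal_colon[OF p J(1) fg(1)] sat_ideal_colon[OF p K'(1) fg(1)] in blast)+
  then obtain n2 where n2: "\<And>k. k \<ge> n2 \<Longrightarrow> ?B k = ?B n2" by blast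
  define n where "n = max n1 n2"
  have "J n \<subseteq> J k" if k: "k \<ge> n" for k
  proof
    fix z assume z: "z \<in> J n"
    interpret Jn: ideal "J n" R by (rule Jid)
    interpret Jk: ideal "J k" R by (rule Jid)
    have zc: "z \<in> carrier R" using z Jc by blast
    \<comment> \<open>As in the five lemma, the two stable traces recover the ideal:
      \<open>u \<otimes> z\<close> differs from an element of \<open>J k\<close> by a multiple
      \<open>r \<otimes> f\<close>; this multiple lies in \<open>J n\<close>, so \<open>r\<close>
      lies in the colon ideal, which is the same for \<open>J k\<close>.\<close>
    have "?A k = ?A n" using n1[of k] n1[of n] k unfolding n_def by auto
    then have "z \<in> ?A k" using z sat_ideal_extend(2)[OF p Jid fg(1)] by blast
    then obtain u i r where u: "u \<in> carrier R - p" "i \<in> J k" "r \<in> carrier R" "u \<otimes> z = i \<oplus> r \<otimes> f"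
      unfolding sat_extend_def by blast
    have c: "u \<in> carrier R" "i \<in> carrier R" using u Jk.Icarr by auto
    have "r \<otimes> f = u \<otimes> z \<ominus> i" unfolding u(4) using c u(3) fg(1) by algebra
    moreover have "u \<otimes> z \<ominus> i \<in> J n"
      using z u(2) c dec[OF k] by (auto intro!: Jn.minus_closed_ideal simp: Jn.I_l_closed)
    ultimately have "r \<in> ?B n" using u(3) by simp
    moreover have "?B k = ?B n" using n2[of k] n2[of n] k unfolding n_def by auto
    ultimately have "r \<otimes> f \<in> J k" by blast
    then have "u \<otimes> z \<in> J k" using u by simp
    then show "z \<in> J k" by (rule sat_idealD[OF J(1) u(1) zc])
  qed
  then show False using nst[of n] dec by blast
qed

section \<open>Krull's principal ideal theorem\<close>

text \<open>For \<open>p\<close> prime above \<open>p0\<close> the sets \<open>symb_power R p0 p n\<close> are the symbolic powers of \<open>p\<close>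
  modulo \<open>p0\<close>.\<close>

primrec symb_power :: "('a, 'r) ring_scheme \<Rightarrow> 'a set \<Rightarrow> 'a set \<Rightarrow> nat \<Rightarrow> 'a set" where
  "symb_power R p0 p 0 = carrier R"
| "symb_power R p0 p (Suc n) = carrier R \<inter> \<Inter> {L. sat_ideal R p L \<and> p0 \<subseteq> L \<and>
     (\<forall>t \<in> p. \<forall>z \<in> symb_power R p0 p n. t \<otimes>\<^bsub>R\<^esub> z \<in> L)}"

lemma (in cring) sat_ideal_Inter:
  assumes "\<And>L. L \<in> F \<Longrightarrow> sat_ideal R p L"
  shows "sat_ideal R p (carrier R \<inter> \<Inter>F)"
proof -
  have id: "ideal L R" if "L \<in> F" for L using assms[OF that] by (simp add: sat_ideal_def)
  have "ideal (carrier R \<inter> \<Inter>F) R"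
  proof (rule ideal_of_closed)
    show "\<zero> \<in> carrier R \<inter> \<Inter>F"
      using additive_subgroup.zero_closed[OF ideal.axioms(1)[OF id]] by simp
    show "a \<oplus> b \<in> carrier R \<inter> \<Inter>F" if "a \<in> carrier R \<inter> \<Inter>F" "b \<in> carrier R \<inter> \<Inter>F" for a b
      using that additive_subgroup.a_closed[OF ideal.axioms(1)[OF id]] by simp
    show "r \<otimes> a \<in> carrier R \<inter> \<Inter>F" if "a \<in> carrier R \<inter> \<Inter>F" "r \<in> carrier R" for a r
      using that ideal.I_l_closed[OF id] by simp
  qed simp
  moreover have "s \<in> carrier R \<inter> \<Inter>F"
    if "u \<in> carrier R - p" "s \<in> carrier R" "u \<otimes> s \<in> carrier R \<inter> \<Inter>F" for u s
    using that sat_idealD[OF assms] by blast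
  ultimately show ?thesis unfolding sat_ideal_def by blast
qed

lemma (in cring) sat_ideal_carrier: "sat_ideal R p (carrier R)"
  unfolding sat_ideal_def using oneideal by blast

lemma (in cring) sat_ideal_symb_power: "sat_ideal R p (symb_power R p0 p n)"
proof (cases n)
  case (Suc k)
  then show ?thesis by (simp only: symb_power.simps) (rule sat_ideal_Inter, blast)
qed (simp add: sat_ideal_carrier)

lemma (in cring) symb_power_mult:
  assumes "t \<in> p" "p \<subseteq> carrier R" "z \<in> symb_power R p0 p n"
  shows "t \<otimes> z \<in> symb_power R p0 p (Suc n)"
proof -
  have "z \<in> carrier R"
    by (rule ideal.Icarr[OF sat_ideal_ideal[OF sat_ideal_symb_power] assms(3)])
  then show ?thesis using assms by auto
qed

lemma (in cring) symb_power_least: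
  assumes "sat_ideal R p L" "p0 \<subseteq> L" "\<And>t z. t \<in> p \<Longrightarrow> z \<in> symb_power R p0 p n \<Longrightarrow> t \<otimes> z \<in> L"
  shows "symb_power R p0 p (Suc n) \<subseteq> L"
  using assms by auto

lemma (in cring) symb_power_above: "p0 \<subseteq> carrier R \<Longrightarrow> p0 \<subseteq> symb_power R p0 p n"
  by (cases n) auto

lemma (in cring) symb_power_Suc_subset:
  assumes "p \<subseteq> carrier R" "p0 \<subseteq> carrier R"
  shows "symb_power R p0 p (Suc n) \<subseteq> symb_power R p0 p n"
proof (rule symb_power_least)
  show "t \<otimes> z \<in> symb_power R p0 p n" if "t \<in> p" "z \<in> symb_power R p0 p n" for t z
    using that assms ideal.I_l_closed[OF sat_ideal_ideal[OF sat_ideal_symb_power]] by blast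
qed (rule sat_ideal_symb_power symb_power_above[OF assms(2)])+

text \<open>The classical argument with symbolic powers. If the claim fails, \<open>p\<close> is
  minimal over \<open>p0\<close> and \<open>x\<close>, so the symbolic powers \<open>Q n\<close> of
  \<open>q\<close> stabilize modulo \<open>x\<close>. Nakayama's lemma at \<open>p\<close> turns
  this into an equality of two successive powers, and Nakayama's lemma at \<open>q\<close> then
  forces that power down to \<open>p0\<close>, which the powers of an element of
  \<open>q - p0\<close> prevent.\<close>

theorem (in noetherian_cring) principal_ideal_theorem:
  assumes p0: "primeideal p0 R" and q: "primeideal q R" and p: "primeideal p R"
    and "p0 \<subset> q" "q \<subset> p" and x: "x \<in> p"
  shows "\<exists>P. primeideal P R \<and> p0 \<subseteq> P \<and> x \<in> P \<and> P \<subset> p"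
proof (rule ccontr)
  assume contr: "\<not> ?thesis"
  interpret p0: primeideal p0 R by fact
  interpret q: primeideal q R by fact
  interpret p: primeideal p R by fact
  have xc: "x \<in> carrier R" using x p.Icarr by blast
  \<comment> \<open>Otherwise \<open>q\<close> itself would be the prime sought.\<close>
  have xq: "x \<notin> q" using contr q assms(4,5) by blast
  define Q where "Q = symb_power R p0 q"
  have sub: "p0 \<subseteq> carrier R" "q \<subseteq> carrier R" using p0.Icarr q.Icarr by auto
  have Qq: "sat_ideal R q (Q n)" for n unfolding Q_def by (rule sat_ideal_symb_power)
  \<comment> \<open>Fewer elements lie outside \<open>p\<close> than outside \<open>q\<close>, so
    the condition at \<open>q\<close> implies the one at \<open>p\<close>.\<close>
  then have Qp: "sat_ideal R p (Q n)" for n using assms(5) unfolding sat_ideal_def by blast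
  have Qid: "ideal (Q n) R" for n using Qq[of n] by (rule sat_ideal_ideal)
  have Qdec: "Q (Suc n) \<subseteq> Q n" for n unfolding Q_def by (rule symb_power_Suc_subset[OF sub(2,1)])
  then have Qdec': "decseq Q" by (rule decseq_SucI)
  have Qp0: "p0 \<subseteq> Q n" for n unfolding Q_def by (rule symb_power_above[OF sub(1)])
  have "\<exists>n. \<forall>k\<ge>n. sat_extend R p (Q k) x = sat_extend R p (Q n) x"
  proof (rule sat_ideal_dcc[OF p])
    have E: "sat_ideal R p (sat_extend R p p0 x)" "p0 \<subseteq> sat_extend R p p0 x" "x \<in> sat_extend R p p0 x"
      using sat_ideal_extend[OF p p0.is_ideal xc] by auto
    show "sat_ideal R p (sat_extend R p p0 x)" by fact
    show "P = p" if "primeideal P R" "sat_extend R p p0 x \<subseteq> P" "P \<subseteq> p" for P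
      using that E contr by blast
    show "sat_ideal R p (sat_extend R p (Q n) x)" for n by (rule sat_ideal_extend[OF p Qid xc])
    show "sat_extend R p p0 x \<subseteq> sat_extend R p (Q n) x" for n by (rule sat_extend_mono[OF Qp0])
    show "decseq (\<lambda>n. sat_extend R p (Q n) x)"
      using Qdec' sat_extend_mono unfolding decseq_def by metis
  qed
  then obtain n where st: "\<And>k. k \<ge> n \<Longrightarrow> sat_extend R p (Q k) x = sat_extend R p (Q n) x" by blast
  have n: "sat_extend R p (Q (Suc n)) x = sat_extend R p (Q n) x" by (rule st) simp
  have eq: "Q (Suc n) = Q n"
  proof (rule ccontr)
    assume "Q (Suc n) \<noteq> Q n"
    then have "Q (Suc n) \<subset> Q n" using Qdec by blast
    then obtain L where L: "sat_ideal R p L" "Q (Suc n) \<subseteq> L" "L \<subset> Q n"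
      "\<And>t z. t \<in> p \<Longrightarrow> z \<in> Q n \<Longrightarrow> t \<otimes> z \<in> L"
      using sat_ideal_nakayama[OF p Qp Qp] by metis
    interpret L: ideal L R using L by (simp add: sat_ideal_def)
    interpret Qn: ideal "Q n" R by (rule Qid)
    have "z \<in> L" if z: "z \<in> Q n" for z
    proof -
      have "z \<in> sat_extend R p (Q (Suc n)) x" using n z sat_ideal_extend(2)[OF p Qid xc] by blast
      then obtain u i r where u: "u \<in> carrier R - p" "i \<in> Q (Suc n)" "r \<in> carrier R" "u \<otimes> z = i \<oplus> r \<otimes> x"
        unfolding sat_extend_def by blast
      have c: "u \<in> carrier R" "i \<in> carrier R" "z \<in> carrier R" "i \<in> Q n"
        using u z Qdec[of n] Qn.Icarr by auto
      have "x \<otimes> r = u \<otimes> z \<ominus> i" unfolding u(4) using c u(3) xc by algebra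
      moreover have "u \<otimes> z \<ominus> i \<in> Q n" using z c by (intro Qn.minus_closed_ideal Qn.I_l_closed)
      \<comment> \<open>The powers are saturated at \<open>q\<close> and \<open>x\<close> is outside
        \<open>q\<close>, so \<open>x\<close> can be cancelled; then \<open>x \<otimes> r\<close> is
        a product of an element of \<open>p\<close> and one of \<open>Q n\<close>, as Nakayama's
        lemma requires.\<close>
      ultimately have "r \<in> Q n" using sat_idealD[OF Qq, of x r n] xq xc u(3) by simp
      then have "x \<otimes> r \<in> L" using L(4) x by blast
      then have "u \<otimes> z \<in> L" using u L(2) xc m_comm[of x r] by auto
      then show ?thesis by (rule sat_idealD[OF L(1) u(1) c(3)])
    qed
    then show False using L(3) by blast
  qed
  obtain y where y: "y \<in> q" "y \<notin> p0" using assms(4) by blast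
  have "y [^] k \<in> Q k - p0" for k
  proof (induction k)
    case 0
    then show ?case using p0.one_notin by (simp add: Q_def)
  next
    case (Suc k)
    have yc: "y \<in> carrier R" using y q.Icarr by blast
    have "y \<otimes> y [^] k \<in> Q (Suc k)"
      using symb_power_mult[OF y(1) sub(2)] Suc unfolding Q_def by blast
    moreover have "y \<otimes> y [^] k \<notin> p0" using p0.I_prime[of y "y [^] k"] y Suc yc by blast
    ultimately show ?case using yc by (simp add: nat_pow_Suc m_comm)
  qed
  then have "p0 \<subset> Q n" using Qp0 by blast
  then obtain L where L: "sat_ideal R q L" "p0 \<subseteq> L" "L \<subset> Q n"
      "\<And>t z. t \<in> q \<Longrightarrow> z \<in> Q n \<Longrightarrow> t \<otimes> z \<in> L"
    using sat_ideal_nakayama[OF q Qq sat_ideal_prime[OF p0]] assms(4) by (metis psubsetE)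
  have "Q (Suc n) \<subseteq> L" unfolding Q_def by (rule symb_power_least) (use L in \<open>auto simp: Q_def\<close>)
  then show False using eq L(3) by blast
qed

section \<open>Chains of primes\<close>

text \<open>A chain of \<open>n\<close> strict inclusions of primes above \<open>I\<close>, seen
  only through its top \<open>P\<close>. The lower members are hidden behind quantifiers because
  equations are imposed by exchanging them while the top stays fixed. The lower bound
  \<open>{}\<close> is vacuous.\<close>

primrec pchain :: "('a, 'r) ring_scheme \<Rightarrow> 'a set \<Rightarrow> nat \<Rightarrow> 'a set \<Rightarrow> bool" where
  "pchain R I 0 P \<longleftrightarrow> primeideal P R \<and> I \<subseteq> P"
| "pchain R I (Suc n) P \<longleftrightarrow> primeideal P R \<and> (\<exists>P'. P' \<subset> P \<and> pchain R I n P')"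

lemma pchain_prime: "pchain R I n P \<Longrightarrow> primeideal P R"
  by (cases n) auto

lemma pchain_above: "pchain R I n P \<Longrightarrow> I \<subseteq> P"
  by (induction n arbitrary: P) auto

lemma pchain_antimono: "pchain R J n P \<Longrightarrow> I \<subseteq> J \<Longrightarrow> pchain R I n P"
proof (induction n arbitrary: P)
  case (Suc n)
  then show ?case unfolding pchain.simps by blast
qed auto

lemma pchain_enlarge: "pchain R I n P \<Longrightarrow> primeideal P' R \<Longrightarrow> P \<subseteq> P' \<Longrightarrow> pchain R I n P'"
proof (cases n)
  case (Suc k)
  assume "pchain R I n P" "primeideal P' R" "P \<subseteq> P'"
  then show ?thesis unfolding Suc pchain.simps by blast
qed auto

lemma pchain_le: "pchain R I n P \<Longrightarrow> k \<le> n \<Longrightarrow> pchain R I k P"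
proof (induction n arbitrary: P)
  case (Suc n)
  show ?case
  proof (cases "k = Suc n")
    case False
    obtain P' where "P' \<subset> P" "pchain R I n P'" using Suc.prems unfolding pchain.simps by blast
    moreover have "k \<le> n" using False Suc.prems by simp
    ultimately show ?thesis
      using Suc.IH pchain_enlarge[of R I k P' P] pchain_prime[OF Suc.prems(1)] by blast
  qed (use Suc.prems in simp)
qed simp

lemma pchain_map:
  assumes "pchain R I n P"
    and "\<And>P. primeideal P R \<Longrightarrow> I \<subseteq> P \<Longrightarrow> primeideal (f P) S \<and> J \<subseteq> f P"
    and "\<And>P P'. primeideal P R \<Longrightarrow> primeideal P' R \<Longrightarrow> I \<subseteq> P' \<Longrightarrow> P' \<subset> P \<Longrightarrow> f P' \<subset> f P"
  shows "pchain S J n (f P)"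
  using assms(1)
proof (induction n arbitrary: P)
  case (Suc n)
  then obtain P' where P': "P' \<subset> P" "pchain R I n P'" unfolding pchain.simps by blast
  have "I \<subseteq> P'" "primeideal P' R" "primeideal P R"
    using pchain_above pchain_prime P' Suc.prems by blast+
  then have "primeideal (f P) S" "f P' \<subset> f P"
    using assms(2)[of P] assms(3)[of P P'] P'(1) by auto
  with Suc.IH[OF P'(2)] show ?case unfolding pchain.simps by blast
qed (use assms(2) in auto)

text \<open>The primes are exchanged from the top downwards. If the second prime misses
  \<open>x\<close>, the principal ideal theorem supplies another one that contains \<open>x\<close>
  and is still strictly above the third; the induction continues below it. In the end the bottom
  prime is given up, which costs one step.\<close>

lemma (in noetherian_cring) pchain_insert:
  assumes "pchain R I (Suc n) P" "x \<in> P"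
  shows "pchain R (insert x I) n P"
  using assms
proof (induction n arbitrary: P)
  case (Suc n)
  then obtain P' P'' where P: "P' \<subset> P" "P'' \<subset> P'" "primeideal P' R" "primeideal P R" "pchain R I n P''"
    unfolding pchain.simps by blast
  show ?case
  proof (cases "x \<in> P'")
    case True
    then have "pchain R (insert x I) n P'" using Suc.IH P unfolding pchain.simps by blast
    then show ?thesis using P unfolding pchain.simps by blast
  next
    case False
    obtain S where S: "primeideal S R" "P'' \<subseteq> S" "x \<in> S" "S \<subset> P"
      using principal_ideal_theorem[OF pchain_prime[OF P(5)] P(3,4,2,1) Suc.prems(2)] by blast
    then have "P'' \<subset> S" using False P(2) by blast
    then have "pchain R I (Suc n) S" using S P unfolding pchain.simps by blast
    then show ?thesis using Suc.IH S P unfolding pchain.simps by blast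
  qed
qed (auto simp: psubset_eq)

lemma (in noetherian_cring) pchain_union:
  assumes "finite G" "pchain R I n P" "G \<subseteq> P"
  shows "pchain R (G \<union> I) (n - card G) P"
  using assms
proof (induction G)
  case (insert x G)
  then have IH: "pchain R (G \<union> I) (n - card G) P" by auto
  show ?case
  proof (cases "n - card G")
    \<comment> \<open>By truncated subtraction the length is already \<open>0\<close>, and it
      remains only that \<open>P\<close> contains \<open>x\<close>.\<close>
    case 0
    then show ?thesis using IH insert by auto
  next
    case (Suc k)
    then have "pchain R (insert x (G \<union> I)) k P"
      using pchain_insert[of "G \<union> I" k P x] IH insert.prems by simp
    moreover have "n - card (insert x G) = k" using Suc insert by simp
    ultimately show ?thesis by simp
  qed
qed auto

section \<open>Hilbert's basis theorem\<close>

text \<open>Expressions in \<open>y\<close> of degree less than \<open>n\<close>; with the strict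
  bound the base case is zero alone, and \<open>Suc n\<close> splits off a term of degree
  \<open>n\<close>.\<close>

primrec adjoin_below :: "('a, 'r) ring_scheme \<Rightarrow> 'a set \<Rightarrow> 'a \<Rightarrow> nat \<Rightarrow> 'a set" where
  "adjoin_below R A y 0 = {\<zero>\<^bsub>R\<^esub>}"
| "adjoin_below R A y (Suc n) =
     {a \<otimes>\<^bsub>R\<^esub> y [^]\<^bsub>R\<^esub> n \<oplus>\<^bsub>R\<^esub> g | a g. a \<in> A \<and> g \<in> adjoin_below R A y n}"

definition adjoin :: "('a, 'r) ring_scheme \<Rightarrow> 'a set \<Rightarrow> 'a \<Rightarrow> 'a set" where
  "adjoin R A y = (\<Union>n. adjoin_below R A y n)"

text \<open>Unlike for a polynomial ring, the expression of an element of \<open>A[y]\<close> in powers of \<open>y\<close> need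
  not be unique, so \<open>lead_coeffs\<close> collects the leading coefficients of all expressions.\<close>

definition lead_coeffs :: "('a, 'r) ring_scheme \<Rightarrow> 'a set \<Rightarrow> 'a \<Rightarrow> nat \<Rightarrow> 'a set \<Rightarrow> 'a set" where
  "lead_coeffs R A y n I =
     {a \<in> A. \<exists>g \<in> adjoin_below R A y n. a \<otimes>\<^bsub>R\<^esub> y [^]\<^bsub>R\<^esub> n \<oplus>\<^bsub>R\<^esub> g \<in> I}"

lemma ideal_carrier_updateD:
  assumes I: "ideal I (R\<lparr>carrier := S\<rparr>)"
  shows "I \<subseteq> S" "\<zero>\<^bsub>R\<^esub> \<in> I" "\<And>f g. f \<in> I \<Longrightarrow> g \<in> I \<Longrightarrow> f \<oplus>\<^bsub>R\<^esub> g \<in> I"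
    "\<And>f g. f \<in> I \<Longrightarrow> g \<in> S \<Longrightarrow> g \<otimes>\<^bsub>R\<^esub> f \<in> I"
  using ideal.Icarr[OF I] additive_subgroup.zero_closed[OF ideal.axioms(1)[OF I]]
    additive_subgroup.a_closed[OF ideal.axioms(1)[OF I]] ideal.I_l_closed[OF I]
  by auto

context cring
begin

lemma cring_subring: "subring S R \<Longrightarrow> cring (R\<lparr>carrier := S\<rparr>)"
  using subcringI' subcring_iff subringE(1) by blast

context
  fixes A :: "'a set" and y :: 'a
  assumes A: "subring A R" and y: "y \<in> carrier R"
begin

lemma A_carrier: "a \<in> A \<Longrightarrow> a \<in> carrier R"
  using subringE(1)[OF A] by blast

lemma adjoin_below_carrier: "g \<in> adjoin_below R A y n \<Longrightarrow> g \<in> carrier R"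
  by (induction n arbitrary: g) (auto simp: A_carrier y)

lemma adjoin_below_SucI:
  "a \<in> A \<Longrightarrow> g \<in> adjoin_below R A y n \<Longrightarrow> a \<otimes> y [^] n \<oplus> g \<in> adjoin_below R A y (Suc n)"
  by auto

lemma adjoin_below_SucE:
  assumes "f \<in> adjoin_below R A y (Suc n)"
  obtains a g where "a \<in> A" "g \<in> adjoin_below R A y n" "f = a \<otimes> y [^] n \<oplus> g"
  using assms by auto

lemma adjoin_below_Suc: "g \<in> adjoin_below R A y n \<Longrightarrow> g \<in> adjoin_below R A y (Suc n)"
  using adjoin_below_SucI[of "\<zero>" g n] subringE(2)[OF A] adjoin_below_carrier[of g n] y by simp

lemma adjoin_below_mono: "m \<le> n \<Longrightarrow> g \<in> adjoin_below R A y m \<Longrightarrow> g \<in> adjoin_below R A y n"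
  by (induction rule: dec_induct) (auto simp: adjoin_below_Suc simp del: adjoin_below.simps)

lemma zero_adjoin_below: "\<zero> \<in> adjoin_below R A y n"
  using adjoin_below_mono[of 0 n "\<zero>"] by simp

lemma adjoin_below_add:
  "f \<in> adjoin_below R A y n \<Longrightarrow> g \<in> adjoin_below R A y n \<Longrightarrow> f \<oplus> g \<in> adjoin_below R A y n"
proof (induction n arbitrary: f g)
  case (Suc n)
  obtain a f' where f: "a \<in> A" "f' \<in> adjoin_below R A y n" "f = a \<otimes> y [^] n \<oplus> f'"
    using Suc.prems(1) by (rule adjoin_below_SucE)
  obtain b g' where g: "b \<in> A" "g' \<in> adjoin_below R A y n" "g = b \<otimes> y [^] n \<oplus> g'"
    using Suc.prems(2) by (rule adjoin_below_SucE)
  have c: "a \<in> carrier R" "b \<in> carrier R" "f' \<in> carrier R" "g' \<in> carrier R" "y [^] n \<in> carrier R"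
    using f g y A_carrier adjoin_below_carrier by auto
  have "f \<oplus> g = (a \<oplus> b) \<otimes> y [^] n \<oplus> (f' \<oplus> g')" unfolding f(3) g(3) using c by algebra
  then show ?case using adjoin_below_SucI[OF _ Suc.IH[OF f(2) g(2)]] subringE(7)[OF A f(1) g(1)] by simp
qed simp

lemma adjoin_below_smult:
  "b \<in> A \<Longrightarrow> g \<in> adjoin_below R A y n \<Longrightarrow> b \<otimes> g \<in> adjoin_below R A y n"
proof (induction n arbitrary: g)
  case (Suc n)
  obtain a f where f: "a \<in> A" "f \<in> adjoin_below R A y n" "g = a \<otimes> y [^] n \<oplus> f"
    using Suc.prems(2) by (rule adjoin_below_SucE)
  have c: "a \<in> carrier R" "b \<in> carrier R" "f \<in> carrier R" "y [^] n \<in> carrier R"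
    using f y A_carrier adjoin_below_carrier Suc.prems by auto
  have "b \<otimes> g = (b \<otimes> a) \<otimes> y [^] n \<oplus> b \<otimes> f" unfolding f(3) using c by algebra
  then show ?case
    using adjoin_below_SucI[OF _ Suc.IH[OF Suc.prems(1) f(2)]] subringE(6)[OF A Suc.prems(1) f(1)] by simp
qed (simp add: A_carrier)

lemma adjoin_below_shift: "g \<in> adjoin_below R A y n \<Longrightarrow> y \<otimes> g \<in> adjoin_below R A y (Suc n)"
proof (induction n arbitrary: g)
  case 0
  then have "y \<otimes> g = \<zero>" using y by simp
  then show ?case by (simp only: zero_adjoin_below)
next
  case (Suc n)
  obtain a f where f: "a \<in> A" "f \<in> adjoin_below R A y n" "g = a \<otimes> y [^] n \<oplus> f"
    using Suc.prems by (rule adjoin_below_SucE)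
  have c: "a \<in> carrier R" "f \<in> carrier R" "y [^] n \<in> carrier R"
    using f y A_carrier adjoin_below_carrier by auto
  have "y \<otimes> g = a \<otimes> (y [^] n \<otimes> y) \<oplus> y \<otimes> f" unfolding f(3) using c y by algebra
  then show ?case
    using adjoin_below_SucI[OF f(1) Suc.IH[OF f(2)]] by (simp only: nat_pow_Suc)
qed

lemma adjoin_below_mult:
  "f \<in> adjoin_below R A y m \<Longrightarrow> g \<in> adjoin_below R A y n \<Longrightarrow> f \<otimes> g \<in> adjoin_below R A y (m + n)"
proof (induction m arbitrary: f)
  case 0
  then show ?case using zero_adjoin_below adjoin_below_carrier by simp
next
  case (Suc m)
  obtain a h where f: "a \<in> A" "h \<in> adjoin_below R A y m" "f = a \<otimes> y [^] m \<oplus> h"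
    using Suc.prems(1) by (rule adjoin_below_SucE)
  have c: "a \<in> carrier R" "h \<in> carrier R" "y [^] m \<in> carrier R" "g \<in> carrier R"
    using f y A_carrier adjoin_below_carrier Suc.prems by auto
  have "y [^] k \<otimes> g \<in> adjoin_below R A y (k + n)" for k
  proof (induction k)
    case (Suc k)
    have "y [^] (Suc k) \<otimes> g = y \<otimes> (y [^] k \<otimes> g)" using y c by (simp add: m_ac)
    then show ?case using adjoin_below_shift[OF Suc] by simp
  qed (use c Suc.prems in simp)
  then have 1: "a \<otimes> (y [^] m \<otimes> g) \<in> adjoin_below R A y (Suc (m + n))"
    by (intro adjoin_below_Suc adjoin_below_smult[OF f(1)])
  have "f \<otimes> g = a \<otimes> (y [^] m \<otimes> g) \<oplus> h \<otimes> g" unfolding f(3) using c y by algebra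
  then show ?case
    using adjoin_below_add[OF 1 adjoin_below_Suc[OF Suc.IH[OF f(2) Suc.prems(2)]]]
    by (simp only: add_Suc)
qed

lemma adjoin_minus_one: "\<ominus> \<one> \<in> A"
  using subringE(3,5)[OF A] by blast

lemma adjoin_below_uminus: "g \<in> adjoin_below R A y n \<Longrightarrow> \<ominus> g \<in> adjoin_below R A y n"
  using adjoin_below_smult[OF adjoin_minus_one, of g n] adjoin_below_carrier[of g n]
  by (simp add: l_minus)

lemma adjoin_supset: "A \<subseteq> adjoin R A y"
proof
  fix a assume a: "a \<in> A"
  then have "a \<otimes> y [^] (0::nat) \<oplus> \<zero> \<in> adjoin_below R A y (Suc 0)"
    by (intro adjoin_below_SucI zero_adjoin_below)
  moreover have "a \<otimes> y [^] (0::nat) \<oplus> \<zero> = a" using A_carrier[OF a] by simp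
  ultimately show "a \<in> adjoin R A y" unfolding adjoin_def by (metis UN_I UNIV_I)
qed

lemma adjoin_mem: "y \<in> adjoin R A y"
proof -
  have "\<one> \<otimes> y [^] (Suc 0) \<oplus> \<zero> \<in> adjoin_below R A y (Suc (Suc 0))"
    by (intro adjoin_below_SucI zero_adjoin_below subringE(3)[OF A])
  moreover have "\<one> \<otimes> y [^] (Suc 0) \<oplus> \<zero> = y" using y by simp
  ultimately show ?thesis unfolding adjoin_def by (metis UN_I UNIV_I)
qed

lemma subring_adjoin: "subring (adjoin R A y) R"
proof (rule subringI)
  show "adjoin R A y \<subseteq> carrier R" using adjoin_below_carrier unfolding adjoin_def by auto
  show "\<one> \<in> adjoin R A y" using adjoin_supset subringE(3)[OF A] by blast
  show "\<ominus> f \<in> adjoin R A y" if "f \<in> adjoin R A y" for f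
    using that adjoin_below_uminus unfolding adjoin_def by blast
  show "f \<otimes> g \<in> adjoin R A y" if "f \<in> adjoin R A y" "g \<in> adjoin R A y" for f g
    using that adjoin_below_mult unfolding adjoin_def by blast
  show "f \<oplus> g \<in> adjoin R A y" if fg: "f \<in> adjoin R A y" "g \<in> adjoin R A y" for f g
  proof -
    obtain m n where "f \<in> adjoin_below R A y m" "g \<in> adjoin_below R A y n"
      using fg unfolding adjoin_def by blast
    then have "f \<oplus> g \<in> adjoin_below R A y (max m n)"
      by (intro adjoin_below_add) (auto intro: adjoin_below_mono[rotated])
    then show ?thesis unfolding adjoin_def by blast
  qed
qed

lemma adjoin_minimal:
  assumes S: "subring S R" "A \<subseteq> S" "y \<in> S"
  shows "adjoin R A y \<subseteq> S"
proof -
  have pow: "y [^] n \<in> S" for n :: nat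
    by (induction n) (use subringE(3,6)[OF S(1)] S(3) in auto)
  have "g \<in> adjoin_below R A y n \<Longrightarrow> g \<in> S" for g n
  proof (induction n arbitrary: g)
    case (Suc n)
    obtain a f where f: "a \<in> A" "f \<in> adjoin_below R A y n" "g = a \<otimes> y [^] n \<oplus> f"
      using Suc.prems by (rule adjoin_below_SucE)
    then show ?case using S(2) pow Suc.IH[OF f(2)] subringE(6,7)[OF S(1)] by auto
  qed (simp add: subringE(2)[OF S(1)])
  then show ?thesis unfolding adjoin_def by blast
qed

context
  fixes T :: "('a, 'b) ring_scheme"
  defines "T \<equiv> R\<lparr>carrier := adjoin R A y\<rparr>"
begin

lemma cring_adjoin: "cring T"
  unfolding T_def by (rule cring_subring[OF subring_adjoin])

lemma cring_base: "cring (R\<lparr>carrier := A\<rparr>)"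
  by (rule cring_subring[OF A])

lemma ideal_adjoinD:
  assumes I: "ideal I T"
  shows "I \<subseteq> adjoin R A y" "\<zero> \<in> I" "\<And>f g. f \<in> I \<Longrightarrow> g \<in> I \<Longrightarrow> f \<oplus> g \<in> I"
    "\<And>f g. f \<in> I \<Longrightarrow> g \<in> adjoin R A y \<Longrightarrow> g \<otimes> f \<in> I"
  using ideal_carrier_updateD[OF I[unfolded T_def]] by blast+

lemma ideal_lead_coeffs:
  assumes I: "ideal I T"
  shows "ideal (lead_coeffs R A y n I) (R\<lparr>carrier := A\<rparr>)"
proof (rule cring.ideal_of_closed[OF cring_base])
  show "lead_coeffs R A y n I \<subseteq> carrier (R\<lparr>carrier := A\<rparr>)" unfolding lead_coeffs_def by auto
  have "\<zero> \<otimes> y [^] n \<oplus> \<zero> \<in> I" using ideal_adjoinD(2)[OF I] y by simp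
  then show "\<zero>\<^bsub>R\<lparr>carrier := A\<rparr>\<^esub> \<in> lead_coeffs R A y n I"
    unfolding lead_coeffs_def using subringE(2)[OF A] zero_adjoin_below by auto
next
  fix a b assume ab: "a \<in> lead_coeffs R A y n I" "b \<in> lead_coeffs R A y n I"
  obtain f where f: "a \<in> A" "f \<in> adjoin_below R A y n" "a \<otimes> y [^] n \<oplus> f \<in> I"
    using ab(1) unfolding lead_coeffs_def by blast
  obtain g where g: "b \<in> A" "g \<in> adjoin_below R A y n" "b \<otimes> y [^] n \<oplus> g \<in> I"
    using ab(2) unfolding lead_coeffs_def by blast
  have c: "a \<in> carrier R" "b \<in> carrier R" "f \<in> carrier R" "g \<in> carrier R" "y [^] n \<in> carrier R"
    using f g y A_carrier adjoin_below_carrier by auto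
  have "(a \<otimes> y [^] n \<oplus> f) \<oplus> (b \<otimes> y [^] n \<oplus> g) = (a \<oplus> b) \<otimes> y [^] n \<oplus> (f \<oplus> g)" using c by algebra
  then have "(a \<oplus> b) \<otimes> y [^] n \<oplus> (f \<oplus> g) \<in> I" using ideal_adjoinD(3)[OF I f(3) g(3)] by simp
  then have "a \<oplus> b \<in> lead_coeffs R A y n I"
    unfolding lead_coeffs_def using subringE(7)[OF A f(1) g(1)] adjoin_below_add[OF f(2) g(2)] by blast
  then show "a \<oplus>\<^bsub>R\<lparr>carrier := A\<rparr>\<^esub> b \<in> lead_coeffs R A y n I" by simp
next
  fix a r assume a: "a \<in> lead_coeffs R A y n I" and r': "r \<in> carrier (R\<lparr>carrier := A\<rparr>)"
  then have r: "r \<in> A" by simp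
  obtain f where f: "a \<in> A" "f \<in> adjoin_below R A y n" "a \<otimes> y [^] n \<oplus> f \<in> I"
    using a unfolding lead_coeffs_def by blast
  have c: "a \<in> carrier R" "r \<in> carrier R" "f \<in> carrier R" "y [^] n \<in> carrier R"
    using f r y A_carrier adjoin_below_carrier by auto
  have "r \<otimes> (a \<otimes> y [^] n \<oplus> f) = (r \<otimes> a) \<otimes> y [^] n \<oplus> r \<otimes> f" using c by algebra
  then have "(r \<otimes> a) \<otimes> y [^] n \<oplus> r \<otimes> f \<in> I" 
    using ideal_adjoinD(4)[OF I f(3), of r] r adjoin_supset by auto
  then have "r \<otimes> a \<in> lead_coeffs R A y n I"
    unfolding lead_coeffs_def using subringE(6)[OF A r f(1)] adjoin_below_smult[OF r f(2)] by blast
  then show "r \<otimes>\<^bsub>R\<lparr>carrier := A\<rparr>\<^esub> a \<in> lead_coeffs R A y n I" by simp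
qed

lemma lead_coeffs_mono: "I \<subseteq> J \<Longrightarrow> lead_coeffs R A y n I \<subseteq> lead_coeffs R A y n J"
  unfolding lead_coeffs_def by blast

lemma lead_coeffs_Suc:
  assumes I: "ideal I T"
  shows "lead_coeffs R A y n I \<subseteq> lead_coeffs R A y (Suc n) I"
proof
  fix a assume "a \<in> lead_coeffs R A y n I"
  then obtain f where f: "a \<in> A" "f \<in> adjoin_below R A y n" "a \<otimes> y [^] n \<oplus> f \<in> I"
    unfolding lead_coeffs_def by blast
  have c: "a \<in> carrier R" "f \<in> carrier R" "y [^] n \<in> carrier R"
    using f y A_carrier adjoin_below_carrier by auto
  have "y \<otimes> (a \<otimes> y [^] n \<oplus> f) = a \<otimes> (y [^] n \<otimes> y) \<oplus> y \<otimes> f" using c y by algebra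
  then have "a \<otimes> y [^] (Suc n) \<oplus> y \<otimes> f \<in> I"
    using ideal_adjoinD(4)[OF I f(3) adjoin_mem] by simp
  then show "a \<in> lead_coeffs R A y (Suc n) I"
    unfolding lead_coeffs_def using f(1) adjoin_below_shift[OF f(2)] by blast
qed

lemma lead_coeffs_le:
  assumes I: "ideal I T" and "m \<le> n"
  shows "lead_coeffs R A y m I \<subseteq> lead_coeffs R A y n I"
  using assms(2) lead_coeffs_Suc[OF I] by (induction rule: dec_induct) blast+

text \<open>Induction on the degree bound of an element of \<open>J\<close>: some element of
  \<open>I\<close> has the same leading term, and the difference lies in \<open>J\<close> with a
  smaller bound.\<close>

lemma ideal_eq_if_lead_coeffs_eq:
  assumes I: "ideal I T" and J: "ideal J T" and "I \<subseteq> J"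
    and eq: "\<And>n. lead_coeffs R A y n J \<subseteq> lead_coeffs R A y n I"
  shows "J = I"
proof -
  have "f \<in> J \<Longrightarrow> f \<in> adjoin_below R A y n \<Longrightarrow> f \<in> I" for f n
  proof (induction n arbitrary: f)
    case 0
    then show ?case using ideal_adjoinD(2)[OF I] by simp
  next
    case (Suc n)
    obtain a g where g: "a \<in> A" "g \<in> adjoin_below R A y n" "f = a \<otimes> y [^] n \<oplus> g"
      using Suc.prems(2) by (rule adjoin_below_SucE)
    then have "a \<in> lead_coeffs R A y n J" using Suc.prems(1) unfolding lead_coeffs_def by blast
    then have "a \<in> lead_coeffs R A y n I" using eq by blast
    then obtain h where h: "h \<in> adjoin_below R A y n" "a \<otimes> y [^] n \<oplus> h \<in> I"
      unfolding lead_coeffs_def by blast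
    define f' where "f' = a \<otimes> y [^] n \<oplus> h"
    have c: "a \<in> carrier R" "g \<in> carrier R" "h \<in> carrier R" "y [^] n \<in> carrier R"
      using g h y A_carrier adjoin_below_carrier by auto
    have f'c: "f' \<in> carrier R" unfolding f'_def using c by simp
    have "\<ominus> \<one> \<otimes> f' \<in> J"
      using ideal_adjoinD(4)[OF J, of f' "\<ominus> \<one>"] h(2) \<open>I \<subseteq> J\<close> adjoin_minus_one adjoin_supset
      unfolding f'_def by blast
    then have "f \<oplus> \<ominus> \<one> \<otimes> f' \<in> J" using ideal_adjoinD(3)[OF J Suc.prems(1)] by blast
    moreover have "f \<oplus> \<ominus> \<one> \<otimes> f' = g \<oplus> \<ominus> h" unfolding g(3) f'_def using c by algebra
    moreover have "g \<oplus> \<ominus> h \<in> adjoin_below R A y n"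
      using adjoin_below_add[OF g(2) adjoin_below_uminus[OF h(1)]] .
    ultimately have "g \<oplus> \<ominus> h \<in> I" using Suc.IH by simp
    then have "f' \<oplus> (g \<oplus> \<ominus> h) \<in> I" using ideal_adjoinD(3)[OF I] h(2) unfolding f'_def by blast
    moreover have "f' \<oplus> (g \<oplus> \<ominus> h) = f" unfolding g(3) f'_def using c by algebra
    ultimately show ?case by simp
  qed
  then show ?thesis using ideal_adjoinD(1)[OF J] \<open>I \<subseteq> J\<close> unfolding adjoin_def by blast
qed

text \<open>The ideals of leading coefficients grow with the degree and with the ideal. A maximal
  one among all of them, attained at \<open>n0\<close> and \<open>I0\<close>, controls every degree
  from \<open>n0\<close> on; each of the finitely many smaller degrees gets a maximal one of its
  own. A member of the chain above all these choices has the largest possible leading coefficients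
  in every degree and is therefore the union.\<close>

lemma noetherian_adjoin:
  assumes noeth: "noetherian_ring (R\<lparr>carrier := A\<rparr>)"
  shows "noetherian_ring T"
proof -
  interpret T: cring T by (rule cring_adjoin)
  let ?l = "lead_coeffs R A y"
  show ?thesis
  proof (rule T.trivial_ideal_chain_imp_noetherian)
    fix C assume C: "C \<noteq> {}" "subset.chain {I. ideal I T} C"
    have id: "ideal I T" if "I \<in> C" for I using C(2) that unfolding subset.chain_def by blast
    have tot: "I \<subseteq> J \<or> J \<subseteq> I" if "I \<in> C" "J \<in> C" for I J
      using C(2) that unfolding subset.chain_def by blast
    have lid: "ideal (?l n I) (R\<lparr>carrier := A\<rparr>)" if "I \<in> C" for n I
      by (rule ideal_lead_coeffs[OF id[OF that]])
    have "\<exists>M\<in>{?l n I | n I. I \<in> C}. \<forall>L\<in>{?l n I | n I. I \<in> C}. M \<subseteq> L \<longrightarrow> L = M"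
    proof (rule noetherian_ring.exists_maximal_ideal_in[OF noeth])
      show "{?l n I | n I. I \<in> C} \<noteq> {}" using C(1) by blast
      show "ideal L (R\<lparr>carrier := A\<rparr>)" if "L \<in> {?l n I | n I. I \<in> C}" for L
        using that lid by blast
    qed
    then obtain L0 where L0: "L0 \<in> {?l n I | n I. I \<in> C}"
      "\<forall>L\<in>{?l n I | n I. I \<in> C}. L0 \<subseteq> L \<longrightarrow> L = L0" ..
    then obtain n0 I0 where I0: "I0 \<in> C" "L0 = ?l n0 I0" by blast
    have I0': "?l n I = ?l n0 I0" if "I \<in> C" "?l n0 I0 \<subseteq> ?l n I" for n I
      using bspec[OF L0(2), of "?l n I"] that I0(2) by blast
    have "\<exists>I\<in>C. \<forall>J\<in>C. ?l n I \<subseteq> ?l n J \<longrightarrow> ?l n J = ?l n I" for n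
    proof -
      have "\<exists>M\<in>?l n ` C. \<forall>L\<in>?l n ` C. M \<subseteq> L \<longrightarrow> L = M"
      proof (rule noetherian_ring.exists_maximal_ideal_in[OF noeth])
        show "?l n ` C \<noteq> {}" using C(1) by blast
        show "ideal L (R\<lparr>carrier := A\<rparr>)" if "L \<in> ?l n ` C" for L using that lid by blast
      qed
      then show ?thesis by (simp only: bex_simps ball_simps)
    qed
    then have "\<exists>F. \<forall>n. F n \<in> C \<and> (\<forall>J\<in>C. ?l n (F n) \<subseteq> ?l n J \<longrightarrow> ?l n J = ?l n (F n))"
      by (intro choice) (simp add: Bex_def)
    then obtain F where FF:
      "\<forall>n. F n \<in> C \<and> (\<forall>J\<in>C. ?l n (F n) \<subseteq> ?l n J \<longrightarrow> ?l n J = ?l n (F n))" ..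
    have F: "F n \<in> C" for n using FF by simp
    have F': "\<forall>J\<in>C. ?l n (F n) \<subseteq> ?l n J \<longrightarrow> ?l n J = ?l n (F n)" for n using FF by simp
    have "\<exists>M\<in>C. I0 \<subseteq> M \<and> (\<forall>n<k. F n \<subseteq> M)" for k
    proof (induction k)
      case (Suc k)
      then obtain M where M: "M \<in> C" "I0 \<subseteq> M" "\<forall>n<k. F n \<subseteq> M" by blast
      show ?case
      proof (cases "F k \<subseteq> M")
        case True
        then have "I0 \<subseteq> M \<and> (\<forall>n<Suc k. F n \<subseteq> M)" using M by (auto simp: less_Suc_eq)
        then show ?thesis using M(1) by (rule bexI)
      next
        case False
        then have "M \<subseteq> F k" using tot[OF M(1) F[of k]] by blast
        then have "I0 \<subseteq> F k \<and> (\<forall>n<Suc k. F n \<subseteq> F k)" using M by (auto simp: less_Suc_eq)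
        then show ?thesis by (rule bexI) (rule F)
      qed
    qed (use I0 in auto)
    from this[of n0] obtain M where M: "M \<in> C" "I0 \<subseteq> M" "\<forall>n<n0. F n \<subseteq> M" by blast
    have "J \<subseteq> M" if J: "J \<in> C" for J
    proof (cases "M \<subseteq> J")
      case True
      have "?l n J \<subseteq> ?l n M" for n
      proof (cases "n < n0")
        case True
        then have "?l n (F n) \<subseteq> ?l n M" using M(3) lead_coeffs_mono by blast
        moreover have "?l n M \<subseteq> ?l n J" using \<open>M \<subseteq> J\<close> by (rule lead_coeffs_mono)
        ultimately show ?thesis using bspec[OF F' J, of n] bspec[OF F' M(1), of n] by blast
      next
        case False
        then have "?l n0 I0 \<subseteq> ?l n M"
          using lead_coeffs_mono[OF M(2), of n0] lead_coeffs_le[OF id[OF M(1)], of n0 n] by simp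
        moreover have "?l n M \<subseteq> ?l n J" using \<open>M \<subseteq> J\<close> by (rule lead_coeffs_mono)
        ultimately show ?thesis using I0'[OF J, of n] I0'[OF M(1), of n] by blast
      qed
      then show ?thesis using ideal_eq_if_lead_coeffs_eq[OF id[OF M(1)] id[OF J] True] by blast
    next
      case False
      then show ?thesis using tot[OF M(1) J] by blast
    qed
    then have "\<Union>C = M" using M(1) by blast
    then show "\<Union>C \<in> C" using M(1) by simp
  qed
qed

end

end

end

text \<open>The last clause replaces a description of the elements of \<open>T\<close>: whatever
  holds for the constants and the generators and is stable under the ring operations holds on all of
  \<open>T\<close>.\<close>

lemma (in cring) exists_noetherian_subring:
  assumes "finite G" "G \<subseteq> carrier R" and A: "subring A R" "noetherian_ring (R\<lparr>carrier := A\<rparr>)"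
  shows "\<exists>T. subring T R \<and> noetherian_ring (R\<lparr>carrier := T\<rparr>) \<and> A \<union> G \<subseteq> T \<and>
    (\<forall>S. subring S R \<longrightarrow> A \<union> G \<subseteq> S \<longrightarrow> T \<subseteq> S)"
  using assms(1,2)
proof (induction G)
  case empty
  then show ?case using A by blast
next
  case (insert y G)
  then obtain T where T: "subring T R" "noetherian_ring (R\<lparr>carrier := T\<rparr>)" "A \<union> G \<subseteq> T"
    "\<forall>S. subring S R \<longrightarrow> A \<union> G \<subseteq> S \<longrightarrow> T \<subseteq> S" by auto
  have y: "y \<in> carrier R" using insert by simp
  show ?case
  proof (intro exI conjI allI impI)
    show "subring (adjoin R T y) R" by (rule subring_adjoin[OF T(1) y])
    show "noetherian_ring (R\<lparr>carrier := adjoin R T y\<rparr>)" by (rule noetherian_adjoin[OF T(1) y T(2)])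
    show "A \<union> insert y G \<subseteq> adjoin R T y"
      using adjoin_supset[OF T(1) y] adjoin_mem[OF T(1) y] T(3) by blast
    show "adjoin R T y \<subseteq> S" if "subring S R" "A \<union> insert y G \<subseteq> S" for S
      using adjoin_minimal[OF T(1) y that(1)] T(4) that by blast
  qed
qed

text \<open>Preimages turn a chain of ideals of \<open>S\<close> into one of ideals of
  \<open>R\<close>, and surjectivity lets inclusions of preimages be read off in \<open>S\<close>.
  This carries the Noetherian property from \<open>R\<close> to the constant functions.\<close>

lemma (in noetherian_ring) noetherian_surj_image:
  assumes S: "ring S" and h: "h \<in> ring_hom R S" and surj: "carrier S \<subseteq> h ` carrier R"
  shows "noetherian_ring S"
proof -
  interpret S: ring S by fact
  interpret h: ring_hom_ring R S h by (rule ring_hom_ringI2[OF ring_axioms S h])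
  show ?thesis
  proof (rule S.trivial_ideal_chain_imp_noetherian)
    fix C assume C: "C \<noteq> {}" "subset.chain {I. ideal I S} C"
    define v where "v = (\<lambda>I. {r \<in> carrier R. h r \<in> I})"
    have CS: "C \<subseteq> {I. ideal I S}" using C(2) by (simp add: subset.chain_def)
    have tot: "I \<subseteq> J \<or> J \<subseteq> I" if "I \<in> C" "J \<in> C" for I J
      using C(2) that unfolding subset.chain_def by blast
    have "\<Union>(v ` C) \<in> v ` C"
    proof (rule ideal_chain_is_trivial)
      show "v ` C \<noteq> {}" using C(1) by simp
      have "v ` C \<subseteq> {I. ideal I R}" using CS h.ideal_vimage unfolding v_def by blast
      moreover have "v I \<subseteq> v J \<or> v J \<subseteq> v I" if "I \<in> C" "J \<in> C" for I J
        using tot[OF that] unfolding v_def by blast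
      ultimately show "subset.chain {I. ideal I R} (v ` C)" unfolding subset_chain_def by blast
    qed
    then obtain I where I: "I \<in> C" "\<Union>(v ` C) = v I" by auto
    have "J \<subseteq> I" if J: "J \<in> C" for J
    proof
      fix s assume s: "s \<in> J"
      have "ideal J S" using CS J by blast
      then obtain r where r: "r \<in> carrier R" "s = h r" using ideal.Icarr[of J S s] s surj by blast
      then have "r \<in> v I" using s J I(2) unfolding v_def by blast
      then show "s \<in> I" using r unfolding v_def by simp
    qed
    then have "\<Union>C = I" using I(1) by blast
    then show "\<Union>C \<in> C" using I(1) by simp
  qed
qed

section \<open>Rings of functions\<close>

text \<open>The ambient ring in which the algebra of linear forms is generated. Functions are total
  on the type \<open>'w\<close>, so values in \<open>carrier R\<close> are demanded also at points
  that have nothing to do with \<open>R\<close>.\<close>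

definition fun_ring :: "('a, 'r) ring_scheme \<Rightarrow> ('w \<Rightarrow> 'a) ring" where
  "fun_ring R = \<lparr>carrier = {f. \<forall>w. f w \<in> carrier R}, monoid.mult = (\<lambda>f g w. f w \<otimes>\<^bsub>R\<^esub> g w),
     one = (\<lambda>w. \<one>\<^bsub>R\<^esub>), zero = (\<lambda>w. \<zero>\<^bsub>R\<^esub>), add = (\<lambda>f g w. f w \<oplus>\<^bsub>R\<^esub> g w)\<rparr>"

lemma fun_ring_simps [simp]:
  "carrier (fun_ring R) = {f. \<forall>w. f w \<in> carrier R}"
  "f \<otimes>\<^bsub>fun_ring R\<^esub> g = (\<lambda>w. f w \<otimes>\<^bsub>R\<^esub> g w)"
  "f \<oplus>\<^bsub>fun_ring R\<^esub> g = (\<lambda>w. f w \<oplus>\<^bsub>R\<^esub> g w)"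
  "\<one>\<^bsub>fun_ring R\<^esub> = (\<lambda>w. \<one>\<^bsub>R\<^esub>)" "\<zero>\<^bsub>fun_ring R\<^esub> = (\<lambda>w. \<zero>\<^bsub>R\<^esub>)"
  by (simp_all add: fun_ring_def)

definition fun_const :: "'a \<Rightarrow> 'w \<Rightarrow> 'a" where
  "fun_const b = (\<lambda>w. b)"

lemma fun_const_apply [simp]: "fun_const b w = b"
  by (simp add: fun_const_def)

context cring
begin

lemma cring_fun_ring: "cring (fun_ring R :: ('w \<Rightarrow> 'a) ring)"
proof (rule cringI)
  show "abelian_group (fun_ring R :: ('w \<Rightarrow> 'a) ring)"
  proof (rule abelian_groupI)
    fix f :: "'w \<Rightarrow> 'a" assume "f \<in> carrier (fun_ring R)"
    then show "\<exists>g\<in>carrier (fun_ring R). g \<oplus>\<^bsub>fun_ring R\<^esub> f = \<zero>\<^bsub>fun_ring R\<^esub>"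
      by (intro bexI[of _ "\<lambda>w. \<ominus> f w"]) (auto simp: l_neg)
  qed (auto simp: a_ac)
  show "Group.comm_monoid (fun_ring R :: ('w \<Rightarrow> 'a) ring)"
    by (rule comm_monoidI) (auto simp: m_ac)
qed (auto simp: l_distr)

lemma fun_ring_uminus:
  fixes f :: "'w \<Rightarrow> 'a"
  assumes "f \<in> carrier (fun_ring R)"
  shows "\<ominus>\<^bsub>fun_ring R\<^esub> f = (\<lambda>w. \<ominus> f w)"
proof -
  interpret F: cring "fun_ring R :: ('w \<Rightarrow> 'a) ring" by (rule cring_fun_ring)
  show ?thesis using assms by (intro F.minus_equality) (auto simp: l_neg)
qed

text \<open>Negation is multiplication by the constant function \<open>\<ominus> \<one>\<close>, so
  it needs no assumption of its own.\<close>

lemma subring_fun_ringI: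
  fixes S :: "('w \<Rightarrow> 'a) set"
  assumes "\<And>f w. f \<in> S \<Longrightarrow> f w \<in> carrier R" "\<And>b. b \<in> carrier R \<Longrightarrow> fun_const b \<in> S"
    "\<And>f g. f \<in> S \<Longrightarrow> g \<in> S \<Longrightarrow> (\<lambda>w. f w \<oplus> g w) \<in> S"
    "\<And>f g. f \<in> S \<Longrightarrow> g \<in> S \<Longrightarrow> (\<lambda>w. f w \<otimes> g w) \<in> S"
  shows "subring S (fun_ring R)"
proof -
  interpret F: cring "fun_ring R :: ('w \<Rightarrow> 'a) ring" by (rule cring_fun_ring)
  show ?thesis
  proof (rule F.subringI)
    show "\<one>\<^bsub>fun_ring R\<^esub> \<in> S" using assms(2)[OF one_closed] by (simp add: fun_const_def)
    show "\<ominus>\<^bsub>fun_ring R\<^esub> f \<in> S" if f: "f \<in> S" for f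
    proof -
      have "(\<lambda>w. fun_const (\<ominus> \<one>) w \<otimes> f w) \<in> S" using assms(2) assms(4)[OF _ f] by blast
      moreover have "(\<lambda>w. fun_const (\<ominus> \<one>) w \<otimes> f w) = (\<lambda>w. \<ominus> f w)"
        using assms(1)[OF f] by (auto simp: l_minus)
      ultimately show ?thesis using fun_ring_uminus[of f] assms(1)[OF f] by simp
    qed
  qed (use assms in auto)
qed

lemma fun_finsum_closed:
  fixes S :: "('w \<Rightarrow> 'a) set"
  assumes "finite A" "\<And>f w. f \<in> S \<Longrightarrow> f w \<in> carrier R" "(\<lambda>w. \<zero>) \<in> S"
    "\<And>f g. f \<in> S \<Longrightarrow> g \<in> S \<Longrightarrow> (\<lambda>w. f w \<oplus> g w) \<in> S" "\<And>i. i \<in> A \<Longrightarrow> f i \<in> S"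
  shows "(\<lambda>w. \<Oplus>i\<in>A. f i w) \<in> S"
  using assms(1,5)
proof (induction A)
  case (insert j A)
  have "f i w \<in> carrier R" if "i \<in> insert j A" for i w using insert.prems[OF that] assms(2) by blast
  then have "(\<lambda>w. \<Oplus>i\<in>insert j A. f i w) = (\<lambda>w. f j w \<oplus> (\<Oplus>i\<in>A. f i w))"
    using insert.hyps by (auto simp: Pi_def)
  then show ?case using insert assms(4) by simp
qed (use assms(3) in simp)

lemma subring_fun_const: "subring (fun_const ` carrier R) (fun_ring R :: ('w \<Rightarrow> 'a) ring)"
  by (rule subring_fun_ringI) (auto simp: fun_const_def image_iff intro!: bexI)

end

lemma (in noetherian_cring) noetherian_fun_const:
  "noetherian_ring (fun_ring R\<lparr>carrier := fun_const ` carrier R :: ('w \<Rightarrow> 'a) set\<rparr>)"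
proof (rule noetherian_surj_image)
  interpret F: cring "fun_ring R :: ('w \<Rightarrow> 'a) ring" by (rule cring_fun_ring)
  show "ring (fun_ring R\<lparr>carrier := fun_const ` carrier R :: ('w \<Rightarrow> 'a) set\<rparr>)"
    by (rule F.subring_is_ring[OF subring_fun_const])
  show "fun_const \<in> ring_hom R (fun_ring R\<lparr>carrier := fun_const ` carrier R :: ('w \<Rightarrow> 'a) set\<rparr>)"
    by (rule ring_hom_memI) (auto simp: fun_const_def)
qed simp

section \<open>Polynomial functions\<close>

text \<open>Only the values on \<open>carrier R\<close> matter; the recursion is Horner's scheme.\<close>

primrec poly_fun :: "('a, 'r) ring_scheme \<Rightarrow> nat \<Rightarrow> ('a \<Rightarrow> 'a) \<Rightarrow> bool" where
  "poly_fun R 0 p \<longleftrightarrow> (\<exists>c\<in>carrier R. \<forall>t\<in>carrier R. p t = c)"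
| "poly_fun R (Suc n) p \<longleftrightarrow> (\<exists>c\<in>carrier R. \<exists>g. poly_fun R n g \<and>
     (\<forall>t\<in>carrier R. p t = c \<oplus>\<^bsub>R\<^esub> t \<otimes>\<^bsub>R\<^esub> g t))"

context cring
begin

lemma poly_fun_SucI:
  "c \<in> carrier R \<Longrightarrow> poly_fun R n g \<Longrightarrow> (\<And>t. t \<in> carrier R \<Longrightarrow> p t = c \<oplus> t \<otimes> g t) \<Longrightarrow>
    poly_fun R (Suc n) p"
  by auto

lemma poly_fun_SucE:
  assumes "poly_fun R (Suc n) p"
  obtains c g where "c \<in> carrier R" "poly_fun R n g" "\<And>t. t \<in> carrier R \<Longrightarrow> p t = c \<oplus> t \<otimes> g t"
  using assms by auto

lemma poly_fun_closed: "poly_fun R n p \<Longrightarrow> t \<in> carrier R \<Longrightarrow> p t \<in> carrier R"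
  by (induction n arbitrary: p) auto

lemma poly_fun_cong:
  assumes "poly_fun R n p" "\<And>t. t \<in> carrier R \<Longrightarrow> p t = q t"
  shows "poly_fun R n q"
  using assms by (cases n) auto

lemma poly_fun_const: "c \<in> carrier R \<Longrightarrow> poly_fun R n (\<lambda>t. c)"
proof (induction n arbitrary: c)
  case (Suc n)
  show ?case using Suc.prems by (intro poly_fun_SucI[OF Suc.prems Suc.IH[OF zero_closed]]) simp
qed auto

lemma poly_fun_Suc: "poly_fun R n p \<Longrightarrow> poly_fun R (Suc n) p"
proof (induction n arbitrary: p)
  case 0
  then obtain c where c: "c \<in> carrier R" "\<And>t. t \<in> carrier R \<Longrightarrow> p t = c" by auto
  then show ?case by (intro poly_fun_SucI[OF c(1) poly_fun_const[OF zero_closed]]) simp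
next
  case (Suc n)
  obtain c g where "c \<in> carrier R" "poly_fun R n g" "\<And>t. t \<in> carrier R \<Longrightarrow> p t = c \<oplus> t \<otimes> g t"
    using Suc.prems by (rule poly_fun_SucE) blast
  then show ?case by (intro poly_fun_SucI[OF _ Suc.IH])
qed

lemma poly_fun_le: "m \<le> n \<Longrightarrow> poly_fun R m p \<Longrightarrow> poly_fun R n p"
  by (induction rule: dec_induct) (simp_all add: poly_fun_Suc del: poly_fun.simps)

lemma poly_fun_add: "poly_fun R n p \<Longrightarrow> poly_fun R n q \<Longrightarrow> poly_fun R n (\<lambda>t. p t \<oplus> q t)"
proof (induction n arbitrary: p q)
  case (Suc n)
  obtain c g where p: "c \<in> carrier R" "poly_fun R n g" "\<And>t. t \<in> carrier R \<Longrightarrow> p t = c \<oplus> t \<otimes> g t"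
    using Suc.prems(1) by (rule poly_fun_SucE) blast
  obtain d h where q: "d \<in> carrier R" "poly_fun R n h" "\<And>t. t \<in> carrier R \<Longrightarrow> q t = d \<oplus> t \<otimes> h t"
    using Suc.prems(2) by (rule poly_fun_SucE) blast
  show ?case
  proof (rule poly_fun_SucI[OF _ Suc.IH[OF p(2) q(2)]])
    fix t assume t: "t \<in> carrier R"
    show "p t \<oplus> q t = (c \<oplus> d) \<oplus> t \<otimes> (g t \<oplus> h t)"
      unfolding p(3)[OF t] q(3)[OF t]
      using poly_fun_closed[OF p(2) t] poly_fun_closed[OF q(2) t] p(1) q(1) t by algebra
  qed (use p q in simp)
qed auto

lemma poly_fun_smult: "b \<in> carrier R \<Longrightarrow> poly_fun R n p \<Longrightarrow> poly_fun R n (\<lambda>t. b \<otimes> p t)"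
proof (induction n arbitrary: p)
  case (Suc n)
  obtain c g where p: "c \<in> carrier R" "poly_fun R n g" "\<And>t. t \<in> carrier R \<Longrightarrow> p t = c \<oplus> t \<otimes> g t"
    using Suc.prems(2) by (rule poly_fun_SucE) blast
  show ?case
  proof (rule poly_fun_SucI[OF _ Suc.IH[OF Suc.prems(1) p(2)]])
    fix t assume t: "t \<in> carrier R"
    show "b \<otimes> p t = b \<otimes> c \<oplus> t \<otimes> (b \<otimes> g t)"
      unfolding p(3)[OF t] using poly_fun_closed[OF p(2) t] p(1) t Suc.prems(1) by algebra
  qed (use p Suc.prems in simp)
qed auto

lemma poly_fun_shift: "poly_fun R n p \<Longrightarrow> poly_fun R (Suc n) (\<lambda>t. t \<otimes> p t)"
  by (rule poly_fun_SucI[OF zero_closed]) (auto simp: poly_fun_closed)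

lemma poly_fun_mult: "poly_fun R m p \<Longrightarrow> poly_fun R n q \<Longrightarrow> poly_fun R (m + n) (\<lambda>t. p t \<otimes> q t)"
proof (induction m arbitrary: p)
  case 0
  then obtain c where c: "c \<in> carrier R" "\<And>t. t \<in> carrier R \<Longrightarrow> p t = c" by auto
  have "poly_fun R n (\<lambda>t. p t \<otimes> q t)"
    by (rule poly_fun_cong[OF poly_fun_smult[OF c(1) 0(2)]]) (simp add: c)
  then show ?case by simp
next
  case (Suc m)
  obtain c g where p: "c \<in> carrier R" "poly_fun R m g" "\<And>t. t \<in> carrier R \<Longrightarrow> p t = c \<oplus> t \<otimes> g t"
    using Suc.prems(1) by (rule poly_fun_SucE) blast
  have 1: "poly_fun R (Suc (m + n)) (\<lambda>t. t \<otimes> (g t \<otimes> q t))"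
    by (rule poly_fun_shift[OF Suc.IH[OF p(2) Suc.prems(2)]])
  have 2: "poly_fun R (Suc (m + n)) (\<lambda>t. c \<otimes> q t)"
    by (rule poly_fun_le[OF _ poly_fun_smult[OF p(1) Suc.prems(2)]]) simp
  have "poly_fun R (Suc (m + n)) (\<lambda>t. p t \<otimes> q t)"
  proof (rule poly_fun_cong[OF poly_fun_add[OF 2 1]])
    fix t assume t: "t \<in> carrier R"
    show "c \<otimes> q t \<oplus> t \<otimes> (g t \<otimes> q t) = p t \<otimes> q t"
      unfolding p(3)[OF t]
      using poly_fun_closed[OF p(2) t] poly_fun_closed[OF Suc.prems(2) t] p(1) t by algebra
  qed
  then show ?case by (simp only: add_Suc)
qed

text \<open>Synthetic division by \<open>t \<ominus> a\<close>: if
  \<open>p t = c \<oplus> t \<otimes> g t\<close> and \<open>g\<close> has quotient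
  \<open>h\<close>, then \<open>p\<close> has quotient
  \<open>g a \<oplus> t \<otimes> h t\<close>.\<close>

lemma poly_fun_divide:
  assumes "poly_fun R (Suc n) p" and a: "a \<in> carrier R"
  shows "\<exists>g. poly_fun R n g \<and> (\<forall>t\<in>carrier R. p t = p a \<oplus> (t \<ominus> a) \<otimes> g t)"
  using assms(1)
proof (induction n arbitrary: p)
  case 0
  obtain c g where p: "c \<in> carrier R" "poly_fun R 0 g" "\<And>t. t \<in> carrier R \<Longrightarrow> p t = c \<oplus> t \<otimes> g t"
    using 0 by (rule poly_fun_SucE) blast
  obtain d where d: "d \<in> carrier R" "\<And>t. t \<in> carrier R \<Longrightarrow> g t = d" using p(2) by auto
  have "p t = p a \<oplus> (t \<ominus> a) \<otimes> g t" if t: "t \<in> carrier R" for t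
    unfolding p(3)[OF t] p(3)[OF a] d(2)[OF t] d(2)[OF a] using p(1) d(1) t a by algebra
  then show ?case using p(2) by blast
next
  case (Suc n)
  obtain c g where p: "c \<in> carrier R" "poly_fun R (Suc n) g" "\<And>t. t \<in> carrier R \<Longrightarrow> p t = c \<oplus> t \<otimes> g t"
    using Suc.prems by (rule poly_fun_SucE) blast
  obtain h where h: "poly_fun R n h" "\<forall>t\<in>carrier R. g t = g a \<oplus> (t \<ominus> a) \<otimes> h t"
    using Suc.IH[OF p(2)] by blast
  have ga: "g a \<in> carrier R" by (rule poly_fun_closed[OF p(2) a])
  have "poly_fun R (Suc n) (\<lambda>t. g a \<oplus> t \<otimes> h t)"
    by (rule poly_fun_SucI[OF ga h(1)]) simp
  moreover have "p t = p a \<oplus> (t \<ominus> a) \<otimes> (g a \<oplus> t \<otimes> h t)" if t: "t \<in> carrier R" for t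
  proof -
    have ht: "h t \<in> carrier R" by (rule poly_fun_closed[OF h(1) t])
    have "p t = c \<oplus> t \<otimes> (g a \<oplus> (t \<ominus> a) \<otimes> h t)"
      using p(3)[OF t] h(2) t by simp
    also have "\<dots> = (c \<oplus> a \<otimes> g a) \<oplus> (t \<ominus> a) \<otimes> (g a \<oplus> t \<otimes> h t)"
      using p(1) ga ht a t by algebra
    finally show ?thesis using p(3)[OF a] by simp
  qed
  ultimately show ?case by blast
qed

text \<open>The bound on the number of roots over the domain \<open>R/Q\<close>: one root is split
  off, and the others remain roots of the quotient because the differences
  \<open>e i \<ominus> e j\<close> are not in \<open>Q\<close>. The degree drops while the set of
  roots stays infinite.\<close>

lemma poly_fun_infinite_roots:
  assumes Q: "primeideal Q R" and e: "\<And>i::nat. e i \<in> carrier R"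
    and ne: "\<And>i j. i \<noteq> j \<Longrightarrow> e i \<ominus> e j \<notin> Q"
    and "poly_fun R n p" "infinite {i. p (e i) \<in> Q}" and t: "t \<in> carrier R"
  shows "p t \<in> Q"
  using assms(4,5) t
proof (induction n arbitrary: p t)
  case 0
  then obtain c where c: "c \<in> carrier R" "\<And>t. t \<in> carrier R \<Longrightarrow> p t = c" by auto
  obtain i where "p (e i) \<in> Q" using 0(2) not_finite_existsD by blast
  then show ?case using c e 0(3) by simp
next
  case (Suc n)
  interpret Q: primeideal Q R by fact
  obtain j where j: "p (e j) \<in> Q" using Suc.prems(2) not_finite_existsD by blast
  obtain g where g: "poly_fun R n g" "\<forall>t\<in>carrier R. p t = p (e j) \<oplus> (t \<ominus> e j) \<otimes> g t"
    using poly_fun_divide[OF Suc.prems(1) e] by blast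
  have "g (e i) \<in> Q" if i: "p (e i) \<in> Q" "i \<noteq> j" for i
  proof -
    have c: "g (e i) \<in> carrier R" "e i \<in> carrier R" "e j \<in> carrier R" "p (e j) \<in> carrier R"
      using poly_fun_closed[OF g(1)] e Q.Icarr[OF j] by auto
    have "(e i \<ominus> e j) \<otimes> g (e i) = p (e i) \<ominus> p (e j)"
      unfolding bspec[OF g(2) c(2)] using c by algebra
    also have "\<dots> \<in> Q" by (rule Q.minus_closed_ideal[OF i(1) j])
    finally show ?thesis using Q.I_prime[of "e i \<ominus> e j" "g (e i)"] ne[OF i(2)] c by auto
  qed
  then have "{i. p (e i) \<in> Q} - {j} \<subseteq> {i. g (e i) \<in> Q}" by blast
  then have "infinite {i. g (e i) \<in> Q}"
    using Suc.prems(2) by (meson finite_Diff2 finite.emptyI finite_insert infinite_super)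
  then have "g t \<in> Q" using Suc.IH[OF g(1)] Suc.prems(3) by blast
  then show ?case using bspec[OF g(2) Suc.prems(3)] j e Suc.prems(3) by (simp add: Q.I_l_closed)
qed

end

section \<open>The chain of primes in the algebra of linear forms\<close>

text \<open>Affine \<open>s\<close>-space consists of the sequences that vanish from index \<open>s\<close> on; for \<open>j = s\<close> only the
  origin is left.\<close>

definition lin_points :: "('a, 'r) ring_scheme \<Rightarrow> nat \<Rightarrow> nat \<Rightarrow> (nat \<Rightarrow> 'a) set" where
  "lin_points R s j = {w. (\<forall>i. w i \<in> carrier R) \<and> (\<forall>i. i < j \<or> s \<le> i \<longrightarrow> w i = \<zero>\<^bsub>R\<^esub>)}"

text \<open>The value off the affine space is irrelevant, but has to lie in the ring.\<close>

definition coord :: "('a, 'r) ring_scheme \<Rightarrow> nat \<Rightarrow> (nat \<Rightarrow> 'a) \<Rightarrow> 'a" where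
  "coord R i = (\<lambda>w. if w i \<in> carrier R then w i else \<zero>\<^bsub>R\<^esub>)"

text \<open>Polynomial behaviour is demanded only along lines through two points, with a degree that
  may depend on the line. This is all that the primality argument uses, and it avoids polynomials in
  several variables.\<close>

definition line_poly :: "('a, 'r) ring_scheme \<Rightarrow> ((nat \<Rightarrow> 'a) \<Rightarrow> 'a) set" where
  "line_poly R = {f. (\<forall>w. f w \<in> carrier R) \<and> (\<forall>w w'. (\<forall>i. w i \<in> carrier R) \<longrightarrow> (\<forall>i. w' i \<in> carrier R) \<longrightarrow>
     (\<exists>n. poly_fun R n (\<lambda>t. f (\<lambda>i. w i \<oplus>\<^bsub>R\<^esub> t \<otimes>\<^bsub>R\<^esub> (w' i \<ominus>\<^bsub>R\<^esub> w i)))))}"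

context cring
begin

lemma coord_closed [simp]: "coord R i w \<in> carrier R"
  by (simp add: coord_def)

lemma line_polyD:
  assumes "f \<in> line_poly R" "\<And>i. w i \<in> carrier R" "\<And>i. w' i \<in> carrier R"
  obtains n where "poly_fun R n (\<lambda>t. f (\<lambda>i. w i \<oplus> t \<otimes> (w' i \<ominus> w i)))"
  using assms unfolding line_poly_def by blast

lemma subring_line_poly: "subring (line_poly R) (fun_ring R)"
proof (rule subring_fun_ringI)
  show "f w \<in> carrier R" if "f \<in> line_poly R" for f w using that by (simp add: line_poly_def)
  show "fun_const b \<in> line_poly R" if "b \<in> carrier R" for b
    using that poly_fun_const unfolding line_poly_def by auto
next
  fix f g assume fg: "f \<in> line_poly R" "g \<in> line_poly R"
  have "\<exists>n. poly_fun R n (\<lambda>t. f (\<lambda>i. w i \<oplus> t \<otimes> (w' i \<ominus> w i)) \<oplus> g (\<lambda>i. w i \<oplus> t \<otimes> (w' i \<ominus> w i)))"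
    "\<exists>n. poly_fun R n (\<lambda>t. f (\<lambda>i. w i \<oplus> t \<otimes> (w' i \<ominus> w i)) \<otimes> g (\<lambda>i. w i \<oplus> t \<otimes> (w' i \<ominus> w i)))"
    if w: "\<forall>i. w i \<in> carrier R" "\<forall>i. w' i \<in> carrier R" for w w'
  proof -
    obtain m where m: "poly_fun R m (\<lambda>t. f (\<lambda>i. w i \<oplus> t \<otimes> (w' i \<ominus> w i)))"
      by (rule line_polyD[OF fg(1), of w w']) (use w in auto)
    obtain n where n: "poly_fun R n (\<lambda>t. g (\<lambda>i. w i \<oplus> t \<otimes> (w' i \<ominus> w i)))"
      by (rule line_polyD[OF fg(2), of w w']) (use w in auto)
    show "\<exists>n. poly_fun R n (\<lambda>t. f (\<lambda>i. w i \<oplus> t \<otimes> (w' i \<ominus> w i)) \<oplus> g (\<lambda>i. w i \<oplus> t \<otimes> (w' i \<ominus> w i)))"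
      using poly_fun_add[OF poly_fun_le[OF max.cobounded1 m] poly_fun_le[OF max.cobounded2 n]] by blast
    show "\<exists>n. poly_fun R n (\<lambda>t. f (\<lambda>i. w i \<oplus> t \<otimes> (w' i \<ominus> w i)) \<otimes> g (\<lambda>i. w i \<oplus> t \<otimes> (w' i \<ominus> w i)))"
      using poly_fun_mult[OF m n] by blast
  qed
  then show "(\<lambda>w. f w \<oplus> g w) \<in> line_poly R" "(\<lambda>w. f w \<otimes> g w) \<in> line_poly R"
    using fg unfolding line_poly_def by auto
qed

lemma coord_line_poly: "coord R k \<in> line_poly R"
proof -
  have "\<exists>n. poly_fun R n (\<lambda>t. coord R k (\<lambda>i. w i \<oplus> t \<otimes> (w' i \<ominus> w i)))"
    if w: "\<forall>i. w i \<in> carrier R" "\<forall>i. w' i \<in> carrier R" for w w'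
  proof -
    have "w' k \<ominus> w k \<in> carrier R" using w by simp
    then have "poly_fun R (Suc 0) (\<lambda>t. coord R k (\<lambda>i. w i \<oplus> t \<otimes> (w' i \<ominus> w i)))"
      by (intro poly_fun_SucI[OF _ poly_fun_const, of "w k" "w' k \<ominus> w k"]) (auto simp: w coord_def)
    then show ?thesis by blast
  qed
  then show ?thesis unfolding line_poly_def by simp
qed

lemma fun_ring_subring_closed:
  assumes "subring T (fun_ring R)"
  shows "\<And>f w. f \<in> T \<Longrightarrow> f w \<in> carrier R" "(\<lambda>w. \<zero>) \<in> T" "(\<lambda>w. \<one>) \<in> T"
    "\<And>f g. f \<in> T \<Longrightarrow> g \<in> T \<Longrightarrow> (\<lambda>w. f w \<oplus> g w) \<in> T"
    "\<And>f g. f \<in> T \<Longrightarrow> g \<in> T \<Longrightarrow> (\<lambda>w. f w \<otimes> g w) \<in> T"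
  using subringE(1,2,3,6,7)[OF assms] by auto

lemma cring_fun_subring:
  "subring T (fun_ring R) \<Longrightarrow> cring (fun_ring R\<lparr>carrier := T\<rparr>)"
  by (rule cring.cring_subring[OF cring_fun_ring])

lemma eval_ideal:
  assumes T: "subring T (fun_ring R)" and P: "ideal P R"
  shows "ideal {f \<in> T. \<forall>w\<in>V. f w \<in> P} (fun_ring R\<lparr>carrier := T\<rparr>)"
proof -
  interpret P: ideal P R by fact
  note cl = fun_ring_subring_closed[OF T]
  show ?thesis
    by (rule cring.ideal_of_closed[OF cring_fun_subring[OF T]])
      (auto simp: cl P.I_l_closed P.zero_closed intro: P.a_closed)
qed

text \<open>The hypothesis \<open>dense\<close> is irreducibility of \<open>V\<close>: two nonempty
  open subsets, given by \<open>f \<notin> P\<close> and \<open>g \<notin> P\<close>, have a common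
  point, and there the product is outside \<open>P\<close>.\<close>

lemma eval_prime:
  assumes T: "subring T (fun_ring R)" and P: "primeideal P R" and V: "V \<noteq> {}"
    and dense: "\<And>f g w w'. f \<in> T \<Longrightarrow> g \<in> T \<Longrightarrow> w \<in> V \<Longrightarrow> w' \<in> V \<Longrightarrow> f w \<notin> P \<Longrightarrow> g w' \<notin> P \<Longrightarrow>
      \<exists>v\<in>V. f v \<notin> P \<and> g v \<notin> P"
  shows "primeideal {f \<in> T. \<forall>w\<in>V. f w \<in> P} (fun_ring R\<lparr>carrier := T\<rparr>)"
proof -
  interpret P: primeideal P R by fact
  note cl = fun_ring_subring_closed[OF T]
  show ?thesis
  proof (rule primeidealI[OF eval_ideal[OF T P.is_ideal] cring_fun_subring[OF T]])
    have "(\<lambda>w. \<one>) \<in> T" "(\<lambda>w. \<one>) \<notin> {f \<in> T. \<forall>w\<in>V. f w \<in> P}"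
      using cl(3) V P.one_notin by auto
    then show "carrier (fun_ring R\<lparr>carrier := T\<rparr>) \<noteq> {f \<in> T. \<forall>w\<in>V. f w \<in> P}" by auto
  next
    fix f g assume fg: "f \<in> carrier (fun_ring R\<lparr>carrier := T\<rparr>)" "g \<in> carrier (fun_ring R\<lparr>carrier := T\<rparr>)"
      and prod: "f \<otimes>\<^bsub>fun_ring R\<lparr>carrier := T\<rparr>\<^esub> g \<in> {f \<in> T. \<forall>w\<in>V. f w \<in> P}"
    have "f \<in> T" "g \<in> T" using fg by auto
    moreover have "f v \<in> P \<or> g v \<in> P" if "v \<in> V" for v
    proof (rule P.I_prime)
      show "f v \<in> carrier R" "g v \<in> carrier R" using fg cl(1) by auto
      show "f v \<otimes> g v \<in> P" using prod that by simp
    qed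
    ultimately show "f \<in> {f \<in> T. \<forall>w\<in>V. f w \<in> P} \<or> g \<in> {f \<in> T. \<forall>w\<in>V. f w \<in> P}"
      using dense by blast
  qed
qed

text \<open>The parameters \<open>e i\<close>, distinct modulo \<open>Q\<close>, give infinitely many points on the line through a
  point with \<open>f \<notin> Q\<close> and one with \<open>g \<notin> Q\<close>, and each of \<open>f\<close>, \<open>g\<close> vanishes modulo \<open>Q\<close> at only
  finitely many of them.\<close>

lemma lin_points_prime:
  assumes T: "subring T (fun_ring R)" "T \<subseteq> line_poly R" and Q: "primeideal Q R"
    and e: "\<And>i::nat. e i \<in> carrier R" "\<And>i j. i \<noteq> j \<Longrightarrow> e i \<ominus> e j \<notin> Q"
  shows "primeideal {f \<in> T. \<forall>w\<in>lin_points R s j. f w \<in> Q} (fun_ring R\<lparr>carrier := T\<rparr>)"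
proof (rule eval_prime[OF T(1) Q])
  show "lin_points R s j \<noteq> {}" unfolding lin_points_def by (auto intro!: exI[of _ "\<lambda>i. \<zero>"])
next
  fix f g w w' assume fg: "f \<in> T" "g \<in> T" and w: "w \<in> lin_points R s j" "w' \<in> lin_points R s j"
    and nz: "f w \<notin> Q" "g w' \<notin> Q"
  let ?l = "\<lambda>t i. w i \<oplus> t \<otimes> (w' i \<ominus> w i)"
  have wc: "w i \<in> carrier R" "w' i \<in> carrier R" for i using w by (auto simp: lin_points_def)
  have l0: "?l \<zero> = w"
  proof
    fix i
    have "w i \<in> carrier R" "w' i \<in> carrier R" by (fact wc)+
    then show "?l \<zero> i = w i" by algebra
  qed
  have l1: "?l \<one> = w'"
  proof
    fix i
    have "w i \<in> carrier R" "w' i \<in> carrier R" by (fact wc)+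
    then show "?l \<one> i = w' i" by algebra
  qed
  obtain m where m: "poly_fun R m (\<lambda>t. f (?l t))"
    by (rule line_polyD[of f w w']) (use fg T(2) wc in auto)
  obtain n where n: "poly_fun R n (\<lambda>t. g (?l t))"
    by (rule line_polyD[of g w w']) (use fg T(2) wc in auto)
  \<comment> \<open>With infinitely many zeros modulo \<open>Q\<close> the polynomial function would
    vanish modulo \<open>Q\<close> also at the parameter \<open>\<zero>\<close>, that is, at
    \<open>w\<close>.\<close>
  have 1: "finite {i. f (?l (e i)) \<in> Q}"
    using poly_fun_infinite_roots[where e = e and t = \<zero>, OF Q e m] nz(1) l0 by auto
  have 2: "finite {i. g (?l (e i)) \<in> Q}"
    using poly_fun_infinite_roots[where e = e and t = \<one>, OF Q e n] nz(2) l1 by auto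
  obtain k where "k \<notin> {i. f (?l (e i)) \<in> Q} \<union> {i. g (?l (e i)) \<in> Q}"
    using ex_new_if_finite[OF infinite_UNIV_nat finite_UnI[OF 1 2]] by blast
  moreover have "?l (e k) \<in> lin_points R s j"
    using w e(1)[of k] by (auto simp: lin_points_def a_minus_def)
  ultimately show "\<exists>v\<in>lin_points R s j. f v \<notin> Q \<and> g v \<notin> Q" by blast
qed

lemma origin_prime:
  assumes T: "subring T (fun_ring R)" and P: "primeideal P R"
  shows "primeideal {f \<in> T. f (\<lambda>i. \<zero>) \<in> P} (fun_ring R\<lparr>carrier := T\<rparr>)"
  using eval_prime[OF T P, of "{\<lambda>i. \<zero>}"] by auto

lemma lin_points_all: "lin_points R s s = {\<lambda>i. \<zero>}"
proof -
  have "i < s \<or> s \<le> i" for i by linarith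
  then show ?thesis by (auto simp: lin_points_def fun_eq_iff)
qed

lemma pchain_lin_forms:
  assumes T: "subring T (fun_ring R)" "T \<subseteq> line_poly R" "range fun_const \<inter> {f. \<forall>w. f w \<in> carrier R} \<subseteq> T"
    and Q: "primeideal Q R"
    and u: "\<And>i. i < s \<Longrightarrow> u i \<in> carrier R - Q" "\<And>i. i < s \<Longrightarrow> (\<lambda>w. u i \<otimes> coord R i w) \<in> T"
    and e: "\<And>i::nat. e i \<in> carrier R" "\<And>i j. i \<noteq> j \<Longrightarrow> e i \<ominus> e j \<notin> Q"
    and ch: "pchain R Q d P"
  shows "pchain (fun_ring R\<lparr>carrier := T\<rparr>) {} (s + d) {f \<in> T. f (\<lambda>i. \<zero>) \<in> P}"
proof -
  interpret Q: primeideal Q R by fact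
  have psub: "A \<subset> B" if "A \<subseteq> B" "x \<in> B" "x \<notin> A" for A B :: "((nat \<Rightarrow> 'a) \<Rightarrow> 'a) set" and x
    using that by blast
  have V: "pchain (fun_ring R\<lparr>carrier := T\<rparr>) {} j {f \<in> T. \<forall>w\<in>lin_points R s j. f w \<in> Q}" if "j \<le> s" for j
    using that
  proof (induction j)
    case 0
    then show ?case using lin_points_prime[where e = e, OF T(1,2) Q e] by simp
  next
    case (Suc j)
    let ?f = "\<lambda>w. u j \<otimes> coord R j w"
    have uj: "u j \<in> carrier R" "u j \<notin> Q" using u(1)[of j] Suc.prems by auto
    let ?w = "\<lambda>i. if i = j then \<one> else \<zero>"
    have "lin_points R s (Suc j) \<subseteq> lin_points R s j" by (auto simp: lin_points_def)
    then have sub: "{f \<in> T. \<forall>w\<in>lin_points R s j. f w \<in> Q} \<subseteq> {f \<in> T. \<forall>w\<in>lin_points R s (Suc j). f w \<in> Q}"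
      by blast
    have "?f w \<in> Q" if "w \<in> lin_points R s (Suc j)" for w
      using that uj by (simp add: lin_points_def coord_def)
    moreover have "?f \<in> T" using u(2) Suc.prems by simp
    ultimately have in': "?f \<in> {f \<in> T. \<forall>w\<in>lin_points R s (Suc j). f w \<in> Q}" by simp
    have "?w \<in> lin_points R s j" using Suc.prems by (auto simp: lin_points_def)
    moreover have "?f ?w \<notin> Q" using uj by (simp add: coord_def)
    ultimately have notin: "?f \<notin> {f \<in> T. \<forall>w\<in>lin_points R s j. f w \<in> Q}" by blast
    have "{f \<in> T. \<forall>w\<in>lin_points R s j. f w \<in> Q} \<subset> {f \<in> T. \<forall>w\<in>lin_points R s (Suc j). f w \<in> Q}"
      using sub in' notin by (rule psub)
    then show ?case
      using lin_points_prime[where e = e and s = s and j = "Suc j", OF T(1,2) Q e] Suc.IH Suc.prems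
      unfolding pchain.simps by (intro conjI exI) simp_all
  qed
  show ?thesis using ch
  proof (induction d arbitrary: P)
    case 0
    then have P: "primeideal P R" "Q \<subseteq> P" by auto
    \<comment> \<open>The bottom prime of the given chain may be larger than \<open>Q\<close>.
      Enlarging the top of the lower chain joins the two chains without loss of length.\<close>
    have "{f \<in> T. \<forall>w\<in>lin_points R s s. f w \<in> Q} \<subseteq> {f \<in> T. f (\<lambda>i. \<zero>) \<in> P}"
      using P(2) by (auto simp: lin_points_all)
    then show ?case using pchain_enlarge[OF V[of s] origin_prime[OF T(1) P(1)]] by simp
  next
    case (Suc d)
    then obtain P' where P': "P' \<subset> P" "pchain R Q d P'" "primeideal P R" unfolding pchain.simps by blast
    interpret P: primeideal P R by fact
    obtain b where b: "b \<in> P" "b \<notin> P'" using P'(1) by blast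
    then have "fun_const b \<in> T" using T(3) P.Icarr by fastforce
    have "{f \<in> T. f (\<lambda>i. \<zero>) \<in> P'} \<subset> {f \<in> T. f (\<lambda>i. \<zero>) \<in> P}"
    proof (rule psub)
      show "{f \<in> T. f (\<lambda>i. \<zero>) \<in> P'} \<subseteq> {f \<in> T. f (\<lambda>i. \<zero>) \<in> P}" using P'(1) by blast
      show "fun_const b \<in> {f \<in> T. f (\<lambda>i. \<zero>) \<in> P}" using \<open>fun_const b \<in> T\<close> b by simp
      show "fun_const b \<notin> {f \<in> T. f (\<lambda>i. \<zero>) \<in> P'}" using b by simp
    qed
    then show ?case
      using Suc.IH[OF P'(2)] origin_prime[OF T(1) P'(3)]
      unfolding pchain.simps add_Suc_right by (intro conjI exI)
  qed
qed

end

section \<open>From the algebra of linear forms back to the base ring\<close>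

lemma (in cring) contract_prime:
  assumes T: "subring T (fun_ring R)" "fun_const ` carrier R \<subseteq> T"
    and P: "primeideal P (fun_ring R\<lparr>carrier := T\<rparr>)"
  shows "primeideal {b \<in> carrier R. fun_const b \<in> P} R"
proof -
  interpret P: primeideal P "fun_ring R\<lparr>carrier := T\<rparr>" by fact
  note P_D = ideal_carrier_updateD[OF P.is_ideal, simplified]
  have const: "fun_const \<zero> = (\<lambda>w. \<zero>)" "fun_const \<one> = (\<lambda>w. \<one>)"
    "fun_const (a \<oplus> b) = (\<lambda>w. fun_const a w \<oplus> fun_const b w)"
    "fun_const (a \<otimes> b) = (\<lambda>w. fun_const a w \<otimes> fun_const b w)" for a b
    by (auto simp: fun_const_def)
  have one: "(\<lambda>w. \<one>) \<notin> P" using P.one_notin by simp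
  have ideal: "ideal {b \<in> carrier R. fun_const b \<in> P} R"
  proof (rule ideal_of_closed)
    show "\<zero> \<in> {b \<in> carrier R. fun_const b \<in> P}" using P_D(2) by (simp add: const(1))
    show "a \<oplus> b \<in> {b \<in> carrier R. fun_const b \<in> P}"
      if "a \<in> {b \<in> carrier R. fun_const b \<in> P}" "b \<in> {b \<in> carrier R. fun_const b \<in> P}" for a b
      using that P_D(3)[of "fun_const a" "fun_const b"] by (simp add: const(3) del: fun_const_apply)
    show "r \<otimes> a \<in> {b \<in> carrier R. fun_const b \<in> P}"
      if "a \<in> {b \<in> carrier R. fun_const b \<in> P}" "r \<in> carrier R" for a r
    proof -
      have "fun_const r \<in> T" using that T(2) by blast
      then show ?thesis
        using that P_D(4)[of "fun_const a" "fun_const r"] by (simp add: const(4) del: fun_const_apply)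
    qed
  qed blast
  show ?thesis
  proof (rule primeidealI[OF ideal is_cring])
    show "carrier R \<noteq> {b \<in> carrier R. fun_const b \<in> P}" 
    proof
      assume "carrier R = {b \<in> carrier R. fun_const b \<in> P}"
      then have "fun_const \<one> \<in> P" using one_closed by blast
      then show False using one by (simp add: const(2))
    qed
    show "a \<in> {b \<in> carrier R. fun_const b \<in> P} \<or> b \<in> {b \<in> carrier R. fun_const b \<in> P}"
      if ab: "a \<in> carrier R" "b \<in> carrier R" and prod: "a \<otimes> b \<in> {b \<in> carrier R. fun_const b \<in> P}" for a b
    proof -
      have "fun_const a \<in> T" "fun_const b \<in> T" using ab T(2) by auto
      then show ?thesis
        using P.I_prime[of "fun_const a" "fun_const b"] ab prod
        by (simp add: const(4) del: fun_const_apply)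
    qed
  qed
qed


text \<open>For \<open>i < j\<close> the difference is \<open>t [^] i\<close> times
  \<open>1 - t^(j-i)\<close>. The first factor is outside \<open>Q\<close> since \<open>t\<close>
  is; the second is outside \<open>m\<close>, hence outside \<open>Q\<close>, since \<open>t\<close>
  is in \<open>m\<close>. The powers of \<open>t\<close> thus serve as infinitely many parameters on
  a line.\<close>

lemma (in cring) power_diff_notin_prime:
  assumes m: "primeideal m R" and Q: "primeideal Q R" "Q \<subseteq> m"
    and t: "t \<in> m" "t \<notin> Q" and "i \<noteq> j"
  shows "t [^] (i::nat) \<ominus> t [^] j \<notin> Q"
proof -
  interpret m: primeideal m R by fact
  interpret Q: primeideal Q R by fact
  have tc: "t \<in> carrier R" using t(1) by (rule m.Icarr)
  have pow: "t [^] i \<notin> Q" for i :: nat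
  proof (induction i)
    case (Suc i)
    then show ?case using Q.I_prime[of "t [^] i" t] t(2) tc by auto
  qed (simp add: Q.one_notin)
  have ne: "t [^] i \<ominus> t [^] j \<notin> Q" if "i < j" for i j :: nat
  proof
    assume diff: "t [^] i \<ominus> t [^] j \<in> Q"
    obtain k where k: "j = i + Suc k" using \<open>i < j\<close> less_iff_Suc_add by auto
    have c: "t [^] i \<in> carrier R" "t [^] k \<in> carrier R" using tc by auto
    have "t [^] j = t [^] i \<otimes> (t [^] k \<otimes> t)" unfolding k nat_pow_mult[OF tc, symmetric] by simp
    then have "t [^] i \<ominus> t [^] j = t [^] i \<otimes> (\<one> \<ominus> t [^] k \<otimes> t)"
      using c tc by (simp only:) algebra
    then have "\<one> \<ominus> t [^] k \<otimes> t \<in> Q"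
      using diff Q.I_prime[of "t [^] i" "\<one> \<ominus> t [^] k \<otimes> t"] pow[of i] c tc by simp
    then have "\<one> \<ominus> t [^] k \<otimes> t \<in> m" using Q(2) by blast
    then have "(\<one> \<ominus> t [^] k \<otimes> t) \<oplus> t [^] k \<otimes> t \<in> m"
      by (rule m.a_closed) (rule m.I_l_closed[OF t(1) c(2)])
    moreover have "(\<one> \<ominus> t [^] k \<otimes> t) \<oplus> t [^] k \<otimes> t = \<one>" using c tc by algebra
    ultimately show False using m.one_notin by simp
  qed
  show ?thesis
  proof (cases "i < j")
    case False
    have "t [^] i \<in> carrier R" "t [^] j \<in> carrier R" using tc by auto
    then have "t [^] j \<ominus> t [^] i = \<ominus> \<one> \<otimes> (t [^] i \<ominus> t [^] j)" by algebra
    then have "t [^] j \<ominus> t [^] i \<in> Q" if "t [^] i \<ominus> t [^] j \<in> Q"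
      using Q.I_l_closed[OF that, of "\<ominus> \<one>"] by simp
    then show ?thesis using ne[of j i] False assms(6) by linarith
  qed (rule ne)
qed

lemma (in cring) finsum_swap:
  assumes "finite A" "finite B" "\<And>i j. i \<in> A \<Longrightarrow> j \<in> B \<Longrightarrow> f i j \<in> carrier R"
  shows "(\<Oplus>i\<in>A. \<Oplus>j\<in>B. f i j) = (\<Oplus>j\<in>B. \<Oplus>i\<in>A. f i j)"
  using assms(1,3)
proof (induction A)
  case (insert a A)
  have c: "f a j \<in> carrier R" "(\<Oplus>i\<in>A. f i j) \<in> carrier R" if "j \<in> B" for j
    using insert.prems that by (auto intro!: finsum_closed)
  have "(\<Oplus>j\<in>B. \<Oplus>i\<in>insert a A. f i j) = (\<Oplus>j\<in>B. f a j \<oplus> (\<Oplus>i\<in>A. f i j))"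
    using insert.hyps insert.prems c by (intro finsum_cong') (auto simp: Pi_def)
  also have "\<dots> = (\<Oplus>j\<in>B. f a j) \<oplus> (\<Oplus>j\<in>B. \<Oplus>i\<in>A. f i j)"
    using c by (intro finsum_addf) auto
  also have "\<dots> = (\<Oplus>i\<in>insert a A. \<Oplus>j\<in>B. f i j)"
    using insert by (subst finsum_insert) (auto intro!: finsum_closed)
  finally show ?case by simp
qed simp

text \<open>Interchanging the summations and using \<open>eq\<close> turns the second sum into the
  sum of all \<open>\<alpha> i \<otimes> (u i \<otimes> y i)\<close>, which cancels everything in
  the first sum that involves \<open>y\<close>. Hence the right-hand side lies in every ideal that
  contains all \<open>u i \<otimes> y i \<oplus> \<ominus> a i\<close> and all sums of
  \<open>c i e \<otimes> y i\<close> over \<open>i\<close>.\<close>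

lemma (in cring) linear_relations_identity:
  assumes fin: "finite I" "finite E"
    and \<alpha>: "\<And>i. i \<in> I \<Longrightarrow> \<alpha> i \<in> carrier R" and \<beta>: "\<And>e. e \<in> E \<Longrightarrow> \<beta> e \<in> carrier R"
    and u: "\<And>i. i \<in> I \<Longrightarrow> u i \<in> carrier R" and y: "\<And>i. i \<in> I \<Longrightarrow> y i \<in> carrier R"
    and a: "\<And>i. i \<in> I \<Longrightarrow> a i \<in> carrier R"
    and c: "\<And>i e. i \<in> I \<Longrightarrow> e \<in> E \<Longrightarrow> c i e \<in> carrier R"
    and eq: "\<And>i. i \<in> I \<Longrightarrow> \<alpha> i \<otimes> u i = (\<Oplus>e\<in>E. c i e \<otimes> \<beta> e)"
  shows "(\<Oplus>i\<in>I. \<ominus> \<alpha> i \<otimes> (u i \<otimes> y i \<oplus> \<ominus> a i)) \<oplus> (\<Oplus>e\<in>E. \<beta> e \<otimes> (\<Oplus>i\<in>I. c i e \<otimes> y i))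
    = (\<Oplus>i\<in>I. \<alpha> i \<otimes> a i)"
proof -
  have "(\<Oplus>e\<in>E. \<beta> e \<otimes> (\<Oplus>i\<in>I. c i e \<otimes> y i)) = (\<Oplus>e\<in>E. \<Oplus>i\<in>I. (c i e \<otimes> \<beta> e) \<otimes> y i)"
  proof (rule finsum_cong')
    fix e assume e: "e \<in> E"
    have "\<beta> e \<otimes> (\<Oplus>i\<in>I. c i e \<otimes> y i) = (\<Oplus>i\<in>I. \<beta> e \<otimes> (c i e \<otimes> y i))"
      using \<beta> e c y fin by (intro finsum_rdistr) auto
    also have "\<dots> = (\<Oplus>i\<in>I. (c i e \<otimes> \<beta> e) \<otimes> y i)"
      using \<beta> e c y by (intro finsum_cong') (auto simp: m_ac)
    finally show "\<beta> e \<otimes> (\<Oplus>i\<in>I. c i e \<otimes> y i) = (\<Oplus>i\<in>I. (c i e \<otimes> \<beta> e) \<otimes> y i)" .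
  qed (use \<beta> c y in \<open>auto intro!: finsum_closed\<close>)
  also have "\<dots> = (\<Oplus>i\<in>I. \<Oplus>e\<in>E. (c i e \<otimes> \<beta> e) \<otimes> y i)"
    using fin \<beta> c y by (intro finsum_swap) auto
  also have "\<dots> = (\<Oplus>i\<in>I. \<alpha> i \<otimes> (u i \<otimes> y i))"
  proof (rule finsum_cong')
    fix i assume i: "i \<in> I"
    have "(\<Oplus>e\<in>E. (c i e \<otimes> \<beta> e) \<otimes> y i) = (\<Oplus>e\<in>E. c i e \<otimes> \<beta> e) \<otimes> y i"
      using \<beta> c y i fin by (intro finsum_ldistr[symmetric]) auto
    also have "\<dots> = \<alpha> i \<otimes> (u i \<otimes> y i)"
      using \<alpha>[OF i] u[OF i] y[OF i] by (simp add: m_assoc flip: eq[OF i])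
    finally show "(\<Oplus>e\<in>E. (c i e \<otimes> \<beta> e) \<otimes> y i) = \<alpha> i \<otimes> (u i \<otimes> y i)" .
  qed (use \<alpha> u y in auto)
  finally have Z: "(\<Oplus>e\<in>E. \<beta> e \<otimes> (\<Oplus>i\<in>I. c i e \<otimes> y i)) = (\<Oplus>i\<in>I. \<alpha> i \<otimes> (u i \<otimes> y i))" .
  have "(\<Oplus>i\<in>I. \<ominus> \<alpha> i \<otimes> (u i \<otimes> y i \<oplus> \<ominus> a i)) \<oplus> (\<Oplus>i\<in>I. \<alpha> i \<otimes> (u i \<otimes> y i))
    = (\<Oplus>i\<in>I. \<ominus> \<alpha> i \<otimes> (u i \<otimes> y i \<oplus> \<ominus> a i) \<oplus> \<alpha> i \<otimes> (u i \<otimes> y i))"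
    using \<alpha> u a y by (intro finsum_addf[symmetric]) auto
  also have "\<dots> = (\<Oplus>i\<in>I. \<alpha> i \<otimes> a i)"
  proof (rule finsum_cong')
    fix i assume i: "i \<in> I"
    have "\<alpha> i \<in> carrier R" "u i \<in> carrier R" "y i \<in> carrier R" "a i \<in> carrier R"
      using i \<alpha> u a y by auto
    then show "\<ominus> \<alpha> i \<otimes> (u i \<otimes> y i \<oplus> \<ominus> a i) \<oplus> \<alpha> i \<otimes> (u i \<otimes> y i) = \<alpha> i \<otimes> a i" by algebra
  qed (use \<alpha> a in auto)
  finally show ?thesis by (simp only: Z)
qed

text \<open>Modulo an ideal containing \<open>f - b\<^sub>f\<close> for all generators \<open>f\<close>, every element of the algebra is
  congruent to a constant.\<close>

lemma (in cring) contract_strict: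
  assumes T: "subring T (fun_ring R)" "fun_const ` carrier R \<union> G \<subseteq> T"
    and min: "\<And>S. subring S (fun_ring R) \<Longrightarrow> fun_const ` carrier R \<union> G \<subseteq> S \<Longrightarrow> T \<subseteq> S"
    and P: "ideal P (fun_ring R\<lparr>carrier := T\<rparr>)" and P': "ideal P' (fun_ring R\<lparr>carrier := T\<rparr>)"
    and sub: "P' \<subset> P"
    and G: "\<And>f. f \<in> G \<Longrightarrow> \<exists>b\<in>carrier R. (\<lambda>w. f w \<oplus> fun_const b w) \<in> P'"
  shows "{b \<in> carrier R. fun_const b \<in> P'} \<subset> {b \<in> carrier R. fun_const b \<in> P}"
proof -
  note P_D = ideal_carrier_updateD[OF P, simplified]
  note P'_D = ideal_carrier_updateD[OF P', simplified]
  note Tcl = fun_ring_subring_closed[OF T(1)]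
  have constT: "fun_const b \<in> T" if "b \<in> carrier R" for b using T(2) that by blast
  define S where "S = {f \<in> T. \<exists>b\<in>carrier R. (\<lambda>w. f w \<oplus> fun_const b w) \<in> P'}"
  have "subring S (fun_ring R)"
  proof (rule subring_fun_ringI)
    show "f w \<in> carrier R" if "f \<in> S" for f w using that Tcl(1) by (simp add: S_def)
    have "(\<lambda>w. fun_const b w \<oplus> fun_const (\<ominus> b) w) \<in> P'" if "b \<in> carrier R" for b
      using P'_D(2) that by (simp add: r_neg)
    then show "fun_const b \<in> S" if "b \<in> carrier R" for b
      using that constT unfolding S_def by blast
  next
    fix f g assume fg: "f \<in> S" "g \<in> S"
    obtain b where b: "b \<in> carrier R" "(\<lambda>w. f w \<oplus> fun_const b w) \<in> P'" and f: "f \<in> T"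
      using fg(1) unfolding S_def by blast
    obtain d where d: "d \<in> carrier R" "(\<lambda>w. g w \<oplus> fun_const d w) \<in> P'" and g: "g \<in> T"
      using fg(2) unfolding S_def by blast
    have c: "f w \<in> carrier R" "g w \<in> carrier R" for w using f g Tcl(1) by auto
    have "(\<lambda>w. (f w \<oplus> fun_const b w) \<oplus> (g w \<oplus> fun_const d w)) \<in> P'"
      by (rule P'_D(3)[OF b(2) d(2)])
    also have "(\<lambda>w. (f w \<oplus> fun_const b w) \<oplus> (g w \<oplus> fun_const d w)) =
        (\<lambda>w. (f w \<oplus> g w) \<oplus> fun_const (b \<oplus> d) w)"
      using c b d by (simp add: a_ac)
    finally show "(\<lambda>w. f w \<oplus> g w) \<in> S"
      using Tcl(4)[OF f g] b(1) d(1) unfolding S_def by blast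
    \<comment> \<open>Modulo \<open>P'\<close> the functions \<open>f\<close> and \<open>g\<close>
      are \<open>\<ominus> b\<close> and \<open>\<ominus> d\<close>, so the product is
      \<open>b \<otimes> d\<close>; in this combination of the two memberships the mixed terms
      \<open>b \<otimes> g w\<close> cancel.\<close>
    have "(\<lambda>w. g w \<otimes> (f w \<oplus> fun_const b w)) \<in> P'" "(\<lambda>w. fun_const (\<ominus> b) w \<otimes> (g w \<oplus> fun_const d w)) \<in> P'"
      using P'_D(4)[OF b(2) g] P'_D(4)[OF d(2) constT, of "\<ominus> b"] b(1) by auto
    then have "(\<lambda>w. g w \<otimes> (f w \<oplus> fun_const b w) \<oplus> fun_const (\<ominus> b) w \<otimes> (g w \<oplus> fun_const d w)) \<in> P'"
      by (rule P'_D(3))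
    also have "(\<lambda>w. g w \<otimes> (f w \<oplus> fun_const b w) \<oplus> fun_const (\<ominus> b) w \<otimes> (g w \<oplus> fun_const d w)) =
        (\<lambda>w. f w \<otimes> g w \<oplus> fun_const (\<ominus> b \<otimes> d) w)"
    proof
      fix w
      have "f w \<in> carrier R" "g w \<in> carrier R" by (fact c)+
      then show "g w \<otimes> (f w \<oplus> fun_const b w) \<oplus> fun_const (\<ominus> b) w \<otimes> (g w \<oplus> fun_const d w) =
          f w \<otimes> g w \<oplus> fun_const (\<ominus> b \<otimes> d) w"
        unfolding fun_const_apply using b(1) d(1) by algebra
    qed
    finally show "(\<lambda>w. f w \<otimes> g w) \<in> S"
      using Tcl(5)[OF f g] b(1) d(1) unfolding S_def by blast
  qed
  moreover have "fun_const b \<in> S" if "b \<in> carrier R" for b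
  proof -
    have "(\<lambda>w. fun_const b w \<oplus> fun_const (\<ominus> b) w) \<in> P'"
      using P'_D(2) that by (simp add: r_neg)
    then show ?thesis using that constT unfolding S_def by blast
  qed
  moreover have "G \<subseteq> S" using G T(2) unfolding S_def by blast
  ultimately have "T \<subseteq> S" by (intro min) auto
  \<comment> \<open>A witness of strictness in \<open>T\<close> is traded for a constant:
    \<open>f\<close> agrees with \<open>\<ominus> b\<close> modulo \<open>P'\<close>, so
    \<open>b\<close> lies in \<open>P\<close> but not in \<open>P'\<close>.\<close>
  obtain f where f: "f \<in> P" "f \<notin> P'" using sub by blast
  then have "f \<in> S" using \<open>T \<subseteq> S\<close> P_D(1) by blast
  then obtain b where b: "b \<in> carrier R" "(\<lambda>w. f w \<oplus> fun_const b w) \<in> P'"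
    unfolding S_def by blast
  have fc: "f w \<in> carrier R" for w using f(1) P_D(1) Tcl(1) by blast
  have mone: "fun_const (\<ominus> \<one>) \<in> T" using constT by simp
  have "(\<lambda>w. f w \<oplus> fun_const b w) \<in> P" using b(2) sub by blast
  then have "(\<lambda>w. (f w \<oplus> fun_const b w) \<oplus> fun_const (\<ominus> \<one>) w \<otimes> f w) \<in> P"
    by (rule P_D(3)[OF _ P_D(4)[OF f(1) mone]])
  also have "(\<lambda>w. (f w \<oplus> fun_const b w) \<oplus> fun_const (\<ominus> \<one>) w \<otimes> f w) = fun_const b"
  proof
    fix w
    have "f w \<in> carrier R" by (fact fc)
    then show "(f w \<oplus> fun_const b w) \<oplus> fun_const (\<ominus> \<one>) w \<otimes> f w = fun_const b w"
      unfolding fun_const_apply using b(1) by algebra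
  qed
  finally have bP: "fun_const b \<in> P" .
  have "fun_const b \<notin> P'"
  proof
    assume "fun_const b \<in> P'"
    then have "(\<lambda>w. (f w \<oplus> fun_const b w) \<oplus> fun_const (\<ominus> \<one>) w \<otimes> fun_const b w) \<in> P'"
      by (rule P'_D(3)[OF b(2) P'_D(4)[OF _ mone]])
    also have "(\<lambda>w. (f w \<oplus> fun_const b w) \<oplus> fun_const (\<ominus> \<one>) w \<otimes> fun_const b w) = f"
    proof
      fix w
      have "f w \<in> carrier R" by (fact fc)
      then show "(f w \<oplus> fun_const b w) \<oplus> fun_const (\<ominus> \<one>) w \<otimes> fun_const b w = f w"
        unfolding fun_const_apply using b(1) by algebra
    qed
    finally show False using f(2) by simp
  qed
  then show ?thesis using bP b(1) sub by blast
qed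

text \<open>For \<open>x = \<Sum> a\<^sub>i n\<^sub>i\<close> and \<open>u\<^sub>i n\<^sub>i = \<Sum> c\<^sub>i\<^sub>e e\<close> this set contains \<open>N\<^sup>*(x)\<close>: take \<open>\<alpha> i = \<phi>(n\<^sub>i)\<close> and
  \<open>\<beta> e = \<phi>(e)\<close>. It is defined without reference to the module.\<close>

definition relation_values ::
  "('a, 'r) ring_scheme \<Rightarrow> nat \<Rightarrow> 'e set \<Rightarrow> (nat \<Rightarrow> 'a) \<Rightarrow> (nat \<Rightarrow> 'e \<Rightarrow> 'a) \<Rightarrow> (nat \<Rightarrow> 'a) \<Rightarrow> 'a set" where
  "relation_values R s E u c a = {\<Oplus>\<^bsub>R\<^esub>i\<in>{..<s}. \<alpha> i \<otimes>\<^bsub>R\<^esub> a i | \<alpha>. (\<forall>i<s. \<alpha> i \<in> carrier R) \<and>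
     (\<exists>\<beta>. (\<forall>e\<in>E. \<beta> e \<in> carrier R) \<and> (\<forall>i<s. \<alpha> i \<otimes>\<^bsub>R\<^esub> u i = (\<Oplus>\<^bsub>R\<^esub>e\<in>E. c i e \<otimes>\<^bsub>R\<^esub> \<beta> e)))}"

text \<open>Together with \<open>lin_right\<close>, these are the generators
  \<open>Y\<^sub>i\<close> and \<open>Z\<^sub>e\<close>; \<open>coord\<close> stands for the
  variable, so that the values are in the ring at every point.\<close>

definition lin_left :: "('a, 'r) ring_scheme \<Rightarrow> (nat \<Rightarrow> 'a) \<Rightarrow> nat \<Rightarrow> (nat \<Rightarrow> 'a) \<Rightarrow> 'a" where
  "lin_left R u i w = u i \<otimes>\<^bsub>R\<^esub> coord R i w"

definition lin_right ::
  "('a, 'r) ring_scheme \<Rightarrow> nat \<Rightarrow> (nat \<Rightarrow> 'e \<Rightarrow> 'a) \<Rightarrow> 'e \<Rightarrow> (nat \<Rightarrow> 'a) \<Rightarrow> 'a" where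
  "lin_right R s c e w = (\<Oplus>\<^bsub>R\<^esub>i\<in>{..<s}. c i e \<otimes>\<^bsub>R\<^esub> coord R i w)"

definition specialized ::
  "('a, 'r) ring_scheme \<Rightarrow> nat \<Rightarrow> 'e set \<Rightarrow> (nat \<Rightarrow> 'a) \<Rightarrow> (nat \<Rightarrow> 'e \<Rightarrow> 'a) \<Rightarrow> (nat \<Rightarrow> 'a) \<Rightarrow>
    ((nat \<Rightarrow> 'a) \<Rightarrow> 'a) set" where
  "specialized R s E u c a = (\<lambda>i w. lin_left R u i w \<oplus>\<^bsub>R\<^esub> fun_const (\<ominus>\<^bsub>R\<^esub> a i) w) ` {..<s} \<union> lin_right R s c ` E"

lemma (in ideal) finsum_mem:
  "finite A \<Longrightarrow> (\<And>i. i \<in> A \<Longrightarrow> f i \<in> I) \<Longrightarrow> (\<Oplus>i\<in>A. f i) \<in> I"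
proof (induction A rule: finite_induct)
  case (insert j A)
  then have "f i \<in> carrier R" if "i \<in> insert j A" for i using that Icarr by blast
  then show ?case using insert by (subst finsum_insert) auto
qed simp

context cring
begin

lemma fun_const_line_poly: "b \<in> carrier R \<Longrightarrow> fun_const b \<in> line_poly R"
  using poly_fun_const unfolding line_poly_def by auto

lemma subring_fun_finsum:
  assumes S: "subring S (fun_ring R)" and "finite A" "\<And>i. i \<in> A \<Longrightarrow> f i \<in> S"
  shows "(\<lambda>w. \<Oplus>i\<in>A. f i w) \<in> S"
proof (rule fun_finsum_closed)
  show "(\<lambda>w. f w \<oplus> g w) \<in> S" if "f \<in> S" "g \<in> S" for f g
    using that by (rule fun_ring_subring_closed(4)[OF S])
qed (use assms fun_ring_subring_closed(1,2)[OF S] in auto)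

lemma ideal_fun_finsum:
  assumes T: "subring T (fun_ring R)" and P: "ideal P (fun_ring R\<lparr>carrier := T\<rparr>)"
    and "finite A" "\<And>i. i \<in> A \<Longrightarrow> f i \<in> P"
  shows "(\<lambda>w. \<Oplus>i\<in>A. f i w) \<in> P"
proof (rule fun_finsum_closed)
  note P_D = ideal_carrier_updateD[OF P, simplified]
  show "(\<lambda>w. \<zero>) \<in> P" by (rule P_D(2))
  show "f w \<in> carrier R" if "f \<in> P" for f w
    using that fun_ring_subring_closed(1)[OF T] P_D(1) by blast
  show "(\<lambda>w. f w \<oplus> g w) \<in> P" if "f \<in> P" "g \<in> P" for f g
    using that by (rule P_D(3))
qed (use assms in auto)

context
  fixes s :: nat and E :: "'e set" and u a :: "nat \<Rightarrow> 'a" and c :: "nat \<Rightarrow> 'e \<Rightarrow> 'a"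
  assumes E: "finite E" and uc: "\<And>i. i < s \<Longrightarrow> u i \<in> carrier R"
    and ac: "\<And>i. i < s \<Longrightarrow> a i \<in> carrier R"
    and c: "\<And>i e. i < s \<Longrightarrow> e \<in> E \<Longrightarrow> c i e \<in> carrier R"
begin

lemma lin_left_line_poly: "i < s \<Longrightarrow> lin_left R u i \<in> line_poly R"
  using fun_ring_subring_closed(5)[OF subring_line_poly fun_const_line_poly[OF uc] coord_line_poly]
  unfolding lin_left_def[abs_def] by simp

lemma lin_right_line_poly:
  assumes "e \<in> E"
  shows "lin_right R s c e \<in> line_poly R"
proof -
  have "(\<lambda>w. \<Oplus>i\<in>{..<s}. c i e \<otimes> coord R i w) \<in> line_poly R"
  proof (rule subring_fun_finsum[OF subring_line_poly])
    show "(\<lambda>w. c i e \<otimes> coord R i w) \<in> line_poly R" if "i \<in> {..<s}" for i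
      using fun_ring_subring_closed(5)[OF subring_line_poly fun_const_line_poly[OF c] coord_line_poly, of i e]
        that assms by simp
  qed simp
  then show ?thesis by (simp only: lin_right_def[abs_def])
qed

lemma card_specialized: "finite (specialized R s E u c a)" "card (specialized R s E u c a) \<le> s + card E"
proof -
  show "finite (specialized R s E u c a)" unfolding specialized_def using E by simp
  show "card (specialized R s E u c a) \<le> s + card E"
    unfolding specialized_def
    by (rule order.trans[OF card_Un_le add_mono])
      (use card_image_le[of "{..<s}"] card_image_le[OF E] in auto)
qed

text \<open>The linear forms vanish at the origin, so only the values \<open>\<ominus> a i\<close>
  and \<open>\<zero>\<close> remain.\<close>

lemma specialized_origin:
  assumes "f \<in> (specialized R s E u c a)" "primeideal m R" "\<And>i. i < s \<Longrightarrow> a i \<in> m"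
  shows "f (\<lambda>i. \<zero>) \<in> m"
proof -
  interpret m: primeideal m R by fact
  have "lin_left R u i (\<lambda>i. \<zero>) \<oplus> fun_const (\<ominus> a i) (\<lambda>i. \<zero>) = \<ominus> a i" if "i < s" for i
    using uc[OF that] ac[OF that] by (simp add: lin_left_def coord_def)
  moreover have "lin_right R s c e (\<lambda>i. \<zero>) = \<zero>" if "e \<in> E" for e
  proof -
    have "lin_right R s c e (\<lambda>i. \<zero>) = (\<Oplus>i\<in>{..<s}. \<zero>)"
      unfolding lin_right_def using c that by (intro finsum_cong') (auto simp: coord_def)
    then show ?thesis by simp
  qed
  ultimately show ?thesis using assms(1,3) unfolding specialized_def by auto
qed

lemma specialized_closed:
  assumes T: "subring T (fun_ring R)"
    "fun_const ` carrier R \<union> (lin_left R u ` {..<s} \<union> lin_right R s c ` E) \<subseteq> T"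
  shows "specialized R s E u c a \<subseteq> T"
proof -
  have "(\<lambda>w. lin_left R u i w \<oplus> fun_const (\<ominus> a i) w) \<in> T" if "i < s" for i
  proof (rule fun_ring_subring_closed(4)[OF T(1)])
    show "lin_left R u i \<in> T" using T(2) that by blast
    show "fun_const (\<ominus> a i) \<in> T" using T(2) a_inv_closed[OF ac[OF that]] by blast
  qed
  then show ?thesis unfolding specialized_def using T(2) by blast
qed

lemma relation_values_contract:
  assumes T: "subring T (fun_ring R)" "fun_const ` carrier R \<subseteq> T"
    and P: "ideal P (fun_ring R\<lparr>carrier := T\<rparr>)" "specialized R s E u c a \<subseteq> P"
  shows "relation_values R s E u c a \<subseteq> {b \<in> carrier R. fun_const b \<in> P}"
proof
  note P_D = ideal_carrier_updateD[OF P(1), simplified]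
  fix x assume "x \<in> relation_values R s E u c a"
  then obtain \<alpha> \<beta> where x: "x = (\<Oplus>i\<in>{..<s}. \<alpha> i \<otimes> a i)" and \<alpha>: "\<forall>i<s. \<alpha> i \<in> carrier R"
    and \<beta>: "\<forall>e\<in>E. \<beta> e \<in> carrier R" and eq: "\<forall>i<s. \<alpha> i \<otimes> u i = (\<Oplus>e\<in>E. c i e \<otimes> \<beta> e)"
    unfolding relation_values_def by blast
  have 1: "(\<lambda>w. \<Oplus>i\<in>{..<s}. fun_const (\<ominus> \<alpha> i) w \<otimes> (lin_left R u i w \<oplus> fun_const (\<ominus> a i) w)) \<in> P"
  proof (rule ideal_fun_finsum[OF T(1) P(1)])
    fix i assume i: "i \<in> {..<s}"
    then have "(\<lambda>w. lin_left R u i w \<oplus> fun_const (\<ominus> a i) w) \<in> P"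
      using P(2) unfolding specialized_def by blast
    moreover have "\<ominus> \<alpha> i \<in> carrier R" using \<alpha> i by simp
    then have "fun_const (\<ominus> \<alpha> i) \<in> T" using T(2) by blast
    ultimately show "(\<lambda>w. fun_const (\<ominus> \<alpha> i) w \<otimes> (lin_left R u i w \<oplus> fun_const (\<ominus> a i) w)) \<in> P"
      by (rule P_D(4))
  qed simp
  have 2: "(\<lambda>w. \<Oplus>e\<in>E. fun_const (\<beta> e) w \<otimes> lin_right R s c e w) \<in> P"
  proof (rule ideal_fun_finsum[OF T(1) P(1) E])
    fix e assume e: "e \<in> E"
    then have "lin_right R s c e \<in> P" using P(2) unfolding specialized_def by blast
    moreover have "fun_const (\<beta> e) \<in> T" using T(2) \<beta> e by blast
    ultimately show "(\<lambda>w. fun_const (\<beta> e) w \<otimes> lin_right R s c e w) \<in> P" by (rule P_D(4))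
  qed
  \<comment> \<open>The identity is applied at each point \<open>w\<close> with the coordinates of
    \<open>w\<close> for \<open>y\<close>. Its right-hand side does not depend on \<open>w\<close>,
    so this combination of the equations is a constant function.\<close>
  have "(\<Oplus>i\<in>{..<s}. fun_const (\<ominus> \<alpha> i) w \<otimes> (lin_left R u i w \<oplus> fun_const (\<ominus> a i) w)) \<oplus>
      (\<Oplus>e\<in>E. fun_const (\<beta> e) w \<otimes> lin_right R s c e w) = x" for w
    unfolding x fun_const_apply lin_left_def lin_right_def
    by (rule linear_relations_identity) (use E uc ac c \<alpha> \<beta> eq in \<open>simp_all add: coord_def\<close>)
  then have "fun_const x \<in> P" using P_D(3)[OF 1 2] by (simp add: fun_const_def)
  moreover have "x \<in> carrier R" unfolding x using \<alpha> ac by (intro finsum_closed) auto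
  ultimately show "x \<in> {b \<in> carrier R. fun_const b \<in> P}" by simp
qed

lemma relation_values_subset_prime:
  assumes "primeideal m R" "\<And>i. i < s \<Longrightarrow> a i \<in> m"
  shows "relation_values R s E u c a \<subseteq> m"
proof -
  interpret m: primeideal m R by fact
  show ?thesis
    using assms(2) unfolding relation_values_def by (auto intro!: m.finsum_mem m.I_l_closed)
qed

end

end

text \<open>The length count: \<open>s + d\<close> steps in \<open>T\<close>, at most
  \<open>s + card E\<close> equations, and a contraction to \<open>R\<close> that keeps all
  inclusions strict. The coefficients are arbitrary ring elements here, so no module is
  involved.\<close>

theorem (in noetherian_cring) pchain_relation_values:
  fixes c :: "nat \<Rightarrow> 'e \<Rightarrow> 'a"
  assumes m: "primeideal m R" and local: "\<And>P. primeideal P R \<Longrightarrow> P \<subseteq> m"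
    and Q: "primeideal Q R" and E: "finite E"
    and u: "\<And>i. i < s \<Longrightarrow> u i \<in> carrier R - Q"
    and c: "\<And>i e. i < s \<Longrightarrow> e \<in> E \<Longrightarrow> c i e \<in> carrier R"
    and a: "\<And>i. i < s \<Longrightarrow> a i \<in> m"
    and ch: "pchain R Q d P"
  shows "pchain R (relation_values R s E u c a) (d - card E) m"
proof (cases d)
  interpret m: primeideal m R by fact
  have uc: "u i \<in> carrier R" if "i < s" for i using u[OF that] by blast
  have ac: "a i \<in> carrier R" if "i < s" for i using a[OF that] m.Icarr by blast
  note ctx = E uc ac c
  {
    \<comment> \<open>Here \<open>R/Q\<close> may be finite, so functions need not behave like
      polynomials; but the claim shrinks to the inclusion of the values in \<open>m\<close>.\<close>
    case 0
    then show ?thesis using m relation_values_subset_prime[where s = s and E = E and u = u and a = a and c = c, OF ctx m a] by simp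
  next
    case (Suc d')
    then obtain P0 P' where P: "P0 \<subset> P'" "primeideal P' R" "pchain R Q d' P0"
      using ch unfolding Suc pchain.simps by blast
    \<comment> \<open>One strict inclusion above \<open>Q\<close> is enough for infinitely many
      residues: \<open>\<tau>\<close> lies in \<open>m\<close> but not in \<open>Q\<close>, so its
      powers are distinct modulo \<open>Q\<close>.\<close>
    obtain \<tau> where \<tau>: "\<tau> \<in> P'" "\<tau> \<notin> P0" using P(1) by blast
    have \<tau>m: "\<tau> \<in> m" "\<tau> \<notin> Q" using \<tau> local[OF P(2)] pchain_above[OF P(3)] by blast+
    define e where "e = (\<lambda>i::nat. \<tau> [^] i)"
    have ec: "e i \<in> carrier R" for i unfolding e_def using m.Icarr[OF \<tau>m(1)] by simp
    have ene: "e i \<ominus> e j \<notin> Q" if "i \<noteq> j" for i j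
      unfolding e_def by (rule power_diff_notin_prime[OF m Q local[OF Q] \<tau>m that])
    define Y where "Y = lin_left R u"
    define Z where "Z = lin_right R s c"
    let ?G = "specialized R s E u c a"
    let ?B = "fun_ring R :: ((nat \<Rightarrow> 'a) \<Rightarrow> 'a) ring"
    interpret B: cring ?B by (rule cring_fun_ring)
    have YL: "Y i \<in> line_poly R" if "i < s" for i
      unfolding Y_def by (rule lin_left_line_poly[where s = s and E = E and u = u and a = a and c = c, OF ctx that])
    have ZL: "Z e \<in> line_poly R" if "e \<in> E" for e
      unfolding Z_def by (rule lin_right_line_poly[where s = s and E = E and u = u and a = a and c = c, OF ctx that])
    have YZL: "Y ` {..<s} \<union> Z ` E \<subseteq> line_poly R" using YL ZL by blast
    have fin: "finite (Y ` {..<s} \<union> Z ` E)" using E by simp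
    have car: "Y ` {..<s} \<union> Z ` E \<subseteq> carrier ?B"
      using YZL subringE(1)[OF subring_line_poly] by blast
    obtain T where T: "subring T ?B" "noetherian_ring (?B\<lparr>carrier := T\<rparr>)"
      and gen: "fun_const ` carrier R \<union> (Y ` {..<s} \<union> Z ` E) \<subseteq> T"
      and Tmin: "\<forall>S. subring S ?B \<longrightarrow> fun_const ` carrier R \<union> (Y ` {..<s} \<union> Z ` E) \<subseteq> S \<longrightarrow> T \<subseteq> S"
      using B.exists_noetherian_subring[OF fin car subring_fun_const noetherian_fun_const] by (elim exE conjE)
    have constT: "fun_const ` carrier R \<subseteq> T" using gen by blast
    have "fun_const ` carrier R \<subseteq> line_poly R"
      using fun_const_line_poly by blast
    \<comment> \<open>\<open>line_poly R\<close> is a subring containing the constants and the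
      forms, hence it contains the least such subring; no element of \<open>T\<close> has to be
      written out.\<close>
    then have TL: "T \<subseteq> line_poly R" using Tmin subring_line_poly YZL by blast
    let ?T = "?B\<lparr>carrier := T\<rparr>" and ?M = "{f \<in> T. f (\<lambda>i. \<zero>) \<in> m}"
    have "noetherian_cring ?T"
      by (intro noetherian_cring.intro T(2) cring_fun_subring[OF T(1)])
    have "pchain ?T {} (s + d) {f \<in> T. f (\<lambda>i. \<zero>) \<in> P}"
    proof (rule pchain_lin_forms[where e = e and u = u, OF T(1) TL _ Q u _ ec ene ch])
      show "range fun_const \<inter> {f. \<forall>w. f w \<in> carrier R} \<subseteq> T" using constT by auto
      show "(\<lambda>w. u i \<otimes> coord R i w) \<in> T" if "i < s" for i
      proof -
        have "Y i \<in> T" using gen that by blast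
        then show ?thesis
          unfolding Y_def lin_left_def[abs_def] .
      qed
    qed
    \<comment> \<open>The equations are known to lie in \<open>?M\<close> but not in the ideal
      belonging to \<open>P\<close>, so the top is enlarged before they are imposed.\<close>
    moreover have "{f \<in> T. f (\<lambda>i. \<zero>) \<in> P} \<subseteq> ?M" using local[OF pchain_prime[OF ch]] by blast
    ultimately have chM: "pchain ?T {} (s + d) ?M"
      using pchain_enlarge[OF _ origin_prime[OF T(1) m]] by (metis (no_types, lifting))
    have GT: "?G \<subseteq> T"
      using specialized_closed[where s = s and E = E and u = u and a = a and c = c, OF ctx T(1)] gen unfolding Y_def Z_def by blast
    then have GM: "?G \<subseteq> ?M"
      using specialized_origin[where s = s and E = E and u = u and a = a and c = c, OF ctx _ m a] by blast
    have "pchain ?T (?G \<union> {}) (s + d - card ?G) ?M"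
      by (rule noetherian_cring.pchain_union[OF \<open>noetherian_cring ?T\<close>
          card_specialized(1)[where s = s and E = E and u = u and a = a and c = c, OF ctx] chM GM])
    \<comment> \<open>Equations may coincide, so \<open>card ?G\<close> is only bounded; the chain
      is cut back to a length that depends on \<open>card E\<close> alone.\<close>
    moreover have "d - card E \<le> s + d - card ?G"
      using card_specialized(2)[where s = s and E = E and u = u and a = a and c = c, OF ctx] by (simp add: diff_le_mono2)
    ultimately have ch': "pchain ?T ?G (d - card E) ?M"
      using pchain_le[of ?T "?G \<union> {}" "s + d - card ?G" ?M "d - card E"] by simp
    let ?f = "\<lambda>P. {b \<in> carrier R. fun_const b \<in> P}"
    have "pchain R (relation_values R s E u c a) (d - card E) (?f ?M)"
    proof (rule pchain_map[OF ch'])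
      fix P assume P: "primeideal P ?T" "?G \<subseteq> P"
      show "primeideal (?f P) R \<and> relation_values R s E u c a \<subseteq> ?f P"
        using contract_prime[OF T(1) constT P(1)]
          relation_values_contract[where s = s and E = E and u = u and a = a and c = c, OF ctx T(1) constT primeideal.axioms(1)[OF P(1)] P(2)]
        by blast
    next
      fix P P' assume P: "primeideal P ?T" and P': "primeideal P' ?T" "?G \<subseteq> P'" "P' \<subset> P"
      note P'_D = ideal_carrier_updateD[OF primeideal.axioms(1)[OF P'(1)], simplified]
      show "?f P' \<subset> ?f P"
      proof (rule contract_strict[OF T(1) gen _ primeideal.axioms(1)[OF P] primeideal.axioms(1)[OF P'(1)] P'(3)])
        show "T \<subseteq> S" if "subring S ?B" "fun_const ` carrier R \<union> (Y ` {..<s} \<union> Z ` E) \<subseteq> S" for S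
          using Tmin that by blast
        fix f assume "f \<in> Y ` {..<s} \<union> Z ` E"
        then consider i where "i < s" "f = Y i" | e where "e \<in> E" "f = Z e" by blast
        then show "\<exists>b\<in>carrier R. (\<lambda>w. f w \<oplus> fun_const b w) \<in> P'"
        proof cases
          case 1
          have "(\<lambda>w. Y i w \<oplus> fun_const (\<ominus> a i) w) \<in> ?G"
            unfolding specialized_def Y_def using 1(1) by blast
          then show ?thesis using P'(2) 1 ac[OF 1(1)] by (intro bexI[of _ "\<ominus> a i"]) auto
        next
          case 2
          have "Z e \<in> ?G"
            unfolding specialized_def Z_def using 2(1) by blast
          then have "Z e \<in> P'" using P'(2) by blast
          moreover have "(\<lambda>w. Z e w \<oplus> fun_const \<zero> w) = Z e"
            using fun_ring_subring_closed(1)[OF subring_line_poly ZL[OF 2(1)]] by auto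
          ultimately show ?thesis using 2 by (intro bexI[of _ \<zero>]) simp_all
        qed
      qed
    qed
    moreover have "?f ?M = m" using constT m.Icarr by auto
    ultimately show ?thesis by simp
  }
qed

section \<open>Modules and order ideals\<close>

context module
begin

lemma submodule_of_closed:
  assumes "H \<subseteq> carrier M" "\<zero>\<^bsub>M\<^esub> \<in> H"
    and "\<And>x y. x \<in> H \<Longrightarrow> y \<in> H \<Longrightarrow> x \<oplus>\<^bsub>M\<^esub> y \<in> H"
    and "\<And>a x. a \<in> carrier R \<Longrightarrow> x \<in> H \<Longrightarrow> a \<odot>\<^bsub>M\<^esub> x \<in> H"
  shows "submodule H R M"
proof (rule submoduleI)
  fix x assume x: "x \<in> H"
  then have "\<ominus>\<^bsub>M\<^esub> x = \<ominus> \<one> \<odot>\<^bsub>M\<^esub> x" using assms(1) by (simp add: smult_l_minus subsetD)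
  then show "\<ominus>\<^bsub>M\<^esub> x \<in> H" using assms(4)[OF _ x, of "\<ominus> \<one>"] by simp
qed (use assms in auto)

lemma module_span_least: "submodule H R M \<Longrightarrow> A \<subseteq> H \<Longrightarrow> module_span R M A \<subseteq> H"
  unfolding module_span_def by blast

text \<open>Indexing the summands by \<open>{..<s}\<close> rather than by module elements allows
  repetitions and fixes the number \<open>s\<close> of variables used later.\<close>

lemma ideal_smult_sum:
  assumes m: "ideal m R" and x: "x \<in> ideal_smult R m M"
  shows "\<exists>s a n. (\<forall>i<s::nat. a i \<in> m \<and> n i \<in> carrier M) \<and> x = (\<Oplus>\<^bsub>M\<^esub>i\<in>{..<s}. a i \<odot>\<^bsub>M\<^esub> n i)"
proof -
  interpret m: ideal m R by fact
  define G where "G = {x. \<exists>s a n. (\<forall>i<s::nat. a i \<in> m \<and> n i \<in> carrier M) \<and>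
    x = (\<Oplus>\<^bsub>M\<^esub>i\<in>{..<s}. a i \<odot>\<^bsub>M\<^esub> n i)}"
  have GI: "(\<Oplus>\<^bsub>M\<^esub>i\<in>{..<s}. a i \<odot>\<^bsub>M\<^esub> n i) \<in> G"
    if "\<And>i. i < s \<Longrightarrow> a i \<in> m" "\<And>i. i < s \<Longrightarrow> n i \<in> carrier M" for s :: nat and a n
    unfolding G_def using that by blast
  have snoc: "x \<oplus>\<^bsub>M\<^esub> b \<odot>\<^bsub>M\<^esub> y \<in> G" if x: "x \<in> G" and b: "b \<in> m" and y: "y \<in> carrier M" for x b y
  proof -
    obtain s :: nat and a n where s: "\<forall>i<s. a i \<in> m \<and> n i \<in> carrier M"
      "x = (\<Oplus>\<^bsub>M\<^esub>i\<in>{..<s}. a i \<odot>\<^bsub>M\<^esub> n i)" using x unfolding G_def by blast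
    have summand: "a i \<odot>\<^bsub>M\<^esub> n i \<in> carrier M" if "i < s" for i using s(1) that m.Icarr by simp
    let ?a = "a(s := b)" and ?n = "n(s := y)"
    have eq: "(\<Oplus>\<^bsub>M\<^esub>i\<in>{..<s}. ?a i \<odot>\<^bsub>M\<^esub> ?n i) = x"
      unfolding s(2) using summand by (intro M.finsum_cong') auto
    have "(\<Oplus>\<^bsub>M\<^esub>i\<in>{..<Suc s}. ?a i \<odot>\<^bsub>M\<^esub> ?n i) = b \<odot>\<^bsub>M\<^esub> y \<oplus>\<^bsub>M\<^esub> (\<Oplus>\<^bsub>M\<^esub>i\<in>{..<s}. ?a i \<odot>\<^bsub>M\<^esub> ?n i)"
      unfolding lessThan_Suc using b y summand m.Icarr by (subst M.finsum_insert) auto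
    also have "\<dots> = x \<oplus>\<^bsub>M\<^esub> b \<odot>\<^bsub>M\<^esub> y"
      unfolding eq using b y m.Icarr summand s(2) by (intro M.a_comm) (auto intro!: M.finsum_closed)
    finally have sum: "(\<Oplus>\<^bsub>M\<^esub>i\<in>{..<Suc s}. ?a i \<odot>\<^bsub>M\<^esub> ?n i) = x \<oplus>\<^bsub>M\<^esub> b \<odot>\<^bsub>M\<^esub> y" .
    have "?a i \<in> m \<and> ?n i \<in> carrier M" if "i < Suc s" for i
      using that s(1) b y by (auto simp: less_Suc_eq)
    then show ?thesis unfolding sum[symmetric] by (intro GI) simp_all
  qed
  have Gc: "x \<in> carrier M" if "x \<in> G" for x
    using that m.Icarr unfolding G_def by (auto intro!: M.finsum_closed)
  have zero: "\<zero>\<^bsub>M\<^esub> \<in> G" using GI[of 0] by simp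
  have "submodule G R M"
  proof (rule submodule_of_closed)
    fix x y assume x: "x \<in> G" and "y \<in> G"
    then obtain s :: nat and a n where s: "\<forall>i<s. a i \<in> m \<and> n i \<in> carrier M"
      "y = (\<Oplus>\<^bsub>M\<^esub>i\<in>{..<s}. a i \<odot>\<^bsub>M\<^esub> n i)" unfolding G_def by blast
    have summand: "a i \<odot>\<^bsub>M\<^esub> n i \<in> carrier M" if "i < s" for i using s(1) that m.Icarr by simp
    \<comment> \<open>The summands of the second sum are appended to \<open>x\<close> one at a time,
      which avoids shifting indices.\<close>
    have "x \<oplus>\<^bsub>M\<^esub> (\<Oplus>\<^bsub>M\<^esub>i\<in>{..<k}. a i \<odot>\<^bsub>M\<^esub> n i) \<in> G" if "k \<le> s" for k
      using that
    proof (induction k)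
      case 0
      then show ?case using x Gc by simp
    next
      case (Suc k)
      have c: "(\<Oplus>\<^bsub>M\<^esub>i\<in>{..<k}. a i \<odot>\<^bsub>M\<^esub> n i) \<in> carrier M"
        using Suc.prems summand by (intro M.finsum_closed) auto
      have k: "a k \<odot>\<^bsub>M\<^esub> n k \<in> carrier M" using summand Suc.prems by simp
      have "(\<Oplus>\<^bsub>M\<^esub>i\<in>{..<Suc k}. a i \<odot>\<^bsub>M\<^esub> n i) = a k \<odot>\<^bsub>M\<^esub> n k \<oplus>\<^bsub>M\<^esub> (\<Oplus>\<^bsub>M\<^esub>i\<in>{..<k}. a i \<odot>\<^bsub>M\<^esub> n i)"
        unfolding lessThan_Suc using Suc.prems summand by (subst M.finsum_insert) auto
      then have "x \<oplus>\<^bsub>M\<^esub> (\<Oplus>\<^bsub>M\<^esub>i\<in>{..<Suc k}. a i \<odot>\<^bsub>M\<^esub> n i)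
        = (x \<oplus>\<^bsub>M\<^esub> (\<Oplus>\<^bsub>M\<^esub>i\<in>{..<k}. a i \<odot>\<^bsub>M\<^esub> n i)) \<oplus>\<^bsub>M\<^esub> a k \<odot>\<^bsub>M\<^esub> n k"
        using c k Gc[OF x] by (simp add: M.a_ac)
      then show ?case using snoc[of _ "a k" "n k"] Suc s(1) by simp
    qed
    then show "x \<oplus>\<^bsub>M\<^esub> y \<in> G" using s(2) by blast
  next
    fix b x assume b: "b \<in> carrier R" and "x \<in> G"
    then obtain s :: nat and a n where s: "\<forall>i<s. a i \<in> m \<and> n i \<in> carrier M"
      "x = (\<Oplus>\<^bsub>M\<^esub>i\<in>{..<s}. a i \<odot>\<^bsub>M\<^esub> n i)" unfolding G_def by blast
    have "b \<odot>\<^bsub>M\<^esub> x = (\<Oplus>\<^bsub>M\<^esub>i\<in>{..<s}. b \<odot>\<^bsub>M\<^esub> (a i \<odot>\<^bsub>M\<^esub> n i))"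
      unfolding s(2) using b s(1) m.Icarr by (intro finsum_smult_ldistr) auto
    also have "\<dots> = (\<Oplus>\<^bsub>M\<^esub>i\<in>{..<s}. (b \<otimes> a i) \<odot>\<^bsub>M\<^esub> n i)"
      using b s(1) m.Icarr by (intro M.finsum_cong') (auto simp: smult_assoc1)
    also have "\<dots> \<in> G" using b s(1) by (intro GI) (auto simp: m.I_l_closed)
    finally show "b \<odot>\<^bsub>M\<^esub> x \<in> G" .
  qed (use Gc zero in auto)
  moreover have "{a \<odot>\<^bsub>M\<^esub> y | a y. a \<in> m \<and> y \<in> carrier M} \<subseteq> G"
  proof
    fix z assume "z \<in> {a \<odot>\<^bsub>M\<^esub> y | a y. a \<in> m \<and> y \<in> carrier M}"
    then obtain a y where z: "z = a \<odot>\<^bsub>M\<^esub> y" "a \<in> m" "y \<in> carrier M" by blast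
    have "\<zero>\<^bsub>M\<^esub> \<oplus>\<^bsub>M\<^esub> a \<odot>\<^bsub>M\<^esub> y \<in> G" by (rule snoc[OF zero z(2,3)])
    then show "z \<in> G" using z m.Icarr by simp
  qed
  ultimately have "x \<in> G" using x module_span_least unfolding ideal_smult_def by blast
  then show ?thesis unfolding G_def by blast
qed

lemma module_hom_self:
  assumes "\<phi> \<in> module_hom R M (self_module R)"
  shows "\<And>x. x \<in> carrier M \<Longrightarrow> \<phi> x \<in> carrier R"
    "\<And>x y. x \<in> carrier M \<Longrightarrow> y \<in> carrier M \<Longrightarrow> \<phi> (x \<oplus>\<^bsub>M\<^esub> y) = \<phi> x \<oplus> \<phi> y"
    "\<And>a x. a \<in> carrier R \<Longrightarrow> x \<in> carrier M \<Longrightarrow> \<phi> (a \<odot>\<^bsub>M\<^esub> x) = a \<otimes> \<phi> x"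
  using assms unfolding module_hom_def self_module_def by (auto simp: Pi_def)

lemma module_hom_selfI:
  assumes "\<And>x. x \<in> carrier M \<Longrightarrow> \<phi> x \<in> carrier R"
    "\<And>x y. x \<in> carrier M \<Longrightarrow> y \<in> carrier M \<Longrightarrow> \<phi> (x \<oplus>\<^bsub>M\<^esub> y) = \<phi> x \<oplus> \<phi> y"
    "\<And>a x. a \<in> carrier R \<Longrightarrow> x \<in> carrier M \<Longrightarrow> \<phi> (a \<odot>\<^bsub>M\<^esub> x) = a \<otimes> \<phi> x"
  shows "\<phi> \<in> module_hom R M (self_module R)"
  using assms unfolding module_hom_def self_module_def by (auto simp: Pi_def)

lemma module_hom_finsum:
  assumes \<phi>: "\<phi> \<in> module_hom R M (self_module R)" and "finite A" "\<And>i. i \<in> A \<Longrightarrow> f i \<in> carrier M"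
  shows "\<phi> (\<Oplus>\<^bsub>M\<^esub>i\<in>A. f i) = (\<Oplus>i\<in>A. \<phi> (f i))"
  using assms(2,3)
proof (induction A)
  case empty
  have "\<phi> (\<zero> \<odot>\<^bsub>M\<^esub> \<zero>\<^bsub>M\<^esub>) = \<zero> \<otimes> \<phi> \<zero>\<^bsub>M\<^esub>"
    by (rule module_hom_self(3)[OF \<phi>]) simp_all
  then have "\<phi> \<zero>\<^bsub>M\<^esub> = \<zero>" using module_hom_self(1)[OF \<phi>, of "\<zero>\<^bsub>M\<^esub>"] by simp
  then show ?case by simp
next
  case (insert j A)
  then have "\<phi> (\<Oplus>\<^bsub>M\<^esub>i\<in>insert j A. f i) = \<phi> (f j \<oplus>\<^bsub>M\<^esub> (\<Oplus>\<^bsub>M\<^esub>i\<in>A. f i))"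
    by (subst M.finsum_insert) auto
  also have "\<dots> = \<phi> (f j) \<oplus> (\<Oplus>i\<in>A. \<phi> (f i))"
    using insert module_hom_self(2)[OF \<phi>] by (simp add: M.finsum_closed Pi_def)
  also have "\<dots> = (\<Oplus>i\<in>insert j A. \<phi> (f i))"
    using insert module_hom_self(1)[OF \<phi>] by (subst R.finsum_insert) auto
  finally show ?case .
qed

lemma ideal_order_ideal:
  assumes x: "x \<in> carrier M"
  shows "ideal (order_ideal R M x) R"
proof (rule R.ideal_of_closed)
  show "order_ideal R M x \<subseteq> carrier R"
    unfolding order_ideal_def using module_hom_self(1) x by blast
  have "(\<lambda>x. \<zero>) \<in> module_hom R M (self_module R)" by (rule module_hom_selfI) auto
  then show "\<zero> \<in> order_ideal R M x" unfolding order_ideal_def by force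
next
  fix a b assume "a \<in> order_ideal R M x" "b \<in> order_ideal R M x"
  then obtain \<phi> \<psi> where \<phi>: "\<phi> \<in> module_hom R M (self_module R)" "a = \<phi> x"
    and \<psi>: "\<psi> \<in> module_hom R M (self_module R)" "b = \<psi> x" unfolding order_ideal_def by blast
  note hom = module_hom_self[OF \<phi>(1)] module_hom_self[OF \<psi>(1)]
  have "(\<lambda>x. \<phi> x \<oplus> \<psi> x) \<in> module_hom R M (self_module R)"
    by (rule module_hom_selfI) (auto simp: hom R.a_ac R.r_distr)
  then show "a \<oplus> b \<in> order_ideal R M x" unfolding order_ideal_def \<phi>(2) \<psi>(2) by force
next
  fix a r assume "a \<in> order_ideal R M x" and r: "r \<in> carrier R"
  then obtain \<phi> where \<phi>: "\<phi> \<in> module_hom R M (self_module R)" "a = \<phi> x"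
    unfolding order_ideal_def by blast
  note hom = module_hom_self[OF \<phi>(1)]
  have "(\<lambda>x. r \<otimes> \<phi> x) \<in> module_hom R M (self_module R)"
    by (rule module_hom_selfI) (use r in \<open>auto simp: hom R.r_distr R.m_lcomm\<close>)
  then show "r \<otimes> a \<in> order_ideal R M x" unfolding order_ideal_def \<phi>(2) by force
qed

lemma order_ideal_relation_values:
  assumes E: "finite E" "E \<subseteq> carrier M"
    and a: "\<And>i. i < s \<Longrightarrow> a i \<in> carrier R" and n: "\<And>i. i < s \<Longrightarrow> n i \<in> carrier M"
    and u: "\<And>i. i < s \<Longrightarrow> u i \<in> carrier R"
    and c: "\<And>i e. i < s \<Longrightarrow> e \<in> E \<Longrightarrow> c i e \<in> carrier R"
    and rel: "\<And>i. i < s \<Longrightarrow> u i \<odot>\<^bsub>M\<^esub> n i = (\<Oplus>\<^bsub>M\<^esub>e\<in>E. c i e \<odot>\<^bsub>M\<^esub> e)"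
  shows "order_ideal R M (\<Oplus>\<^bsub>M\<^esub>i\<in>{..<s}. a i \<odot>\<^bsub>M\<^esub> n i) \<subseteq> relation_values R s E u c a"
proof
  fix b assume "b \<in> order_ideal R M (\<Oplus>\<^bsub>M\<^esub>i\<in>{..<s}. a i \<odot>\<^bsub>M\<^esub> n i)"
  then obtain \<phi> where \<phi>: "\<phi> \<in> module_hom R M (self_module R)"
    and b: "b = \<phi> (\<Oplus>\<^bsub>M\<^esub>i\<in>{..<s}. a i \<odot>\<^bsub>M\<^esub> n i)" unfolding order_ideal_def by blast
  note hom = module_hom_self[OF \<phi>]
  have "b = (\<Oplus>i\<in>{..<s}. \<phi> (a i \<odot>\<^bsub>M\<^esub> n i))"
    unfolding b using a n by (intro module_hom_finsum[OF \<phi>]) auto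
  also have "\<dots> = (\<Oplus>i\<in>{..<s}. \<phi> (n i) \<otimes> a i)"
    using a n by (intro R.finsum_cong') (auto simp: hom R.m_comm)
  finally have "b = (\<Oplus>i\<in>{..<s}. \<phi> (n i) \<otimes> a i)" .
  moreover have "\<phi> (n i) \<otimes> u i = (\<Oplus>e\<in>E. c i e \<otimes> \<phi> e)" if i: "i < s" for i
  proof -
    have "\<phi> (n i) \<otimes> u i = \<phi> (u i \<odot>\<^bsub>M\<^esub> n i)" using u[OF i] n[OF i] by (simp add: hom R.m_comm)
    also have "\<dots> = (\<Oplus>e\<in>E. \<phi> (c i e \<odot>\<^bsub>M\<^esub> e))"
      unfolding rel[OF i] using c[OF i] E by (intro module_hom_finsum[OF \<phi>]) auto
    also have "\<dots> = (\<Oplus>e\<in>E. c i e \<otimes> \<phi> e)"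
      using c[OF i] E(2) by (intro R.finsum_cong') (auto simp: hom subset_eq)
    finally show ?thesis .
  qed
  ultimately show "b \<in> relation_values R s E u c a"
    unfolding relation_values_def using n E(2) hom(1)
    by (intro CollectI exI[of _ "\<lambda>i. \<phi> (n i)"] exI[of _ \<phi>] conjI allI impI ballI) auto
qed

end

section \<open>Generators of localizations\<close>

lemma self_module_simps [simp]:
  "carrier (self_module R) = carrier R" "\<zero>\<^bsub>self_module R\<^esub> = \<zero>\<^bsub>R\<^esub>"
  "a \<oplus>\<^bsub>self_module R\<^esub> b = a \<oplus>\<^bsub>R\<^esub> b" "a \<odot>\<^bsub>self_module R\<^esub> b = a \<otimes>\<^bsub>R\<^esub> b"
  by (simp_all add: self_module_def)

text \<open>Reduces the computation of an operation on fractions to independence of the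
  representatives: a union of equal sets over nonempty index sets is that set.\<close>

lemma UN_pairs_const:
  assumes "(x, s) \<in> A" "(y, t) \<in> B"
    and "\<And>x s y t. (x, s) \<in> A \<Longrightarrow> (y, t) \<in> B \<Longrightarrow> F x s y t = C"
  shows "(\<Union>(x, s)\<in>A. \<Union>(y, t)\<in>B. F x s y t) = C"
proof -
  have "F (fst p) (snd p) (fst q) (snd q) = C" if "p \<in> A" "q \<in> B" for p q
    using assms(3) that by (metis prod.collapse)
  then show ?thesis using assms(1,2) by (auto simp: case_prod_unfold)
qed

context module
begin

context
  fixes S :: "'a set"
  assumes S: "S \<subseteq> carrier R" "\<one> \<in> S" "\<And>s t. s \<in> S \<Longrightarrow> t \<in> S \<Longrightarrow> s \<otimes> t \<in> S"
begin

lemma denominator_carrier: "s \<in> S \<Longrightarrow> s \<in> carrier R"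
  using S(1) by blast

lemma mem_fraction_iff:
  assumes "x \<in> carrier M" "s \<in> S"
  shows "(y, t) \<in> fraction R S M x s \<longleftrightarrow>
    y \<in> carrier M \<and> t \<in> S \<and> (\<exists>u\<in>S. (u \<otimes> t) \<odot>\<^bsub>M\<^esub> x = (u \<otimes> s) \<odot>\<^bsub>M\<^esub> y)"
  using assms denominator_carrier unfolding fraction_def by (auto simp: smult_assoc1)

lemma mem_fraction_self_iff:
  assumes "a \<in> carrier R" "s \<in> S"
  shows "(b, t) \<in> fraction R S (self_module R) a s \<longleftrightarrow>
    b \<in> carrier R \<and> t \<in> S \<and> (\<exists>u\<in>S. (u \<otimes> t) \<otimes> a = (u \<otimes> s) \<otimes> b)"
  using assms denominator_carrier unfolding fraction_def by (auto simp: R.m_assoc)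

lemma mem_fraction_sym:
  assumes "x \<in> carrier M" "s \<in> S" "(y, t) \<in> fraction R S M x s"
  shows "(x, s) \<in> fraction R S M y t"
proof -
  have y: "y \<in> carrier M" "t \<in> S" and u: "\<exists>u\<in>S. (u \<otimes> t) \<odot>\<^bsub>M\<^esub> x = (u \<otimes> s) \<odot>\<^bsub>M\<^esub> y"
    using assms(3) unfolding mem_fraction_iff[OF assms(1,2)] by auto
  show ?thesis unfolding mem_fraction_iff[OF y] using assms(1,2) u by metis
qed

lemma mem_fraction_trans:
  assumes x: "x \<in> carrier M" "s \<in> S" and "(y, t) \<in> fraction R S M x s" "(z, r) \<in> fraction R S M y t"
  shows "(z, r) \<in> fraction R S M x s"
proof -
  obtain u where y: "y \<in> carrier M" "t \<in> S" and u: "u \<in> S" "(u \<otimes> t) \<odot>\<^bsub>M\<^esub> x = (u \<otimes> s) \<odot>\<^bsub>M\<^esub> y"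
    using assms(3) unfolding mem_fraction_iff[OF x] by blast
  obtain v where z: "z \<in> carrier M" "r \<in> S" and v: "v \<in> S" "(v \<otimes> r) \<odot>\<^bsub>M\<^esub> y = (v \<otimes> t) \<odot>\<^bsub>M\<^esub> z"
    using assms(4) unfolding mem_fraction_iff[OF y] by blast
  have c: "s \<in> carrier R" "t \<in> carrier R" "r \<in> carrier R" "u \<in> carrier R" "v \<in> carrier R"
    using x y z u v denominator_carrier by auto
  \<comment> \<open>The witness is \<open>u \<otimes> v \<otimes> t\<close>; the middle denominator
    has to stay, since elements of \<open>S\<close> may be zero divisors.\<close>
  have "(u \<otimes> v \<otimes> t \<otimes> r) \<odot>\<^bsub>M\<^esub> x = (v \<otimes> r) \<odot>\<^bsub>M\<^esub> ((u \<otimes> t) \<odot>\<^bsub>M\<^esub> x)"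
    using c x by (simp add: smult_assoc1[symmetric] R.m_ac)
  also have "\<dots> = (u \<otimes> s) \<odot>\<^bsub>M\<^esub> ((v \<otimes> r) \<odot>\<^bsub>M\<^esub> y)"
    unfolding u(2) using c y by (simp add: smult_assoc1[symmetric] R.m_ac)
  also have "\<dots> = (u \<otimes> v \<otimes> t \<otimes> s) \<odot>\<^bsub>M\<^esub> z"
    unfolding v(2) using c z by (simp add: smult_assoc1[symmetric] R.m_ac)
  finally show ?thesis
    unfolding mem_fraction_iff[OF x] using z S(3) u v y by blast
qed

lemma fraction_self: "x \<in> carrier M \<Longrightarrow> s \<in> S \<Longrightarrow> (x, s) \<in> fraction R S M x s"
  using S(2) by (auto simp: mem_fraction_iff)

lemma fraction_cong:
  assumes "x \<in> carrier M" "s \<in> S" "(y, t) \<in> fraction R S M x s"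
  shows "fraction R S M y t = fraction R S M x s"
proof -
  have y: "y \<in> carrier M" "t \<in> S" using assms mem_fraction_iff by auto
  have "p \<in> fraction R S M y t \<longleftrightarrow> p \<in> fraction R S M x s" for p
    using mem_fraction_trans[OF assms(1,2,3), of "fst p" "snd p"]
      mem_fraction_trans[OF y mem_fraction_sym[OF assms(1,2,3)], of "fst p" "snd p"] by auto
  then show ?thesis by blast
qed

lemma fraction_eqI:
  assumes "x \<in> carrier M" "s \<in> S" "y \<in> carrier M" "t \<in> S" "u \<in> S"
    "(u \<otimes> t) \<odot>\<^bsub>M\<^esub> x = (u \<otimes> s) \<odot>\<^bsub>M\<^esub> y"
  shows "fraction R S M y t = fraction R S M x s"
  by (rule fraction_cong) (use assms mem_fraction_iff in auto)

lemma fraction_eqD: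
  assumes "fraction R S M x s = fraction R S M y t" "x \<in> carrier M" "s \<in> S" "y \<in> carrier M" "t \<in> S"
  shows "\<exists>u\<in>S. (u \<otimes> t) \<odot>\<^bsub>M\<^esub> x = (u \<otimes> s) \<odot>\<^bsub>M\<^esub> y"
  using fraction_self[OF assms(4,5)] mem_fraction_iff[OF assms(2,3)] unfolding assms(1)[symmetric] by blast

lemma fraction_add_eq:
  assumes x: "x \<in> carrier M" "s \<in> S" and y: "y \<in> carrier M" "t \<in> S"
  shows "fraction_add R S M (fraction R S M x s) (fraction R S M y t)
    = fraction R S M (t \<odot>\<^bsub>M\<^esub> x \<oplus>\<^bsub>M\<^esub> s \<odot>\<^bsub>M\<^esub> y) (s \<otimes> t)" (is "_ = ?r")
proof -
  have c: "s \<in> carrier R" "t \<in> carrier R" using x y S(1) by auto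
  have "fraction R S M (t' \<odot>\<^bsub>M\<^esub> x' \<oplus>\<^bsub>M\<^esub> s' \<odot>\<^bsub>M\<^esub> y') (s' \<otimes> t') = ?r"
    if x'in: "(x', s') \<in> fraction R S M x s" and y'in: "(y', t') \<in> fraction R S M y t" for x' s' y' t'
  proof -
    obtain u where x': "x' \<in> carrier M" "s' \<in> S" and u: "u \<in> S" "(u \<otimes> s') \<odot>\<^bsub>M\<^esub> x = (u \<otimes> s) \<odot>\<^bsub>M\<^esub> x'"
      using x'in unfolding mem_fraction_iff[OF x] by blast
    obtain v where y': "y' \<in> carrier M" "t' \<in> S" and v: "v \<in> S" "(v \<otimes> t') \<odot>\<^bsub>M\<^esub> y = (v \<otimes> t) \<odot>\<^bsub>M\<^esub> y'"
      using y'in unfolding mem_fraction_iff[OF y] by blast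
    have c': "s' \<in> carrier R" "t' \<in> carrier R" "u \<in> carrier R" "v \<in> carrier R"
      using x' y' u v S(1) by auto
    have "(u \<otimes> v \<otimes> (s' \<otimes> t')) \<odot>\<^bsub>M\<^esub> (t \<odot>\<^bsub>M\<^esub> x \<oplus>\<^bsub>M\<^esub> s \<odot>\<^bsub>M\<^esub> y)
      = (t \<otimes> t' \<otimes> v) \<odot>\<^bsub>M\<^esub> ((u \<otimes> s') \<odot>\<^bsub>M\<^esub> x) \<oplus>\<^bsub>M\<^esub> (s \<otimes> s' \<otimes> u) \<odot>\<^bsub>M\<^esub> ((v \<otimes> t') \<odot>\<^bsub>M\<^esub> y)"
      using c c' x y by (simp add: smult_r_distr smult_assoc1[symmetric] R.m_ac)
    also have "\<dots> = (u \<otimes> v \<otimes> (s \<otimes> t)) \<odot>\<^bsub>M\<^esub> (t' \<odot>\<^bsub>M\<^esub> x' \<oplus>\<^bsub>M\<^esub> s' \<odot>\<^bsub>M\<^esub> y')"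
      unfolding u(2) v(2) using c c' x' y' by (simp add: smult_r_distr smult_assoc1[symmetric] R.m_ac)
    finally show ?thesis
      using c c' x y x' y' u(1) v(1) S(3) by (intro fraction_eqI[of _ _ _ _ "u \<otimes> v"]) auto
  qed
  moreover have "(x, s) \<in> fraction R S M x s" "(y, t) \<in> fraction R S M y t"
    using fraction_self x y by auto
  ultimately show ?thesis unfolding fraction_add_def by (intro UN_pairs_const)
qed

lemma fraction_smult_eq:
  assumes a: "a \<in> carrier R" "s \<in> S" and x: "x \<in> carrier M" "t \<in> S"
  shows "fraction_smult R S M (fraction R S (self_module R) a s) (fraction R S M x t)
    = fraction R S M (a \<odot>\<^bsub>M\<^esub> x) (s \<otimes> t)" (is "_ = ?r")
proof -
  have c: "s \<in> carrier R" "t \<in> carrier R" using a x S(1) by auto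
  have "fraction R S M (a' \<odot>\<^bsub>M\<^esub> x') (s' \<otimes> t') = ?r"
    if a'in: "(a', s') \<in> fraction R S (self_module R) a s" and x'in: "(x', t') \<in> fraction R S M x t" for a' s' x' t'
  proof -
    obtain u where a': "a' \<in> carrier R" "s' \<in> S" and u: "u \<in> S" "(u \<otimes> s') \<otimes> a = (u \<otimes> s) \<otimes> a'"
      using a'in unfolding mem_fraction_self_iff[OF a] by blast
    obtain v where x': "x' \<in> carrier M" "t' \<in> S" and v: "v \<in> S" "(v \<otimes> t') \<odot>\<^bsub>M\<^esub> x = (v \<otimes> t) \<odot>\<^bsub>M\<^esub> x'"
      using x'in unfolding mem_fraction_iff[OF x] by blast
    have c': "s' \<in> carrier R" "t' \<in> carrier R" "u \<in> carrier R" "v \<in> carrier R"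
      using x' a' u v S(1) by auto
    have "(u \<otimes> v \<otimes> (s' \<otimes> t')) \<odot>\<^bsub>M\<^esub> (a \<odot>\<^bsub>M\<^esub> x) = (u \<otimes> s' \<otimes> a) \<odot>\<^bsub>M\<^esub> ((v \<otimes> t') \<odot>\<^bsub>M\<^esub> x)"
      using c c' a x by (simp add: smult_assoc1[symmetric] R.m_ac)
    also have "\<dots> = (u \<otimes> v \<otimes> (s \<otimes> t)) \<odot>\<^bsub>M\<^esub> (a' \<odot>\<^bsub>M\<^esub> x')"
      unfolding u(2) v(2) using c c' a' x' by (simp add: smult_assoc1[symmetric] R.m_ac)
    finally show ?thesis
      using c c' x a x' a' u(1) v(1) S(3) by (intro fraction_eqI[of _ _ _ _ "u \<otimes> v"]) auto
  qed
  moreover have "(a, s) \<in> fraction R S (self_module R) a s" "(x, t) \<in> fraction R S M x t"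
    using fraction_self[OF x] mem_fraction_self_iff[OF a] a S(2) by auto
  ultimately show ?thesis unfolding fraction_smult_def by (intro UN_pairs_const)
qed

text \<open>The predicate \<open>submodule\<close> asks for closure under \<open>inv\<close>, a
  definite description. Existence and uniqueness of the inverse are checked directly, in place of
  all group axioms of the localization.\<close>

lemma localization_module_uminus:
  assumes x: "x \<in> carrier M" "s \<in> S"
  shows "inv\<^bsub>add_monoid (localization_module R S M)\<^esub> (fraction R S M x s) = fraction R S M (\<ominus>\<^bsub>M\<^esub> x) s"
proof -
  let ?L = "localization_module R S M" and ?z = "fraction R S M \<zero>\<^bsub>M\<^esub> \<one>"
  have sc: "s \<in> carrier R" using x S(1) by blast
  have mx: "\<ominus>\<^bsub>M\<^esub> x \<in> carrier M" using x by simp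
  have zero_eq: "fraction R S M \<zero>\<^bsub>M\<^esub> (s \<otimes> s) = ?z"
    using sc x S by (intro fraction_eqI[of _ _ _ _ \<one>]) auto
  have "s \<odot>\<^bsub>M\<^esub> x \<oplus>\<^bsub>M\<^esub> s \<odot>\<^bsub>M\<^esub> (\<ominus>\<^bsub>M\<^esub> x) = \<zero>\<^bsub>M\<^esub>"
    using sc x by (simp add: smult_r_minus M.r_neg)
  then have 1: "fraction_add R S M (fraction R S M x s) (fraction R S M (\<ominus>\<^bsub>M\<^esub> x) s) = ?z"
    using fraction_add_eq[OF x mx x(2)] zero_eq by simp
  have "s \<odot>\<^bsub>M\<^esub> (\<ominus>\<^bsub>M\<^esub> x) \<oplus>\<^bsub>M\<^esub> s \<odot>\<^bsub>M\<^esub> x = \<zero>\<^bsub>M\<^esub>"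
    using sc x by (simp add: smult_r_minus M.l_neg)
  then have 2: "fraction_add R S M (fraction R S M (\<ominus>\<^bsub>M\<^esub> x) s) (fraction R S M x s) = ?z"
    using fraction_add_eq[OF mx x(2) x] zero_eq by simp
  have uniq: "Y = fraction R S M (\<ominus>\<^bsub>M\<^esub> x) s"
    if Y: "Y \<in> carrier ?L" "fraction_add R S M (fraction R S M x s) Y = ?z" for Y
  proof -
    obtain y t where y: "y \<in> carrier M" "t \<in> S" "Y = fraction R S M y t"
      using Y(1) unfolding localization_module_def by auto
    have tc: "t \<in> carrier R" using y S(1) by blast
    have "fraction R S M (t \<odot>\<^bsub>M\<^esub> x \<oplus>\<^bsub>M\<^esub> s \<odot>\<^bsub>M\<^esub> y) (s \<otimes> t) = ?z"
      using Y(2) fraction_add_eq[OF x y(1,2)] y(3) by simp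
    then obtain u where u: "u \<in> S"
      "(u \<otimes> \<one>) \<odot>\<^bsub>M\<^esub> (t \<odot>\<^bsub>M\<^esub> x \<oplus>\<^bsub>M\<^esub> s \<odot>\<^bsub>M\<^esub> y) = (u \<otimes> (s \<otimes> t)) \<odot>\<^bsub>M\<^esub> \<zero>\<^bsub>M\<^esub>"
      using fraction_eqD[of "t \<odot>\<^bsub>M\<^esub> x \<oplus>\<^bsub>M\<^esub> s \<odot>\<^bsub>M\<^esub> y" "s \<otimes> t" "\<zero>\<^bsub>M\<^esub>" "\<one>"] x y sc tc S by auto
    have uc: "u \<in> carrier R" using u S(1) by blast
    have "(u \<otimes> t) \<odot>\<^bsub>M\<^esub> x \<oplus>\<^bsub>M\<^esub> (u \<otimes> s) \<odot>\<^bsub>M\<^esub> y = \<zero>\<^bsub>M\<^esub>"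
      using u(2) uc sc tc x y by (simp add: smult_r_distr smult_assoc1)
    then have "(u \<otimes> s) \<odot>\<^bsub>M\<^esub> y = \<ominus>\<^bsub>M\<^esub> ((u \<otimes> t) \<odot>\<^bsub>M\<^esub> x)"
      using uc sc tc x y by (intro M.minus_equality[symmetric]) (auto simp: M.a_comm)
    then have "(u \<otimes> s) \<odot>\<^bsub>M\<^esub> y = (u \<otimes> t) \<odot>\<^bsub>M\<^esub> (\<ominus>\<^bsub>M\<^esub> x)"
      using uc tc x by (simp add: smult_r_minus)
    then show ?thesis
      unfolding y(3) using x y u(1) by (intro fraction_eqI[of _ _ _ _ u]) auto
  qed
  have mem: "fraction R S M (\<ominus>\<^bsub>M\<^esub> x) s \<in> carrier ?L"
    unfolding localization_module_def using mx x(2) by auto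
  show ?thesis
    unfolding m_inv_def
  proof (rule the_equality)
    show "fraction R S M (\<ominus>\<^bsub>M\<^esub> x) s \<in> carrier (add_monoid ?L) \<and>
      fraction R S M x s \<otimes>\<^bsub>add_monoid ?L\<^esub> fraction R S M (\<ominus>\<^bsub>M\<^esub> x) s = \<one>\<^bsub>add_monoid ?L\<^esub> \<and>
      fraction R S M (\<ominus>\<^bsub>M\<^esub> x) s \<otimes>\<^bsub>add_monoid ?L\<^esub> fraction R S M x s = \<one>\<^bsub>add_monoid ?L\<^esub>"
      using mem 1 2 by (simp add: localization_module_def)
    fix Y assume "Y \<in> carrier (add_monoid ?L) \<and>
      fraction R S M x s \<otimes>\<^bsub>add_monoid ?L\<^esub> Y = \<one>\<^bsub>add_monoid ?L\<^esub> \<and>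
      Y \<otimes>\<^bsub>add_monoid ?L\<^esub> fraction R S M x s = \<one>\<^bsub>add_monoid ?L\<^esub>"
    then show "Y = fraction R S M (\<ominus>\<^bsub>M\<^esub> x) s"
      by (intro uniq) (simp_all add: localization_module_def)
  qed
qed

lemma submodule_fractions:
  assumes H: "submodule H R M"
  shows "submodule {fraction R S M x s | x s. x \<in> H \<and> s \<in> S} (localization_ring R S) (localization_module R S M)"
    (is "submodule ?F _ ?L")
proof -
  have Hc: "x \<in> carrier M" if "x \<in> H" for x using submoduleE(1)[OF H] that by blast
  have zeroH: "\<zero>\<^bsub>M\<^esub> \<in> H" using subgroup.one_closed[OF submodule.axioms(1)[OF H]] by simp
  have sc: "s \<in> carrier R" if "s \<in> S" for s using S(1) that by blast
  show ?thesis
  proof (intro submodule.intro subgroup.intro submodule_axioms.intro)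
    show "?F \<subseteq> carrier (add_monoid ?L)" using Hc by (auto simp: localization_module_def)
    show "\<one>\<^bsub>add_monoid ?L\<^esub> \<in> ?F" using zeroH S(2) by (auto simp: localization_module_def)
  next
    fix X Y assume "X \<in> ?F" "Y \<in> ?F"
    then obtain x s y t where x: "X = fraction R S M x s" "x \<in> H" "s \<in> S"
      and y: "Y = fraction R S M y t" "y \<in> H" "t \<in> S" by blast
    have "t \<odot>\<^bsub>M\<^esub> x \<oplus>\<^bsub>M\<^esub> s \<odot>\<^bsub>M\<^esub> y \<in> H"
      using x y sc by (intro submoduleE(5)[OF H] submoduleE(4)[OF H]) auto
    then have "fraction_add R S M X Y \<in> ?F"
      using fraction_add_eq[OF Hc[OF x(2)] x(3) Hc[OF y(2)] y(3)] x y S(3) by blast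
    then show "X \<otimes>\<^bsub>add_monoid ?L\<^esub> Y \<in> ?F" by (simp add: localization_module_def)
  next
    fix X assume "X \<in> ?F"
    then obtain x s where x: "X = fraction R S M x s" "x \<in> H" "s \<in> S" by blast
    then show "inv\<^bsub>add_monoid ?L\<^esub> X \<in> ?F"
      using localization_module_uminus[OF Hc[OF x(2)] x(3)] submoduleE(3)[OF H x(2)] by blast
  next
    fix A X assume "A \<in> carrier (localization_ring R S)" "X \<in> ?F"
    then obtain a s x t where a: "A = fraction R S (self_module R) a s" "a \<in> carrier R" "s \<in> S"
      and x: "X = fraction R S M x t" "x \<in> H" "t \<in> S" unfolding localization_ring_def by auto
    have "fraction_smult R S M A X \<in> ?F"
      unfolding a(1) x(1) fraction_smult_eq[OF a(2,3) Hc[OF x(2)] x(3)]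
      using submoduleE(4)[OF H a(2) x(2)] S(3)[OF a(3) x(3)] by blast
    then show "A \<odot>\<^bsub>?L\<^esub> X \<in> ?F" by (simp add: localization_module_def)
  qed
qed

text \<open>A submodule \<open>H\<close> of the localization that contains the images of the
  generators contracts to a submodule of \<open>M\<close> containing \<open>A\<close>, hence to all
  of \<open>M\<close>; multiplying by \<open>1/s\<close> reaches every fraction. This keeps the
  infimum that defines the local number of generators finite.\<close>

lemma localization_finitely_generated:
  assumes "finite_generating_set R M A"
  shows "finite_generating_set (localization_ring R S) (localization_module R S M) ((\<lambda>x. fraction R S M x \<one>) ` A)"
    (is "finite_generating_set ?RS ?L ?A")
proof -
  have A: "finite A" "A \<subseteq> carrier M" "module_span R M A = carrier M"
    using assms unfolding finite_generating_set_def by auto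
  have AL: "?A \<subseteq> carrier ?L" using A(2) S(2) by (auto simp: localization_module_def)
  have all: "X \<in> H" if H: "submodule H ?RS ?L" "?A \<subseteq> H" and X: "X \<in> carrier ?L" for H X
  proof -
    define K where "K = {z \<in> carrier M. fraction R S M z \<one> \<in> H}"
    have smult: "fraction R S M (a \<odot>\<^bsub>M\<^esub> z) (s \<otimes> t) \<in> H"
      if "a \<in> carrier R" "s \<in> S" "z \<in> carrier M" "t \<in> S" "fraction R S M z t \<in> H" for a s z t
    proof -
      have "fraction R S (self_module R) a s \<in> carrier ?RS"
        unfolding localization_ring_def using that by auto
      then have "fraction R S (self_module R) a s \<odot>\<^bsub>?L\<^esub> fraction R S M z t \<in> H"
        by (rule submodule.smult_closed[OF H(1) _ that(5)])
      then show ?thesis using fraction_smult_eq[OF that(1-4)] by (simp add: localization_module_def)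
    qed
    have "submodule K R M"
    proof (rule submodule_of_closed)
      show "\<zero>\<^bsub>M\<^esub> \<in> K"
        using subgroup.one_closed[OF submodule.axioms(1)[OF H(1)]]
        by (simp add: K_def localization_module_def)
    next
      fix x y assume xy: "x \<in> K" "y \<in> K"
      then have c: "x \<in> carrier M" "y \<in> carrier M" unfolding K_def by auto
      have "fraction R S M x \<one> \<otimes>\<^bsub>add_monoid ?L\<^esub> fraction R S M y \<one> \<in> H"
        using xy by (intro subgroup.m_closed[OF submodule.axioms(1)[OF H(1)]]) (auto simp: K_def)
      then show "x \<oplus>\<^bsub>M\<^esub> y \<in> K"
        using fraction_add_eq[OF c(1) S(2) c(2) S(2)] c by (simp add: K_def localization_module_def)
    next
      fix a x assume a: "a \<in> carrier R" and "x \<in> K"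
      then show "a \<odot>\<^bsub>M\<^esub> x \<in> K" using smult[OF a S(2), of x \<one>] S(2) by (simp add: K_def)
    qed (auto simp: K_def)
    moreover have "A \<subseteq> K" using A(2) H(2) by (auto simp: K_def)
    ultimately have "carrier M \<subseteq> K" using module_span_least A(3) by metis
    moreover obtain z s where z: "z \<in> carrier M" "s \<in> S" "X = fraction R S M z s"
      using X unfolding localization_module_def by auto
    ultimately have "fraction R S M z \<one> \<in> H" by (auto simp: K_def)
    then have "fraction R S M (\<one> \<odot>\<^bsub>M\<^esub> z) (s \<otimes> \<one>) \<in> H"
      using z S by (intro smult) auto
    then show ?thesis using z S(1) by (auto simp: subset_eq)
  qed
  have "submodule (carrier ?L) ?RS ?L"
    using submodule_fractions[OF carrier_is_submodule] by (simp add: localization_module_def)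
  then have "module_span ?RS ?L ?A = carrier ?L"
    unfolding module_span_def using AL all by (intro equalityI) blast+
  then show ?thesis using A(1) AL unfolding finite_generating_set_def by simp
qed

text \<open>The set is the preimage in \<open>M\<close> of the submodule of the localization that is
  generated by \<open>E\<close>.\<close>

lemma submodule_denominator_combinations:
  assumes E: "finite E" "E \<subseteq> carrier M"
  shows "submodule {z \<in> carrier M. \<exists>u\<in>S. \<exists>c. (\<forall>e\<in>E. c e \<in> carrier R) \<and> u \<odot>\<^bsub>M\<^esub> z = (\<Oplus>\<^bsub>M\<^esub>e\<in>E. c e \<odot>\<^bsub>M\<^esub> e)} R M"
    (is "submodule ?H R M")
proof -
  have sc: "s \<in> carrier R" if "s \<in> S" for s using S(1) that by blast
  have Ec: "e \<in> carrier M" if "e \<in> E" for e using E(2) that by blast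
  have HI: "z \<in> ?H"
    if "z \<in> carrier M" "u \<in> S" "\<And>e. e \<in> E \<Longrightarrow> c e \<in> carrier R" "u \<odot>\<^bsub>M\<^esub> z = (\<Oplus>\<^bsub>M\<^esub>e\<in>E. c e \<odot>\<^bsub>M\<^esub> e)" for z u c
    using that by blast
  have scale: "b \<odot>\<^bsub>M\<^esub> (\<Oplus>\<^bsub>M\<^esub>e\<in>E. c e \<odot>\<^bsub>M\<^esub> e) = (\<Oplus>\<^bsub>M\<^esub>e\<in>E. (b \<otimes> c e) \<odot>\<^bsub>M\<^esub> e)"
    if "b \<in> carrier R" "\<And>e. e \<in> E \<Longrightarrow> c e \<in> carrier R" for b c
  proof -
    have "b \<odot>\<^bsub>M\<^esub> (\<Oplus>\<^bsub>M\<^esub>e\<in>E. c e \<odot>\<^bsub>M\<^esub> e) = (\<Oplus>\<^bsub>M\<^esub>e\<in>E. b \<odot>\<^bsub>M\<^esub> (c e \<odot>\<^bsub>M\<^esub> e))"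
      using that Ec E(1) by (intro finsum_smult_ldistr) auto
    also have "\<dots> = (\<Oplus>\<^bsub>M\<^esub>e\<in>E. (b \<otimes> c e) \<odot>\<^bsub>M\<^esub> e)"
      using that Ec by (intro M.finsum_cong') (auto simp: smult_assoc1)
    finally show ?thesis .
  qed
  show ?thesis
  proof (rule submodule_of_closed)
    have "(\<Oplus>\<^bsub>M\<^esub>e\<in>E. \<zero> \<odot>\<^bsub>M\<^esub> e) = (\<Oplus>\<^bsub>M\<^esub>e\<in>E. \<zero>\<^bsub>M\<^esub>)"
      using Ec by (intro M.finsum_cong') auto
    then show "\<zero>\<^bsub>M\<^esub> \<in> ?H" using S(2) by (intro HI[of _ \<one> "\<lambda>e. \<zero>"]) auto
    show "?H \<subseteq> carrier M" by blast
  next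
    fix x y assume "x \<in> ?H" "y \<in> ?H"
    then obtain u v c d where u: "x \<in> carrier M" "u \<in> S" "\<forall>e\<in>E. c e \<in> carrier R" "u \<odot>\<^bsub>M\<^esub> x = (\<Oplus>\<^bsub>M\<^esub>e\<in>E. c e \<odot>\<^bsub>M\<^esub> e)"
      and v: "y \<in> carrier M" "v \<in> S" "\<forall>e\<in>E. d e \<in> carrier R" "v \<odot>\<^bsub>M\<^esub> y = (\<Oplus>\<^bsub>M\<^esub>e\<in>E. d e \<odot>\<^bsub>M\<^esub> e)" by blast
    have uv: "u \<in> carrier R" "v \<in> carrier R" using u v sc by auto
    have "(u \<otimes> v) \<odot>\<^bsub>M\<^esub> (x \<oplus>\<^bsub>M\<^esub> y) = v \<odot>\<^bsub>M\<^esub> (u \<odot>\<^bsub>M\<^esub> x) \<oplus>\<^bsub>M\<^esub> u \<odot>\<^bsub>M\<^esub> (v \<odot>\<^bsub>M\<^esub> y)"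
      using uv u(1) v(1) by (simp add: smult_r_distr smult_assoc1[symmetric] R.m_comm)
    also have "\<dots> = (\<Oplus>\<^bsub>M\<^esub>e\<in>E. (v \<otimes> c e) \<odot>\<^bsub>M\<^esub> e) \<oplus>\<^bsub>M\<^esub> (\<Oplus>\<^bsub>M\<^esub>e\<in>E. (u \<otimes> d e) \<odot>\<^bsub>M\<^esub> e)"
      unfolding u(4) v(4) using uv u(3) v(3) by (simp add: scale)
    also have "\<dots> = (\<Oplus>\<^bsub>M\<^esub>e\<in>E. (v \<otimes> c e) \<odot>\<^bsub>M\<^esub> e \<oplus>\<^bsub>M\<^esub> (u \<otimes> d e) \<odot>\<^bsub>M\<^esub> e)"
      using uv u(3) v(3) Ec by (intro M.finsum_addf[symmetric]) auto
    also have "\<dots> = (\<Oplus>\<^bsub>M\<^esub>e\<in>E. (v \<otimes> c e \<oplus> u \<otimes> d e) \<odot>\<^bsub>M\<^esub> e)"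
      using uv u(3) v(3) Ec by (intro M.finsum_cong') (auto simp: smult_l_distr)
    finally show "x \<oplus>\<^bsub>M\<^esub> y \<in> ?H"
      using u(1-3) v(1-3) uv S(3) by (intro HI[of _ "u \<otimes> v" "\<lambda>e. v \<otimes> c e \<oplus> u \<otimes> d e"]) auto
  next
    fix b x assume b: "b \<in> carrier R" and "x \<in> ?H"
    then obtain u c where u: "x \<in> carrier M" "u \<in> S" "\<forall>e\<in>E. c e \<in> carrier R" "u \<odot>\<^bsub>M\<^esub> x = (\<Oplus>\<^bsub>M\<^esub>e\<in>E. c e \<odot>\<^bsub>M\<^esub> e)"
      by blast
    have "u \<odot>\<^bsub>M\<^esub> (b \<odot>\<^bsub>M\<^esub> x) = b \<odot>\<^bsub>M\<^esub> (u \<odot>\<^bsub>M\<^esub> x)"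
      using b u(1) sc[OF u(2)] by (simp add: smult_assoc1[symmetric] R.m_comm)
    also have "\<dots> = (\<Oplus>\<^bsub>M\<^esub>e\<in>E. (b \<otimes> c e) \<odot>\<^bsub>M\<^esub> e)" unfolding u(4) using b u(3) by (simp add: scale)
    finally show "b \<odot>\<^bsub>M\<^esub> x \<in> ?H"
      using b u(1-3) by (intro HI[of _ u "\<lambda>e. b \<otimes> c e"]) auto
  qed
qed

text \<open>Numerators of the generators suffice, because denominators are units in the
  localization; several fractions may receive the same numerator, so \<open>E\<close> can be smaller
  than \<open>A\<close>. The fractions with numerator in \<open>H\<close> contain \<open>A\<close>
  and hence are everything; clearing denominators brings each \<open>z\<close> itself into
  \<open>H\<close>.\<close>

theorem lift_localization_generators:
  assumes "finite_generating_set (localization_ring R S) (localization_module R S M) A"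
  shows "\<exists>E. finite E \<and> E \<subseteq> carrier M \<and> card E \<le> card A \<and>
    (\<forall>z\<in>carrier M. \<exists>u\<in>S. \<exists>c. (\<forall>e\<in>E. c e \<in> carrier R) \<and> u \<odot>\<^bsub>M\<^esub> z = (\<Oplus>\<^bsub>M\<^esub>e\<in>E. c e \<odot>\<^bsub>M\<^esub> e))"
proof -
  let ?RS = "localization_ring R S" and ?L = "localization_module R S M"
  have A: "finite A" "A \<subseteq> carrier ?L" "module_span ?RS ?L A = carrier ?L"
    using assms unfolding finite_generating_set_def by auto
  have "\<forall>X\<in>A. \<exists>x. x \<in> carrier M \<and> (\<exists>s\<in>S. X = fraction R S M x s)"
    using A(2) unfolding localization_module_def by auto
  then obtain r where r: "\<forall>X\<in>A. r X \<in> carrier M \<and> (\<exists>s\<in>S. X = fraction R S M (r X) s)"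
    using bchoice by metis
  define E where "E = r ` A"
  have E: "finite E" "E \<subseteq> carrier M" "card E \<le> card A"
    unfolding E_def using A(1) r card_image_le by auto
  define H where "H = {z \<in> carrier M. \<exists>u\<in>S. \<exists>c. (\<forall>e\<in>E. c e \<in> carrier R) \<and> u \<odot>\<^bsub>M\<^esub> z = (\<Oplus>\<^bsub>M\<^esub>e\<in>E. c e \<odot>\<^bsub>M\<^esub> e)}"
  have H: "submodule H R M" unfolding H_def by (rule submodule_denominator_combinations[OF E(1,2)])
  have "f \<in> H" if f: "f \<in> E" for f
  proof -
    have fc: "f \<in> carrier M" using f E(2) by blast
    have "(\<Oplus>\<^bsub>M\<^esub>e\<in>E. (if e = f then \<one> else \<zero>) \<odot>\<^bsub>M\<^esub> e) = (\<Oplus>\<^bsub>M\<^esub>e\<in>E. if f = e then e else \<zero>\<^bsub>M\<^esub>)"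
      using E(2) by (intro M.finsum_cong') auto
    also have "\<dots> = f" by (rule M.add.finprod_singleton[OF f E(1)]) (use E(2) in auto)
    finally have "\<one> \<odot>\<^bsub>M\<^esub> f = (\<Oplus>\<^bsub>M\<^esub>e\<in>E. (if e = f then \<one> else \<zero>) \<odot>\<^bsub>M\<^esub> e)" using fc by simp
    then show ?thesis
      unfolding H_def using fc S(2)
      by (intro CollectI conjI bexI[of _ \<one>] exI[of _ "\<lambda>e. if e = f then \<one> else \<zero>"]) auto
  qed
  then have "A \<subseteq> {fraction R S M x s | x s. x \<in> H \<and> s \<in> S}" using r unfolding E_def by blast
  then have span: "carrier ?L \<subseteq> {fraction R S M x s | x s. x \<in> H \<and> s \<in> S}"
    using submodule_fractions[OF H] unfolding A(3)[symmetric] module_span_def by blast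
  have "z \<in> H" if z: "z \<in> carrier M" for z
  proof -
    have "fraction R S M z \<one> \<in> carrier ?L" using z S(2) by (auto simp: localization_module_def)
    then obtain x s where x: "fraction R S M z \<one> = fraction R S M x s" "x \<in> H" "s \<in> S" using span by blast
    have xc: "x \<in> carrier M" using x(2) unfolding H_def by blast
    obtain u where u: "u \<in> S" "(u \<otimes> s) \<odot>\<^bsub>M\<^esub> z = (u \<otimes> \<one>) \<odot>\<^bsub>M\<^esub> x"
      using fraction_eqD[OF x(1) z S(2) xc x(3)] by blast
    have c: "u \<in> carrier R" "s \<in> carrier R" using u x S(1) by auto
    have "u \<odot>\<^bsub>M\<^esub> x \<in> H" by (rule submoduleE(4)[OF H c(1) x(2)])
    then have "(u \<otimes> s) \<odot>\<^bsub>M\<^esub> z \<in> H" using u(2) c by simp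
    then obtain v d where v: "v \<in> S" "\<forall>e\<in>E. d e \<in> carrier R"
      "v \<odot>\<^bsub>M\<^esub> ((u \<otimes> s) \<odot>\<^bsub>M\<^esub> z) = (\<Oplus>\<^bsub>M\<^esub>e\<in>E. d e \<odot>\<^bsub>M\<^esub> e)" unfolding H_def by blast
    have vc: "v \<in> carrier R" using v S(1) by blast
    have "(v \<otimes> (u \<otimes> s)) \<odot>\<^bsub>M\<^esub> z = (\<Oplus>\<^bsub>M\<^esub>e\<in>E. d e \<odot>\<^bsub>M\<^esub> e)"
      using v(3) vc c z by (simp add: smult_assoc1)
    moreover have "v \<otimes> (u \<otimes> s) \<in> S" using v(1) u(1) x(3) S(3) by blast
    ultimately show ?thesis unfolding H_def using z v(2) by blast
  qed
  then show ?thesis using E unfolding H_def by blast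
qed

end

end

section \<open>Dimension and height via chains\<close>

lemma carrier_Quot: "carrier (R Quot I) = (+>\<^bsub>R\<^esub>) I ` carrier R"
  by (simp add: FactRing_def A_RCOSETS_def' UNION_singleton_eq_range)

lemma zero_Quot: "\<zero>\<^bsub>R Quot I\<^esub> = I"
  by (simp add: FactRing_def)

text \<open>Two representatives of a coset differ by an element of \<open>I\<close>, hence of
  \<open>J\<close>.\<close>

lemma (in ideal) rcos_image_mem_iff:
  assumes J: "ideal J R" "I \<subseteq> J" and a: "a \<in> carrier R"
  shows "I +> a \<in> (+>) I ` J \<longleftrightarrow> a \<in> J"
proof
  interpret J: ideal J R by fact
  assume "I +> a \<in> (+>) I ` J"
  then obtain c where c: "c \<in> J" "I +> a = I +> c" by auto
  have cc: "c \<in> carrier R" using c(1) by (rule J.Icarr)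
  have "a \<ominus> c \<in> J"
    using quotient_eq_iff_same_a_r_cos[OF is_ideal a cc] c(2) J(2) by blast
  then have "(a \<ominus> c) \<oplus> c \<in> J" using c(1) by (rule J.a_closed)
  then show "a \<in> J" using a cc by (simp add: a_minus_def a_assoc l_neg)
qed simp

lemma (in cring) quotient_image_prime:
  assumes I: "ideal I R" and P: "primeideal P R" "I \<subseteq> P"
  shows "primeideal ((+>) I ` P) (R Quot I)"
proof -
  interpret I: ideal I R by fact
  interpret P: primeideal P R by fact
  interpret h: ring_hom_cring R "R Quot I" "(+>) I" by (rule I.rcos_ring_hom_cring[OF is_cring])
  note mem = I.rcos_image_mem_iff[OF P.is_ideal P(2)]
  show ?thesis
  proof (rule primeidealI)
    show "ideal ((+>) I ` P) (R Quot I)" by (rule ring_ideal_imp_quot_ideal[OF I P.is_ideal])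
    show "cring (R Quot I)" by (rule I.quotient_is_cring[OF is_cring])
    have "I +> \<one> \<notin> (+>) I ` P" using mem[OF one_closed] P.one_notin by simp
    moreover have "I +> \<one> \<in> carrier (R Quot I)" by simp
    ultimately show "carrier (R Quot I) \<noteq> (+>) I ` P" by metis
  next
    fix x y assume "x \<in> carrier (R Quot I)" "y \<in> carrier (R Quot I)"
      and xy: "x \<otimes>\<^bsub>R Quot I\<^esub> y \<in> (+>) I ` P"
    then obtain a b where a: "a \<in> carrier R" "x = I +> a" and b: "b \<in> carrier R" "y = I +> b"
      unfolding carrier_Quot by blast
    have "I +> (a \<otimes> b) \<in> (+>) I ` P" using xy a b by simp
    then have "a \<otimes> b \<in> P" using mem[of "a \<otimes> b"] a(1) b(1) by blast
    then show "x \<in> (+>) I ` P \<or> y \<in> (+>) I ` P" using P.I_prime[OF a(1) b(1)] a(2) b(2) by blast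
  qed
qed

lemma (in cring) quotient_vimage_prime:
  assumes I: "ideal I R" and P: "primeideal P (R Quot I)"
  shows "primeideal {r \<in> carrier R. I +> r \<in> P} R" "I \<subseteq> {r \<in> carrier R. I +> r \<in> P}"
proof -
  interpret I: ideal I R by fact
  interpret P: primeideal P "R Quot I" by fact
  interpret h: ring_hom_cring R "R Quot I" "(+>) I" by (rule I.rcos_ring_hom_cring[OF is_cring])
  show "primeideal {r \<in> carrier R. I +> r \<in> P} R"
  proof (rule primeidealI[OF ring_hom_ring.ideal_vimage[OF I.rcos_ring_hom_ring P.is_ideal] is_cring])
    have "\<one> \<notin> {r \<in> carrier R. I +> r \<in> P}" using P.one_notin by simp
    then show "carrier R \<noteq> {r \<in> carrier R. I +> r \<in> P}" using one_closed by metis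
    show "a \<in> {r \<in> carrier R. I +> r \<in> P} \<or> b \<in> {r \<in> carrier R. I +> r \<in> P}"
      if "a \<in> carrier R" "b \<in> carrier R" "a \<otimes> b \<in> {r \<in> carrier R. I +> r \<in> P}" for a b
      using that P.I_prime[of "I +> a" "I +> b"] by simp
  qed
  show "I \<subseteq> {r \<in> carrier R. I +> r \<in> P}"
  proof
    fix a assume a: "a \<in> I"
    have "I +> a = \<zero>\<^bsub>R Quot I\<^esub>" unfolding zero_Quot by (rule a_rcos_zero[OF I a])
    moreover have "\<zero>\<^bsub>R Quot I\<^esub> \<in> P" using additive_subgroup.zero_closed[OF ideal.axioms(1)[OF P.is_ideal]] .
    ultimately show "a \<in> {r \<in> carrier R. I +> r \<in> P}" using I.Icarr[OF a] by simp
  qed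
qed

lemma (in cring) pchain_to_quotient:
  assumes I: "ideal I R" and ch: "pchain R I n P"
  shows "pchain (R Quot I) {} n ((+>) I ` P)"
proof (rule pchain_map[OF ch])
  interpret I: ideal I R by fact
  show "primeideal ((+>) I ` P) (R Quot I) \<and> {} \<subseteq> (+>) I ` P" if "primeideal P R" "I \<subseteq> P" for P
    using quotient_image_prime[OF I that] by simp
  fix P P' assume P: "primeideal P R" and P': "primeideal P' R" "I \<subseteq> P'" "P' \<subset> P"
  obtain a where a: "a \<in> P" "a \<notin> P'" using P'(3) by blast
  have ac: "a \<in> carrier R" by (rule ideal.Icarr[OF primeideal.axioms(1)[OF P] a(1)])
  have "I +> a \<notin> (+>) I ` P'"
    using I.rcos_image_mem_iff[OF primeideal.axioms(1)[OF P'(1)] P'(2) ac] a(2) by simp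
  moreover have "I +> a \<in> (+>) I ` P" using a(1) by simp
  moreover have "(+>) I ` P' \<subseteq> (+>) I ` P" using P'(3) by (intro image_mono) simp
  ultimately show "(+>) I ` P' \<subset> (+>) I ` P" by (metis psubsetI)
qed

lemma (in cring) pchain_from_quotient:
  assumes I: "ideal I R" and ch: "pchain (R Quot I) {} n P"
  shows "pchain R I n {r \<in> carrier R. I +> r \<in> P}"
proof (rule pchain_map[OF ch])
  show "primeideal {r \<in> carrier R. I +> r \<in> P} R \<and> I \<subseteq> {r \<in> carrier R. I +> r \<in> P}"
    if "primeideal P (R Quot I)" for P
    using quotient_vimage_prime[OF I that] by simp
  fix P P' assume P: "primeideal P (R Quot I)" and P': "P' \<subset> P"
  obtain x where x: "x \<in> P" "x \<notin> P'" using P' by blast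
  have "x \<in> carrier (R Quot I)" by (rule ideal.Icarr[OF primeideal.axioms(1)[OF P] x(1)])
  then obtain a where "a \<in> carrier R" "x = I +> a"
    unfolding carrier_Quot by blast
  then show "{r \<in> carrier R. I +> r \<in> P'} \<subset> {r \<in> carrier R. I +> r \<in> P}"
    using P' x by blast
qed

section \<open>Comparison of chains with Krull dimension and height\<close>

lemma pchain_iff_prime_chain: "pchain R {} n P \<longleftrightarrow> (\<exists>p. prime_chain R p n \<and> p n = P)"
proof
  assume "pchain R {} n P"
  then show "\<exists>p. prime_chain R p n \<and> p n = P"
  proof (induction n arbitrary: P)
    case 0
    then show ?case by (intro exI[of _ "\<lambda>_. P"]) (simp add: prime_chain_def)
  next
    case (Suc n)
    then obtain P' p where P: "primeideal P R" "P' \<subset> P" and p: "prime_chain R p n" "p n = P'"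
      unfolding pchain.simps by blast
    have "prime_chain R (p(Suc n := P)) (Suc n)"
      using P p by (auto simp: prime_chain_def le_Suc_eq less_Suc_eq)
    moreover have "(p(Suc n := P)) (Suc n) = P" by simp
    ultimately show ?case by blast
  qed
next
  assume "\<exists>p. prime_chain R p n \<and> p n = P"
  then obtain p where p: "prime_chain R p n" "p n = P" by blast
  have "pchain R {} k (p k)" if "k \<le> n" for k
    using that
  proof (induction k)
    case (Suc k)
    then have "pchain R {} k (p k)" "p k \<subset> p (Suc k)" "primeideal (p (Suc k)) R"
      using p(1) by (auto simp: prime_chain_def)
    then show ?case unfolding pchain.simps by blast
  qed (use p(1) in \<open>simp add: prime_chain_def\<close>)
  then show "pchain R {} n P" using p(2) by blast
qed

lemma krull_dim_pchain: "krull_dim R = (SUP n \<in> {n. \<exists>P. pchain R {} n P}. ereal (real n))"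
proof -
  have "(\<exists>P. pchain R {} n P) \<longleftrightarrow> (\<exists>p. prime_chain R p n)" for n
    unfolding pchain_iff_prime_chain by blast
  then show ?thesis unfolding krull_dim_def by simp
qed

lemma prime_height_pchain: "prime_height R P = (SUP n \<in> {n. pchain R {} n P}. ereal (real n))"
  unfolding prime_height_def pchain_iff_prime_chain ..

lemma (in cring) krull_dim_quotient_pchain:
  assumes I: "ideal I R"
  shows "krull_dim (R Quot I) = (SUP n \<in> {n. \<exists>P. pchain R I n P}. ereal (real n))"
proof -
  have "(\<exists>P. pchain (R Quot I) {} n P) \<longleftrightarrow> (\<exists>P. pchain R I n P)" for n
    using pchain_to_quotient[OF I] pchain_from_quotient[OF I] by metis
  then show ?thesis unfolding krull_dim_pchain by simp
qed

text \<open>\<open>P0\<close> is the bottom of the given chain, where any chain ending at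
  \<open>P0\<close> can be glued on.\<close>

lemma pchain_append:
  assumes "pchain R I n P"
  shows "\<exists>P0. primeideal P0 R \<and> I \<subseteq> P0 \<and> (\<forall>h. pchain R {} h P0 \<longrightarrow> pchain R {} (h + n) P)"
  using assms
proof (induction n arbitrary: P)
  case (Suc n)
  then obtain P' where P': "P' \<subset> P" "pchain R I n P'" "primeideal P R" unfolding pchain.simps by blast
  obtain P0 where P0: "primeideal P0 R" "I \<subseteq> P0" "\<forall>h. pchain R {} h P0 \<longrightarrow> pchain R {} (h + n) P'"
    using Suc.IH[OF P'(2)] by blast
  have "pchain R {} (h + Suc n) P" if "pchain R {} h P0" for h
  proof -
    have "pchain R {} (h + n) P'" using P0(3) that by blast
    then show ?thesis using P'(1,3) unfolding add_Suc_right pchain.simps by blast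
  qed
  then show ?case using P0(1,2) by blast
qed auto

text \<open>The height of \<open>I\<close> is at most that of the bottom prime of the given chain,
  and every chain ending at this prime continues for \<open>n\<close> more steps.\<close>

lemma ideal_height_add_pchain:
  assumes "pchain R I n P"
  shows "ideal_height R I + ereal (real n) \<le> krull_dim R"
proof -
  obtain P0 where P0: "primeideal P0 R" "I \<subseteq> P0" "\<forall>h. pchain R {} h P0 \<longrightarrow> pchain R {} (h + n) P"
    using pchain_append[OF assms] by blast
  have "ideal_height R I \<le> prime_height R P0"
    unfolding ideal_height_def using P0 by (intro INF_lower) simp
  moreover have "prime_height R P0 + ereal (real n) \<le> krull_dim R"
  proof -
    have "ereal (real h) \<le> krull_dim R - ereal (real n)" if "pchain R {} h P0" for h
    proof -
      have "ereal (real (h + n)) \<le> krull_dim R"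
        unfolding krull_dim_pchain using P0(3) that by (intro SUP_upper) blast
      then show ?thesis by (simp add: ereal_le_minus)
    qed
    then have "prime_height R P0 \<le> krull_dim R - ereal (real n)"
      unfolding prime_height_pchain by (intro SUP_least) simp
    then show ?thesis by (simp add: ereal_le_minus)
  qed
  ultimately show ?thesis by (meson add_right_mono order.trans)
qed

lemma ideal_height_nonneg: "ideal_height R I \<ge> 0"
proof -
  have "0 \<le> prime_height R P" if "primeideal P R" for P
  proof -
    have "ereal (real 0) \<le> prime_height R P"
      unfolding prime_height_pchain using that by (intro SUP_upper) simp
    then show ?thesis by (simp add: zero_ereal_def)
  qed
  then show ?thesis unfolding ideal_height_def by (intro INF_greatest) simp
qed

text \<open>Cardinalities are natural numbers, so the infimum is a minimum as soon as one generating
  set exists.\<close>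

lemma min_generators_attained:
  assumes "finite_generating_set R M A"
  obtains B where "finite_generating_set R M B" "min_generators R M = ereal (real (card B))"
proof -
  obtain B where B: "finite_generating_set R M B"
    "\<And>C. finite_generating_set R M C \<Longrightarrow> card B \<le> card C"
    using ex_has_least_nat[of "finite_generating_set R M" A card] assms by blast
  have "min_generators R M = ereal (real (card B))"
    unfolding min_generators_def
    by (rule antisym) (use B in \<open>auto intro!: INF_lower2[of B] INF_greatest\<close>)
  then show thesis using B(1) that by blast
qed

section \<open>The bound for modules over a local ring\<close>

lemma (in noetherian_cring) prime_subset_maximal:
  assumes local: "\<And>n. maximalideal n R \<Longrightarrow> n = m" and P: "primeideal P R"
  shows "P \<subseteq> m"
proof -
  interpret P: primeideal P R by fact
  let ?F = "{I. ideal I R \<and> P \<subseteq> I \<and> I \<noteq> carrier R}"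
  have "\<exists>n\<in>?F. \<forall>J\<in>?F. n \<subseteq> J \<longrightarrow> J = n"
  proof (rule exists_maximal_ideal_in)
    show "?F \<noteq> {}" using P.is_ideal P.I_notcarr by blast
  qed simp
  then obtain n where n: "n \<in> ?F" "\<forall>J\<in>?F. n \<subseteq> J \<longrightarrow> J = n" by blast
  have "maximalideal n R"
  proof (rule maximalidealI)
    show "J = n \<or> J = carrier R" if "ideal J R" "n \<subseteq> J" for J
      using n that by blast
  qed (use n in auto)
  then show ?thesis using local n(1) by blast
qed

text \<open>The data \<open>a\<close>, \<open>n\<close>, \<open>E\<close>, \<open>u\<close>,
  \<open>c\<close> are chosen for \<open>x\<close> and \<open>Q\<close> before any chain is given,
  so one natural number \<open>r\<close> serves chains of every length.\<close>

theorem (in noetherian_cring) pchain_order_ideal: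
  fixes N :: "('a, 'c, 'n) module_scheme"
  assumes loc: "local_ring R m" and N: "module R N" "finitely_generated_module R N"
    and x: "x \<in> ideal_smult R m N" and Q: "primeideal Q R"
  obtains r where "local_min_generators R Q N = ereal (real r)"
    and "\<And>d P. pchain R Q d P \<Longrightarrow> pchain R (order_ideal R N x) (d - r) m"
    and "ideal (order_ideal R N x) R"
proof -
  interpret N: module R N by fact
  interpret Q: primeideal Q R by fact
  have mmax: "maximalideal m R" and uniq: "\<And>n. maximalideal n R \<Longrightarrow> n = m"
    using loc unfolding local_ring_def by auto
  have m: "primeideal m R" by (rule maximalideal_prime[OF mmax])
  interpret m: primeideal m R by fact
  let ?S = "carrier R - Q"
  have S: "?S \<subseteq> carrier R" "\<one> \<in> ?S" "\<And>s t. s \<in> ?S \<Longrightarrow> t \<in> ?S \<Longrightarrow> s \<otimes> t \<in> ?S"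
    using Q.one_notin Q.mult_notin by auto
  obtain A0 where "finite_generating_set R N A0"
    using N(2) unfolding finitely_generated_module_def by blast
  note gen = N.localization_finitely_generated[where S = ?S, OF S this]
  obtain A where A: "finite_generating_set (localization_ring R ?S) (localization_module R ?S N) A"
    and r: "local_min_generators R Q N = ereal (real (card A))"
    using min_generators_attained[OF gen] unfolding local_min_generators_def by blast
  obtain E where E: "finite E" "E \<subseteq> carrier N" "card E \<le> card A"
    and lift: "\<forall>z\<in>carrier N. \<exists>u\<in>?S. \<exists>c. (\<forall>e\<in>E. c e \<in> carrier R) \<and> u \<odot>\<^bsub>N\<^esub> z = (\<Oplus>\<^bsub>N\<^esub>e\<in>E. c e \<odot>\<^bsub>N\<^esub> e)"
    using N.lift_localization_generators[where S = ?S, OF S A] by blast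
  obtain s :: nat and a n where an: "\<forall>i<s. a i \<in> m \<and> n i \<in> carrier N"
    and xeq: "x = (\<Oplus>\<^bsub>N\<^esub>i\<in>{..<s}. a i \<odot>\<^bsub>N\<^esub> n i)"
    using N.ideal_smult_sum[OF m.is_ideal x] by blast
  have ac: "a i \<in> carrier R" if "i < s" for i using an that m.Icarr by blast
  \<comment> \<open>Multiplier and coefficients are packed into one pair, so that a single choice
    yields both functions \<open>u\<close> and \<open>c\<close>.\<close>
  have "\<forall>i\<in>{..<s}. \<exists>p. fst p \<in> ?S \<and> (\<forall>e\<in>E. snd p e \<in> carrier R) \<and>
      fst p \<odot>\<^bsub>N\<^esub> n i = (\<Oplus>\<^bsub>N\<^esub>e\<in>E. snd p e \<odot>\<^bsub>N\<^esub> e)"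
  proof
    fix i assume "i \<in> {..<s}"
    then have "n i \<in> carrier N" using an by simp
    then obtain u c where "u \<in> ?S" "\<forall>e\<in>E. c e \<in> carrier R" "u \<odot>\<^bsub>N\<^esub> n i = (\<Oplus>\<^bsub>N\<^esub>e\<in>E. c e \<odot>\<^bsub>N\<^esub> e)"
      using lift by blast
    then show "\<exists>p. fst p \<in> ?S \<and> (\<forall>e\<in>E. snd p e \<in> carrier R) \<and>
      fst p \<odot>\<^bsub>N\<^esub> n i = (\<Oplus>\<^bsub>N\<^esub>e\<in>E. snd p e \<odot>\<^bsub>N\<^esub> e)" by (intro exI[of _ "(u, c)"]) simp
  qed
  then obtain p where p: "\<forall>i\<in>{..<s}. fst (p i) \<in> ?S \<and> (\<forall>e\<in>E. snd (p i) e \<in> carrier R) \<and>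
      fst (p i) \<odot>\<^bsub>N\<^esub> n i = (\<Oplus>\<^bsub>N\<^esub>e\<in>E. snd (p i) e \<odot>\<^bsub>N\<^esub> e)" by (rule bchoice[THEN exE])
  define u c where "u = (\<lambda>i. fst (p i))" and "c = (\<lambda>i. snd (p i))"
  have u: "u i \<in> ?S" and c: "\<And>e. e \<in> E \<Longrightarrow> c i e \<in> carrier R"
    and rel: "u i \<odot>\<^bsub>N\<^esub> n i = (\<Oplus>\<^bsub>N\<^esub>e\<in>E. c i e \<odot>\<^bsub>N\<^esub> e)" if "i < s" for i
    using p that unfolding u_def c_def by auto
  have sub: "order_ideal R N x \<subseteq> relation_values R s E u c a"
    unfolding xeq
  proof (rule N.order_ideal_relation_values[OF E(1,2) ac _ _ c rel])
    show "n i \<in> carrier N" if "i < s" for i using an that by blast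
    show "u i \<in> carrier R" if "i < s" for i using u[OF that] by blast
  qed
  have "x \<in> carrier N" unfolding xeq using an ac by (intro N.finsum_closed) auto
  then have id: "ideal (order_ideal R N x) R" by (rule N.ideal_order_ideal)
  have "pchain R (order_ideal R N x) (d - card A) m" if "pchain R Q d P" for d P
  proof -
    have "pchain R (relation_values R s E u c a) (d - card E) m"
    proof (rule pchain_relation_values[OF m _ Q E(1) u c _ that])
      show "P \<subseteq> m" if "primeideal P R" for P by (rule prime_subset_maximal[OF uniq that])
      show "a i \<in> m" if "i < s" for i using an that by blast
    qed
    then have "pchain R (order_ideal R N x) (d - card E) m" using sub by (rule pchain_antimono)
    \<comment> \<open>\<open>E\<close> may have fewer elements than the minimal generating set it
      was lifted from; shortening the chain makes the loss exactly \<open>card A\<close>.\<close>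
    then show ?thesis using E(3) by (rule pchain_le[OF _ diff_le_mono2])
  qed
  then show thesis using r id that by blast
qed

theorem theorem2p2:
  fixes R :: "('a, 'r) ring_scheme"
    and N :: "('a, 'b, 'n) module_scheme"
    and m :: "'a set"
    and x :: 'b
  assumes "noetherian_ring R"
    and "local_ring R m"
    and "module R N"
    and "finitely_generated_module R N"
    and "x \<in> ideal_smult R m N"
  shows "\<forall>Q. minimal_prime R Q \<longrightarrow>
      krull_dim (R Quot order_ideal R N x) \<ge> krull_dim (R Quot Q) - local_min_generators R Q N \<and>
      ideal_height R (order_ideal R N x)
        \<le> krull_dim R - krull_dim (R Quot Q) + local_min_generators R Q N"
proof (intro allI impI)
  fix Q assume "minimal_prime R Q"
  then have Q: "primeideal Q R" by (simp add: minimal_prime_def)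
  have "cring R" using assms(2) by (simp add: local_ring_def)
  then interpret noetherian_cring R
    by (intro noetherian_cring.intro assms(1))
  interpret Q: primeideal Q R by fact
  let ?I = "order_ideal R N x"
  obtain r where r: "local_min_generators R Q N = ereal (real r)"
    and ch: "\<And>d P. pchain R Q d P \<Longrightarrow> pchain R ?I (d - r) m" and id: "ideal ?I R"
    using pchain_order_ideal[OF assms(2-5) Q] by blast
  have dimQ: "krull_dim (R Quot Q) = (SUP n \<in> {n. \<exists>P. pchain R Q n P}. ereal (real n))"
    by (rule krull_dim_quotient_pchain[OF Q.is_ideal])
  have dimI: "krull_dim (R Quot ?I) = (SUP n \<in> {n. \<exists>P. pchain R ?I n P}. ereal (real n))"
    by (rule krull_dim_quotient_pchain[OF id])
  have "ereal (real d) \<le> krull_dim (R Quot ?I) + ereal (real r)" if "pchain R Q d P" for d P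
  proof -
    have "ereal (real (d - r)) \<le> krull_dim (R Quot ?I)"
      unfolding dimI using ch[OF that] by (intro SUP_upper) blast
    then have "ereal (real (d - r)) + ereal (real r) \<le> krull_dim (R Quot ?I) + ereal (real r)"
      by (rule add_right_mono)
    \<comment> \<open>Truncation works in the right direction: for \<open>d < r\<close> the
      right-hand side is \<open>r\<close>.\<close>
    moreover have "ereal (real d) \<le> ereal (real (d - r)) + ereal (real r)" by simp
    ultimately show ?thesis by (rule order.trans[rotated])
  qed
  then have "krull_dim (R Quot Q) \<le> krull_dim (R Quot ?I) + ereal (real r)"
    unfolding dimQ by (intro SUP_least) blast
  then have first: "krull_dim (R Quot Q) - ereal (real r) \<le> krull_dim (R Quot ?I)"
    by (simp add: ereal_minus_le)
  have second: "ideal_height R ?I \<le> krull_dim R - krull_dim (R Quot Q) + ereal (real r)"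
  \<comment> \<open>If \<open>krull_dim R\<close> is infinite, so is the right-hand side by the
    conventions of \<open>ereal\<close>, even when an infinite dimension is subtracted; finiteness
    of the dimension need not be known. In the other case the chain of length \<open>0\<close> at
    \<open>Q\<close> helps to show that all terms are real numbers, which can be rearranged.\<close>
  proof (cases "krull_dim R = \<infinity>")
    case False
    have le: "ideal_height R ?I + ereal (real (d - r)) \<le> krull_dim R" if "pchain R Q d P" for d P
      by (rule ideal_height_add_pchain[OF ch[OF that]])
    have QQ: "pchain R Q 0 Q" using Q by simp
    have "ideal_height R ?I \<le> krull_dim R" using le[OF QQ] by (simp add: zero_ereal_def[symmetric])
    then obtain h D where h: "ideal_height R ?I = ereal h" and D: "krull_dim R = ereal D"
      using False ideal_height_nonneg[of R ?I]
      by (cases "ideal_height R ?I"; cases "krull_dim R") auto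
    have "ereal (real d) \<le> ereal (D + real r - h)" if "pchain R Q d P" for d P
    proof -
      have "h + real (d - r) \<le> D" using le[OF that] by (simp add: h D)
      then show ?thesis by simp
    qed
    then have up: "krull_dim (R Quot Q) \<le> ereal (D + real r - h)"
      unfolding dimQ by (intro SUP_least) blast
    have "ereal (real 0) \<le> krull_dim (R Quot Q)"
      unfolding dimQ using QQ by (intro SUP_upper) blast
    then obtain q where q: "krull_dim (R Quot Q) = ereal q"
      using up by (cases "krull_dim (R Quot Q)") auto
    show ?thesis using up by (simp add: h D q)
  qed simp
  show "krull_dim (R Quot ?I) \<ge> krull_dim (R Quot Q) - local_min_generators R Q N \<and>
      ideal_height R ?I \<le> krull_dim R - krull_dim (R Quot Q) + local_min_generators R Q N"
    unfolding r using first second by simp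
qed

end
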